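(* For every $n>0$, the map $\mathrm{T}$ is a bijection from $\mathcal{M}_n$ to $\mathcal{T}_n$, and $\mathrm{S}$ is its inverse.
   Context: A planar map is a connected graph (loops and multiple edges allowed) embedded in the sphere, considered up to homeomorphism, with a distinguished oriented edge called the root. A planar map is separable if its edges can be partitioned into two nonempty sets such that exactly one vertex is incident to edges of both sets. A non-separable planar map is a planar map with at least two edges that is not separable. $\mathcal{M}_n$ is the set of non-separable planar maps with $n+1$ edges. Rooted plane trees: children of each vertex are linearly ordered; the root has depth $0$; a leaf is a non-root vertex without children, other vertices are internal; the traversal order of leaves (counterclockwise order) is the order in which the depth-first traversal from the root, visiting children in order, meets them. A decorated tree is a rooted plane tree with an integer label $\geq -1$ on each leaf such that: (1) if a leaf $\ell$ has parent of depth $p$, the label of $\ell$ is $<p$; (2) every internal vertex of depth $p>0$ has a descendant leaf with label $\le p-2$; (3) for any vertex $t$ of depth $p$ and any subtree $T'$ rooted at a child of $t$, if a leaf $\ell$ of $T'$ has label $p$ then every leaf of $T'$ preceding $\ell$ in traversal order has label $\ge p$. $\mathcal{T}_n$ is the set of decorated trees with $n$ edges. The map $\mathrm{T}$: for $M$ with root oriented from $v$ to $u$, perform a depth-first exploration of the vertices of $M$ starting from $v$ and the root edge, examining edges around each vertex in clockwise order, each edge examined once. When, from the current vertex $w$, an examined edge leads to an already visited vertex $x$, this edge is replaced by a new leaf attached to $w$ (in the position of that edge) labeled by the depth of $x$ in the exploration tree, with $v$ of depth $-1$. Deleting the edge $\{v,u\}$ yields $\mathrm{T}(M)$, rooted at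 $u$, with plane structure inherited from $M$. The map $\mathrm{S}$: for a decorated tree $T$ rooted at $u$, (1) attach to $u$ a new edge $\{u,v\}$ with a new vertex $v$ (of depth $-1$), made the root and oriented from $v$ to $u$; (2) process the leaves in reverse traversal order; for a leaf $\ell$ with parent $t$ and label $p$, let $s$ be the ancestor of $\ell$ of depth $p$ (with $s=v$ if $p=-1$) and $e$ the first edge of the path from $s$ to $\ell$; replace $\ell$ by an edge from $t$ to $s$ whose end at $s$ is inserted immediately after $e$ in clockwise order around $s$. *)

theory Defs
  imports "HOL-Combinatorics.Orbits" "HOL-Combinatorics.Cycles"
begin

section \<open>Rooted planar maps\<close>

text \<open>
  A map on an oriented surface is encoded by its darts (half-edges): \<open>opp\<close> exchanges the two darts
  of an edge and \<open>rot\<close> sends a dart to the next one in clockwise order around its vertex.  The root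
  is the dart at the origin of the root edge.
\<close>

record 'd cmap =
  darts :: "'d set"
  rot :: "'d \<Rightarrow> 'd"
  opp :: "'d \<Rightarrow> 'd"
  root_dart :: 'd

definition vertex :: "'d cmap \<Rightarrow> 'd \<Rightarrow> 'd set" where
  "vertex m d = orbit (rot m) d"

definition vertices :: "'d cmap \<Rightarrow> 'd set set" where
  "vertices m = vertex m ` darts m"

definition edges :: "'d cmap \<Rightarrow> 'd set set" where
  "edges m = (\<lambda>d. {d, opp m d}) ` darts m"

definition faces :: "'d cmap \<Rightarrow> 'd set set" where
  "faces m = orbit (rot m \<circ> opp m) ` darts m"

definition rooted_map :: "'d cmap \<Rightarrow> bool" where
  "rooted_map m \<longleftrightarrow>
     finite (darts m) \<and> rot m permutes darts m \<and> opp m permutes darts m \<and>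
     (\<forall>d\<in>darts m. opp m d \<noteq> d \<and> opp m (opp m d) = d) \<and>
     root_dart m \<in> darts m \<and>
     (\<forall>d\<in>darts m. \<forall>e\<in>darts m. (d, e) \<in> ({(x, rot m x) |x. True} \<union> {(x, opp m x) |x. True})\<^sup>*)"

text \<open>The underlying surface is the sphere iff Euler's relation holds.\<close>

definition planar_map :: "'d cmap \<Rightarrow> bool" where
  "planar_map m \<longleftrightarrow>
     rooted_map m \<and> card (vertices m) + card (faces m) = card (edges m) + 2"

definition incident :: "'d set \<Rightarrow> 'd set set \<Rightarrow> bool" where
  "incident v E \<longleftrightarrow> (\<exists>e\<in>E. v \<inter> e \<noteq> {})"

definition separable :: "'d cmap \<Rightarrow> bool" where
  "separable m \<longleftrightarrow>
     (\<exists>E1 E2. E1 \<noteq> {} \<and> E2 \<noteq> {} \<and> E1 \<inter> E2 = {} \<and> E1 \<union> E2 = edges m \<and>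
        (\<exists>!v. v \<in> vertices m \<and> incident v E1 \<and> incident v E2))"

definition nonseparable :: "'d cmap \<Rightarrow> bool" where
  "nonseparable m \<longleftrightarrow> planar_map m \<and> card (edges m) \<ge> 2 \<and> \<not> separable m"

text \<open>
  Root-preserving isomorphisms commuting with \<open>rot\<close> and \<open>opp\<close> are the combinatorial counterpart of
  orientation-preserving homeomorphisms of the sphere that respect the roots.  A planar map is an
  isomorphism class of encodings; every class has representatives with darts in \<open>nat\<close>.
\<close>

definition map_iso :: "('d \<Rightarrow> 'e) \<Rightarrow> 'd cmap \<Rightarrow> 'e cmap \<Rightarrow> bool" where
  "map_iso f m m' \<longleftrightarrow>
     bij_betw f (darts m) (darts m') \<and>
     (\<forall>d\<in>darts m. f (rot m d) = rot m' (f d) \<and> f (opp m d) = opp m' (f d)) \<and>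
     f (root_dart m) = root_dart m'"

definition iso_class :: "'d cmap \<Rightarrow> nat cmap set" where
  "iso_class m = {m'. planar_map m' \<and> (\<exists>f. map_iso f m m')}"

definition nonsep_maps :: "nat \<Rightarrow> nat cmap set set" where
  "nonsep_maps n = iso_class ` {m :: nat cmap. nonseparable m \<and> card (edges m) = n + 1}"


section \<open>Decorated trees\<close>

text \<open>
  The root of a tree is always a \<open>Node\<close>, and \<open>Node []\<close> is only allowed there, since a childless
  non-root vertex is a leaf.
\<close>

datatype dtree = Leaf int | Node "dtree list"

text \<open>
  A vertex is addressed by the list of child indices leading to it from the root, so that its depth
  is the length of its address.  Vertices are listed in depth-first (traversal) order, each with the
  subtree hanging from it.
\<close>

lemma size_nth_less [termination_simp]:
  "i < length ts \<Longrightarrow> size (ts ! i) < Suc (size_list size ts)"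
  by (meson less_Suc_eq_le nth_mem size_list_estimation' order_refl)

fun subtrees :: "dtree \<Rightarrow> (nat list \<times> dtree) list" where
  "subtrees (Leaf p) = [([], Leaf p)]"
| "subtrees (Node ts) =
     ([], Node ts) #
     concat (map (\<lambda>i. map (\<lambda>(a, s). (i # a, s)) (subtrees (ts ! i))) [0..<length ts])"

definition tree_vertices :: "dtree \<Rightarrow> nat list set" where
  "tree_vertices t = fst ` set (subtrees t)"

definition leaves :: "dtree \<Rightarrow> (nat list \<times> int) list" where
  "leaves t = [(a, p). (a, Leaf p) \<leftarrow> subtrees t]"

definition labels :: "dtree \<Rightarrow> int list" where
  "labels t = map snd (leaves t)"

definition tree_edges :: "dtree \<Rightarrow> nat" where
  "tree_edges t = card (tree_vertices t - {[]})"

definition plane_tree :: "dtree \<Rightarrow> bool" where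
  "plane_tree t \<longleftrightarrow>
     (\<exists>ts. t = Node ts) \<and> (\<forall>a. (a, Node []) \<in> set (subtrees t) \<longrightarrow> a = [])"

definition decorated :: "dtree \<Rightarrow> bool" where
  "decorated t \<longleftrightarrow>
     plane_tree t \<and>
     (\<forall>p\<in>set (labels t). p \<ge> -1) \<and>
     (\<forall>a i p. (a @ [i], Leaf p) \<in> set (subtrees t) \<longrightarrow> p < int (length a)) \<and>
     (\<forall>a ts. (a, Node ts) \<in> set (subtrees t) \<and> length a > 0 \<longrightarrow>
        (\<exists>p\<in>set (labels (Node ts)). p \<le> int (length a) - 2)) \<and>
     (\<forall>a i s. (a @ [i], s) \<in> set (subtrees t) \<longrightarrow>
        (\<forall>j k. k < j \<and> j < length (labels s) \<and> labels s ! j = int (length a) \<longrightarrow>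
           labels s ! k \<ge> int (length a)))"

definition decorated_trees :: "nat \<Rightarrow> dtree set" where
  "decorated_trees n = {t. decorated t \<and> tree_edges t = n}"


section \<open>From maps to trees\<close>

text \<open>
  \<open>explore k m p ds (dep, ex)\<close> examines the darts \<open>ds\<close> of the current vertex, which has depth \<open>p\<close>;
  \<open>dep\<close> records the visited vertices with their depths and \<open>ex\<close> the darts of the examined edges.
  The result lists the children of the current vertex in order of exploration, i.e. clockwise.
  As the children of a \<open>Node\<close> are in traversal order, which is counterclockwise, they have to be
  reversed.  The number \<open>k\<close> only serves termination: it bounds the number of nested descents, each of
  which visits a new vertex, so the number of darts is always sufficient.
\<close>

fun explore :: "nat \<Rightarrow> 'd cmap \<Rightarrow> int \<Rightarrow> 'd list \<Rightarrow> ('d set \<rightharpoonup> int) \<times> 'd set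
    \<Rightarrow> dtree list \<times> ('d set \<rightharpoonup> int) \<times> 'd set" where
  "explore k m p [] st = ([], st)"
| "explore k m p (d # ds) (dep, ex) =
     (if d \<in> ex then explore k m p ds (dep, ex)
      else
        let x = vertex m (opp m d); ex' = ex \<union> {d, opp m d} in
        case dep x of
          Some q \<Rightarrow>
            let (ts, st) = explore k m p ds (dep, ex') in (Leaf q # ts, st)
        | None \<Rightarrow>
            (case k of
               0 \<Rightarrow> ([], (dep, ex))
             | Suc k' \<Rightarrow>
                 let (us, st) =
                       explore k' m (p + 1) (support (rot m) (opp m d)) (dep(x \<mapsto> p + 1), ex');
                     (ts, st') = explore k m p ds st
                 in (Node (rev us) # ts, st')))"

text \<open>
  The tree explored from \<open>v\<close> has \<open>u\<close> as the first child of its root, and deleting the edge between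
  them leaves the subtree at \<open>u\<close>.
\<close>

definition dfs_tree :: "'d cmap \<Rightarrow> dtree" where
  "dfs_tree m =
     hd (fst (explore (card (darts m)) m (-1) (support (rot m) (root_dart m))
                ([vertex m (root_dart m) \<mapsto> -1], {})))"

context
  fixes f :: "'d \<Rightarrow> 'e" and m :: "'d cmap" and m' :: "'e cmap"
  assumes m: "rooted_map m" and iso: "map_iso f m m'"
begin

lemma iso_facts:
  "inj_on f (darts m)"
  "d \<in> darts m \<Longrightarrow> f (rot m d) = rot m' (f d)"
  "d \<in> darts m \<Longrightarrow> f (opp m d) = opp m' (f d)"
  "d \<in> darts m \<Longrightarrow> opp m d \<in> darts m"
  "d \<in> darts m \<Longrightarrow> rot m d \<in> darts m"
  using m iso by (auto simp: map_iso_def rooted_map_def bij_betw_def permutes_in_image)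

lemma funpow_rot_iso:
  assumes "d \<in> darts m"
  shows "(rot m ^^ i) d \<in> darts m" "(rot m' ^^ i) (f d) = f ((rot m ^^ i) d)"
  using assms by (induction i) (auto simp: iso_facts)

lemma vertex_subset: "d \<in> darts m \<Longrightarrow> vertex m d \<subseteq> darts m"
  by (auto simp: vertex_def orbit_altdef funpow_rot_iso)

lemma vertex_iso: "d \<in> darts m \<Longrightarrow> vertex m' (f d) = f ` vertex m d"
  by (auto simp: vertex_def orbit_altdef funpow_rot_iso)

lemma vertex_iso_eq:
  "d \<in> darts m \<Longrightarrow> e \<in> darts m \<Longrightarrow>
     vertex m' (f d) = vertex m' (f e) \<longleftrightarrow> vertex m d = vertex m e"
  by (simp add: vertex_iso inj_on_image_eq_iff[OF iso_facts(1)] vertex_subset)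

lemma support_iso:
  assumes "d \<in> darts m"
  shows "support (rot m') (f d) = map f (support (rot m) d)"
    and "set (support (rot m) d) \<subseteq> darts m"
proof -
  have "(rot m' ^^ i) (f d) = f d \<longleftrightarrow> (rot m ^^ i) d = d" for i
    using assms by (simp add: funpow_rot_iso inj_on_eq_iff[OF iso_facts(1)])
  then show "support (rot m') (f d) = map f (support (rot m) d)"
    using assms by (simp add: least_power_def funpow_rot_iso)
  show "set (support (rot m) d) \<subseteq> darts m"
    using assms by (auto simp: funpow_rot_iso)
qed

definition st_rel where
  "st_rel st st' \<longleftrightarrow>
     snd st \<subseteq> darts m \<and> snd st' = f ` snd st \<and>
     (\<forall>d\<in>darts m. fst st' (vertex m' (f d)) = fst st (vertex m d))"

lemma explore_iso:
  assumes "set ds \<subseteq> darts m" "st_rel st st'"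
  shows "fst (explore k m' p (map f ds) st') = fst (explore k m p ds st) \<and>
    st_rel (snd (explore k m p ds st)) (snd (explore k m' p (map f ds) st'))"
  using assms
proof (induction k arbitrary: p ds st st' rule: less_induct)
  case (less k)
  note IHk = less.IH
  from less.prems show ?case
  proof (induction ds arbitrary: st st')
    case Nil
    then show ?case by simp
  next
    case (Cons d ds)
    obtain dep ex where st: "st = (dep, ex)" by (cases st)
    obtain dep' ex' where st': "st' = (dep', ex')" by (cases st')
    have d: "d \<in> darts m" and ds: "set ds \<subseteq> darts m" and od: "opp m d \<in> darts m"
      using Cons.prems by (auto simp: iso_facts)
    have ex: "ex \<subseteq> darts m" and ex': "ex' = f ` ex"
      and dep: "\<And>e. e \<in> darts m \<Longrightarrow> dep' (vertex m' (f e)) = dep (vertex m e)"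
      using Cons.prems(2) by (auto simp: st_rel_def st st')
    have mem: "f d \<in> f ` ex \<longleftrightarrow> d \<in> ex"
      using inj_on_image_mem_iff[OF iso_facts(1) d ex] .
    have oo: "opp m' (f d) = f (opp m d)" using d by (simp add: iso_facts)
    define x where "x = vertex m (opp m d)"
    define x' where "x' = vertex m' (f (opp m d))"
    define en where "en = ex \<union> {d, opp m d}"
    have en': "ex' \<union> {f d, f (opp m d)} = f ` en" by (auto simp: en_def ex')
    have depx: "dep' x' = dep x" using dep[OF od] by (simp add: x_def x'_def)
    have rel1: "st_rel (dep, en) (dep', f ` en)"
      using dep d od ex by (auto simp: st_rel_def en_def)
    have rel2: "st_rel (dep(x \<mapsto> p + 1), en) (dep'(x' \<mapsto> p + 1), f ` en)"
      using rel1 od by (auto simp: st_rel_def x_def x'_def vertex_iso_eq)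
    show ?case
    proof (cases "d \<in> ex")
      case True
      have "f d \<in> ex'" using True ex' by simp
      with True Cons.IH[OF ds Cons.prems(2)] show ?thesis by (simp add: st st')
    next
      case False
      then have False': "f d \<notin> ex'" using mem ex' by simp
      show ?thesis
      proof (cases "dep x")
        case (Some q)
        have Some': "dep' x' = Some q" using depx Some by simp
        note IH = Cons.IH[OF ds rel1]
        have L: "explore k m p (d # ds) (dep, ex) =
            (Leaf q # fst (explore k m p ds (dep, en)), snd (explore k m p ds (dep, en)))"
          using False Some
          by (simp add: x_def[symmetric] en_def[symmetric] Let_def case_prod_beta
              del: Un_insert_right)
        have R: "explore k m' p (map f (d # ds)) st' =
            (Leaf q # fst (explore k m' p (map f ds) (dep', f ` en)),
             snd (explore k m' p (map f ds) (dep', f ` en)))"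
          using False' Some' en'
          by (simp add: st' oo x'_def[symmetric] Let_def case_prod_beta del: Un_insert_right)
        show ?thesis unfolding st L R using IH by simp
      next
        case None
        have None': "dep' x' = None" using depx None by simp
        show ?thesis
        proof (cases k)
          case 0
          then show ?thesis using False False' None None' Cons.prems(2) oo
            by (simp add: st st' x_def x'_def Let_def)
        next
          case (Suc k')
          let ?A = "explore k' m (p + 1) (support (rot m) (opp m d)) (dep(x \<mapsto> p + 1), en)"
          let ?A' = "explore k' m' (p + 1) (support (rot m') (f (opp m d)))
            (dep'(x' \<mapsto> p + 1), f ` en)"
          have A: "fst ?A' = fst ?A \<and> st_rel (snd ?A) (snd ?A')"
            using IHk[OF _ support_iso(2)[OF od] rel2, of k' "p + 1"] Suc
            unfolding support_iso(1)[OF od] by simp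
          have B: "fst (explore k m' p (map f ds) (snd ?A')) = fst (explore k m p ds (snd ?A)) \<and>
              st_rel (snd (explore k m p ds (snd ?A))) (snd (explore k m' p (map f ds) (snd ?A')))"
            using Cons.IH[OF ds conjunct2[OF A]] .
          have L: "explore k m p (d # ds) (dep, ex) =
              (Node (rev (fst ?A)) # fst (explore k m p ds (snd ?A)), snd (explore k m p ds (snd ?A)))"
            using False None Suc
            by (simp add: x_def[symmetric] en_def[symmetric] Let_def case_prod_beta
              del: Un_insert_right)
          have R: "explore k m' p (map f (d # ds)) st' =
              (Node (rev (fst ?A')) # fst (explore k m' p (map f ds) (snd ?A')),
               snd (explore k m' p (map f ds) (snd ?A')))"
            using False' None' Suc en'
            by (simp add: st' oo x'_def[symmetric] Let_def case_prod_beta del: Un_insert_right)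
          show ?thesis unfolding st L R using A B by simp
        qed
      qed
    qed
  qed
qed

end

lemma dfs_tree_iso:
  assumes "rooted_map m" "map_iso f m m'"
  shows "dfs_tree m' = dfs_tree m"
proof -
  have r: "root_dart m \<in> darts m" "root_dart m' = f (root_dart m)"
      "card (darts m') = card (darts m)"
    using assms by (auto simp: rooted_map_def map_iso_def bij_betw_same_card)
  have "st_rel f m m' ([vertex m (root_dart m) \<mapsto> -1], {})
          ([vertex m' (f (root_dart m)) \<mapsto> -1], {})"
    using r by (auto simp: st_rel_def[OF assms] vertex_iso_eq[OF assms])
  from explore_iso[OF assms support_iso(2)[OF assms r(1)] this]
  show ?thesis
    by (simp only: dfs_tree_def r support_iso(1)[OF assms r(1)])
qed

definition T_map :: "nat cmap set \<Rightarrow> dtree" where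
  "T_map M = the_elem (dfs_tree ` M)"

lemma T_map_iso_class:
  fixes m :: "nat cmap"
  assumes "planar_map m"
  shows "T_map (iso_class m) = dfs_tree m"
proof -
  have "map_iso id m m" by (simp add: map_iso_def)
  then have "m \<in> iso_class m" using assms by (auto simp: iso_class_def)
  moreover have "dfs_tree m' = dfs_tree m" if "m' \<in> iso_class m" for m'
    using that assms dfs_tree_iso unfolding iso_class_def planar_map_def by blast
  ultimately have "dfs_tree ` iso_class m = {dfs_tree m}" by blast
  then show ?thesis by (simp add: T_map_def)
qed


section \<open>From trees to maps\<close>

text \<open>
  The edges of \<open>S(T)\<close> are indexed by the vertices of \<open>T\<close>: the address \<open>a\<close> stands for the edge from
  \<open>a\<close> to its parent, with \<open>v\<close> as the parent of the root.  The dart \<open>(a, True)\<close> is at the parent's end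
  and \<open>(a, False)\<close> at the end of \<open>a\<close>.  Clockwise around a vertex, the edge to the parent is followed by
  the edges to the children from the last to the first.
\<close>

definition arity :: "dtree \<Rightarrow> nat list \<Rightarrow> nat" where
  "arity t a = card {i. a @ [i] \<in> tree_vertices t}"

fun tree_rot :: "dtree \<Rightarrow> nat list \<times> bool \<Rightarrow> nat list \<times> bool" where
  "tree_rot t (a, True) =
     (if a = [] then (a, True)
      else if last a = 0 then (butlast a, False)
      else (butlast a @ [last a - 1], True))"
| "tree_rot t (a, False) =
     (if arity t a = 0 then (a, False) else (a @ [arity t a - 1], True))"

text \<open>
  For a leaf with address \<open>a\<close> and label \<open>p\<close>, the first edge on the path to it from its ancestor of
  depth \<open>p\<close> has address \<open>take (p + 1) a\<close>.  The dart \<open>(a, False)\<close>, until then alone at its vertex, is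
  inserted right after the upper dart of that edge.
\<close>

fun close_leaf :: "nat list \<times> int \<Rightarrow> (nat list \<times> bool \<Rightarrow> nat list \<times> bool)
    \<Rightarrow> (nat list \<times> bool \<Rightarrow> nat list \<times> bool)" where
  "close_leaf (a, p) r =
     (let e = (take (nat (p + 1)) a, True) in r(e := (a, False), (a, False) := r e))"

definition closure_map :: "dtree \<Rightarrow> (nat list \<times> bool) cmap" where
  "closure_map t =
     (let D = tree_vertices t \<times> UNIV in
      \<lparr>darts = D,
       rot = perm_restrict (fold close_leaf (rev (leaves t)) (tree_rot t)) D,
       opp = perm_restrict (\<lambda>(a, b). (a, \<not> b)) D,
       root_dart = ([], True)\<rparr>)"

definition S_map :: "dtree \<Rightarrow> nat cmap set" where
  "S_map t = iso_class (closure_map t)"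

end

theory Submission
  imports Defs
begin

text \<open>
  The exploration of a map \<open>M\<close> cuts every back edge at its upper end and so leaves a plane tree, whose
  contour visits all darts in one cyclic word. Gluing the end of one back edge back onto the tree
  composes the face permutation with a transposition, which joins a leaf and a corner of the contour by
  a chord and changes the number of faces by one. By Euler's relation \<open>M\<close> is planar iff each gluing
  creates a face, and restricting this to two back edges at a time shows that the chords of a planar
  map do not cross. Non-separability means that every child subtree of a vertex of depth \<open>p \<ge> 0\<close> has a leaf
  of label less than \<open>p\<close>; the chord of that leaf closes off all corners but the one immediately after the
  first edge of the path, so that the position of every back edge is forced to be the one chosen by \<open>S\<close>.
  Conversely, condition (3) says that when a leaf is closed, in reverse traversal order, the leaf and its
  target corner still lie on the same face.
\<close>

section \<open>Cycles of permutations\<close>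

text \<open>Both directions meet in one notion, \<open>explored_map\<close>: a rotation system with
  a tree whose contour lists every dart once and which satisfies what the exploration guarantees.
  Neither connectedness nor planarity is part of it, so it applies to the closure before anything is
  known about its faces. Vertices and edges are counted off the tree, and Euler's relation becomes:
  one more face than back edges. The obstacle is that gluing a back edge may create a face or merge
  two. A gluing adds at most one face and a planar map attains the maximal total, so no gluing may
  merge faces, in whatever order the gluings are made; this is why two chords can be tested in
  isolation. T after S is the identity because the exploration of such a map is forced to return the
  given tree. S after T is the identity because the forced positions make the rotation around every
  vertex a function of the tree; matching two contours of the same shape position by position is
  then an isomorphism.\<close>

definition cyc :: "('a \<Rightarrow> 'a) \<Rightarrow> 'a list \<Rightarrow> bool" where
  "cyc r l \<longleftrightarrow> distinct l \<and> map r l = rotate1 l"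

lemma cyc_nth: "cyc r (x # l) \<Longrightarrow> i \<le> length l \<Longrightarrow> r ((x # l) ! i) = (l @ [x]) ! i"
  by (metis cyc_def length_Cons less_Suc_eq_le nth_map rotate1.simps(2))

lemma cyc_funpow:
  assumes "cyc r (x # l)" "i \<le> length l"
  shows "(r ^^ i) x = (x # l) ! i"
  using assms(2)
proof (induction i)
  case (Suc i)
  then have "(r ^^ Suc i) x = r ((x # l) ! i)" by simp
  also have "\<dots> = (l @ [x]) ! i" using cyc_nth[OF assms(1), of i] Suc by simp
  finally show ?case using Suc by (simp add: nth_append)
qed simp

lemma cyc_support:
  assumes "cyc r (x # l)"
  shows "support r x = x # l"
proof -
  have 1: "(r ^^ Suc (length l)) x = x"
    using cyc_funpow[OF assms, of "length l"] cyc_nth[OF assms, of "length l"]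
    by (simp add: nth_append)
  have 2: "Suc (length l) \<le> n" if "(r ^^ n) x = x" "n > 0" for n
  proof (rule ccontr)
    assume "\<not> Suc (length l) \<le> n"
    then have "n \<le> length l" by simp
    with cyc_funpow[OF assms this] that have "l ! (n - 1) = x" "n - 1 < length l" by auto
    then show False using assms by (metis cyc_def distinct.simps(2) nth_mem)
  qed
  have "least_power r x = Suc (length l)"
    unfolding least_power_def by (rule Least_equality) (use 1 2 in auto)
  then show ?thesis
    using cyc_funpow[OF assms] by (intro nth_equalityI) (auto simp del: upt_Suc)
qed

lemma cyc_set_closed: "cyc r l \<Longrightarrow> r ` set l = set l"
  by (metis cyc_def list.set_map set_rotate1)

lemma cyc_subset_orbit:
  assumes "cyc r (x # l)"
  shows "orbit r x = set (x # l)"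
proof
  show "orbit r x \<subseteq> set (x # l)"
  proof
    fix y assume "y \<in> orbit r x"
    then show "y \<in> set (x # l)"
      by induct (metis cyc_set_closed[OF assms] imageI list.set_intros(1),
        metis cyc_set_closed[OF assms] imageI)
  qed
  show "set (x # l) \<subseteq> orbit r x"
  proof
    fix y assume "y \<in> set (x # l)"
    then obtain i where i: "i \<le> length l" "y = (x # l) ! i"
      by (metis in_set_conv_nth length_Cons less_Suc_eq_le)
    show "y \<in> orbit r x"
    proof (cases "i = 0")
      case False
      then show ?thesis using i cyc_funpow[OF assms i(1)] funpow_in_orbit orbit_altdef
        by (metis (mono_tags, lifting) mem_Collect_eq neq0_conv)
    next
      case True
      have "(r ^^ Suc (length l)) x = x"
        using cyc_funpow[OF assms, of "length l"] cyc_nth[OF assms, of "length l"]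
        by (simp add: nth_append)
      then show ?thesis using True i unfolding orbit_altdef
        by (metis (mono_tags, lifting) mem_Collect_eq nth_Cons_0 zero_less_Suc)
    qed
  qed
qed

lemma cyc_rotate1: "cyc r l \<Longrightarrow> cyc r (rotate1 l)"
  by (simp add: cyc_def rotate1_map[symmetric])

lemma cyc_rotate: "cyc r l \<Longrightarrow> cyc r (rotate n l)"
  by (induction n) (auto simp: cyc_rotate1)

lemma cyc_append_swap: "cyc r (A @ B) \<Longrightarrow> cyc r (B @ A)"
  using cyc_rotate[of r "A @ B" "length A"] by (simp add: rotate_append)

lemma cyc_orbit:
  assumes "cyc r l" "x \<in> set l"
  shows "orbit r x = set l"
proof -
  obtain A B where l: "l = A @ x # B" using assms(2) by (meson split_list)
  have "cyc r (x # B @ A)" using cyc_append_swap[of r A "x # B"] assms l by simp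
  from cyc_subset_orbit[OF this] show ?thesis using l by auto
qed

lemma support_cyc:
  assumes "permutation r"
  shows "cyc r (support r x)" and "support r x \<noteq> []" and "hd (support r x) = x"
proof -
  let ?n = "least_power r x"
  have n: "(r ^^ ?n) x = x" "?n > 0"
    using least_power_of_permutation[OF assms] by auto
  then obtain k where k: "?n = Suc k" by (metis gr0_implies_Suc)
  have "map r (support r x) = map (\<lambda>i. (r ^^ Suc i) x) [0..<Suc k]" by (simp add: k comp_def)
  also have "\<dots> = map (\<lambda>i. (r ^^ i) x) [Suc 0..<Suc (Suc k)]"
    by (simp only: map_Suc_upt[symmetric] map_map comp_def)
  also have "\<dots> = rotate1 (support r x)"
    using n k by (simp add: upt_conv_Cons[of 0 "Suc k"] del: upt_Suc)
      (simp add: upt_Suc_append)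
  finally show "cyc r (support r x)" using cycle_of_permutation[OF assms] by (simp add: cyc_def)
  show "support r x \<noteq> []" using k by simp
  show "hd (support r x) = x" by (simp add: k upt_conv_Cons del: upt_Suc)
qed

lemma support_eq_Cons:
  assumes "permutation r"
  shows "support r x = x # tl (support r x)"
  using support_cyc(2,3)[OF assms, of x] by (metis list.collapse)

lemma permutes_permutation: "f permutes D \<Longrightarrow> finite D \<Longrightarrow> permutation f"
  using permutation_permutes by blast

section \<open>Transpositions acting on cycles\<close>

lemma cyc_append_iff:
  "cyc r (x # A @ y # B) \<longleftrightarrow>
     distinct (x # A @ y # B) \<and> map r (x # A) = A @ [y] \<and> map r (y # B) = B @ [x]"
proof -
  have "map r (x # A @ y # B) = (A @ [y]) @ (B @ [x]) \<longleftrightarrow>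
      map r (x # A) = A @ [y] \<and> map r (y # B) = B @ [x]"
    using append_eq_append_conv[of "map r (x # A)" "A @ [y]" "map r (y # B)" "B @ [x]"] by simp
  then show ?thesis by (simp add: cyc_def)
qed

lemma cyc_Cons_iff: "cyc r (x # A) \<longleftrightarrow> distinct (x # A) \<and> map r (x # A) = A @ [x]"
  by (simp add: cyc_def)

lemma map_transpose_other:
  "x \<notin> set A \<Longrightarrow> y \<notin> set A \<Longrightarrow> map (r \<circ> transpose x y) A = map r A"
  by (auto simp: transpose_def)

lemma cyc_transpose_other:
  "cyc r l \<Longrightarrow> x \<notin> set l \<Longrightarrow> y \<notin> set l \<Longrightarrow> cyc (r \<circ> transpose x y) l"
  unfolding cyc_def by (metis map_transpose_other)

text \<open>Composition with the transposition exchanges the successors of \<open>x\<close> and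
  \<open>y\<close>: \<open>x\<close> now continues with the successor of \<open>y\<close>, and the
  arc behind \<open>x\<close> closes up at \<open>y\<close>. Cycles are kept as lists because later
  arguments need to know which darts lie on which arc.\<close>

lemma cyc_split0:
  assumes "cyc r (x # B @ y # C)"
  shows "cyc (r \<circ> transpose x y) (x # C)" "cyc (r \<circ> transpose x y) (B @ [y])"
proof -
  have d: "distinct (x # B @ y # C)" and 1: "r x # map r B = B @ [y]" and 2: "r y # map r C = C @ [x]"
    using assms by (auto simp: cyc_append_iff)
  have B: "map (r \<circ> transpose x y) B = map r B" and C: "map (r \<circ> transpose x y) C = map r C"
    using d by (auto intro!: map_transpose_other simp del: map_eq_conv)
  show "cyc (r \<circ> transpose x y) (x # C)"
    unfolding cyc_Cons_iff list.map C using d 2 by simp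
  have "cyc (r \<circ> transpose x y) (y # B)"
    unfolding cyc_Cons_iff list.map B using d 1 by simp
  then show "cyc (r \<circ> transpose x y) (B @ [y])"
    using cyc_append_swap[of _ "[y]" B] by simp
qed

lemma cyc_split:
  assumes "cyc r (A @ x # B @ y # C)"
  shows "cyc (r \<circ> transpose x y) (A @ x # C)" "cyc (r \<circ> transpose x y) (B @ [y])"
proof -
  have "cyc r (x # B @ y # (C @ A))" using cyc_append_swap[OF assms] by simp
  from cyc_split0[OF this] show "cyc (r \<circ> transpose x y) (A @ x # C)"
    "cyc (r \<circ> transpose x y) (B @ [y])"
    using cyc_append_swap[of _ "x # C" A] by auto
qed

lemma cyc_merge:
  assumes "cyc r (x # A)" "cyc r (y # B)" "set (x # A) \<inter> set (y # B) = {}"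
  shows "cyc (r \<circ> transpose x y) (x # B @ y # A)"
proof -
  have A: "map (r \<circ> transpose x y) A = map r A" and B: "map (r \<circ> transpose x y) B = map r B"
    using assms by (auto intro!: map_transpose_other simp: cyc_def simp del: map_eq_conv)
  show ?thesis unfolding cyc_append_iff list.map A B
    using assms by (auto simp: cyc_Cons_iff)
qed

text \<open>Serves the closure, whose rotation arises from function updates: exhibiting a cycle
  through each dart gives surjectivity on a finite set, and injectivity follows.\<close>

lemma cyc_permutes:
  assumes "\<And>x. x \<in> D \<Longrightarrow> \<exists>l. cyc r l \<and> x \<in> set l \<and> set l \<subseteq> D" "finite D"
  shows "perm_restrict r D permutes D"
proof (rule bij_imp_permutes)
  have "r x \<in> D \<and> x \<in> r ` D" if x: "x \<in> D" for x
  proof -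
    obtain l where l: "cyc r l" "x \<in> set l" "set l \<subseteq> D" using assms(1)[OF x] by blast
    have "r x \<in> set l" using cyc_set_closed[OF l(1)] l(2) by (metis imageI)
    moreover have "x \<in> r ` set l" using cyc_set_closed[OF l(1)] l(2) by simp
    ultimately show ?thesis using l(3) by auto
  qed
  then have "r ` D = D" by blast
  then have "perm_restrict r D ` D = D" by (auto simp: perm_restrict_def)
  then show "bij_betw (perm_restrict r D) D D"
    using assms(2) by (simp add: bij_betw_def eq_card_imp_inj_on)
qed (auto simp: perm_restrict_def)


subsection \<open>Counting cycles\<close>

definition ncyc :: "('a \<Rightarrow> 'a) \<Rightarrow> 'a set \<Rightarrow> nat" where
  "ncyc f D = card (orbit f ` D)"

text \<open>The orbits of \<open>x\<close> and \<open>y\<close> are replaced by their union, while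
  \<open>R\<close>, the set of all other orbits, is the same for both permutations.\<close>

lemma ncyc_merge:
  assumes f: "f permutes D" "finite D" and xy: "x \<in> D" "y \<in> D" "y \<notin> orbit f x"
  shows "ncyc f D = Suc (ncyc (f \<circ> transpose x y) D)"
proof -
  have perm: "permutation f" using f permutes_permutation by blast
  let ?g = "f \<circ> transpose x y"
  obtain A where A: "cyc f (x # A)" using support_cyc(1)[OF perm, of x] support_eq_Cons[OF perm, of x]
    by metis
  obtain B where B: "cyc f (y # B)" using support_cyc(1)[OF perm, of y] support_eq_Cons[OF perm, of y]
    by metis
  have Ox: "orbit f x = set (x # A)" and Oy: "orbit f y = set (y # B)"
    using A B cyc_orbit[of f _ x] cyc_orbit[of f _ y] by auto
  have part: "orbit f u = orbit f w" if "z \<in> orbit f u" "z \<in> orbit f w" for u w z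
    using that perm by (metis cyclic_on_orbit' orbit_cyclic_eq3)
  have self: "z \<in> orbit f z" for z using permutation_self_in_orbit[OF perm] .
  have disj: "set (x # A) \<inter> set (y # B) = {}"
    using part[of _ x y] Ox Oy xy(3) self[of y] by auto
  have M: "cyc ?g (x # B @ y # A)" using cyc_merge[OF A B disj] .
  define R where "R = orbit f ` (D - orbit f x - orbit f y)"
  have sub: "orbit f x \<subseteq> D" "orbit f y \<subseteq> D" using permutes_orbit_subset[OF f(1)] xy by auto
  have og: "orbit ?g z = orbit f z" if "z \<in> D - orbit f x - orbit f y" for z
  proof -
    have c: "cyc f (support f z)" using support_cyc(1)[OF perm] .
    have z: "z \<in> set (support f z)" using support_cyc(2,3)[OF perm, of z] by (metis list.set_sel(1))
    have o: "orbit f z = set (support f z)" using cyc_orbit[OF c z] .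
    have "x \<notin> orbit f z" "y \<notin> orbit f z" using that self part[of _ _ z] by blast+
    then have "cyc ?g (support f z)" using cyc_transpose_other[OF c] o by metis
    from cyc_orbit[OF this z] o show ?thesis by simp
  qed
  have of_: "orbit f z = orbit f x" if "z \<in> orbit f x" for z using part[of z] self that by blast
  have of_': "orbit f z = orbit f y" if "z \<in> orbit f y" for z using part[of z] self that by blast
  have og': "orbit ?g z = orbit f x \<union> orbit f y" if "z \<in> orbit f x \<union> orbit f y" for z
    using cyc_orbit[OF M, of z] that Ox Oy by auto
  have D: "D = (D - orbit f x - orbit f y) \<union> orbit f x \<union> orbit f y" using sub by auto
  have 1: "orbit f ` D = R \<union> {orbit f x, orbit f y}"
  proof -
    have "orbit f ` D = R \<union> orbit f ` orbit f x \<union> orbit f ` orbit f y"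
      by (subst D) (simp only: image_Un R_def)
    also have "orbit f ` orbit f x = (\<lambda>_. orbit f x) ` orbit f x"
      by (rule image_cong[OF refl of_])
    also have "\<dots> = {orbit f x}" by (rule image_constant[OF self])
    also have "orbit f ` orbit f y = (\<lambda>_. orbit f y) ` orbit f y"
      by (rule image_cong[OF refl of_'])
    also have "\<dots> = {orbit f y}" by (rule image_constant[OF self])
    finally show ?thesis by auto
  qed
  have 2: "orbit ?g ` D = R \<union> {orbit f x \<union> orbit f y}"
  proof -
    have "orbit ?g ` D = orbit ?g ` (D - orbit f x - orbit f y) \<union> orbit ?g ` (orbit f x \<union> orbit f y)"
      by (subst D) (simp only: image_Un Un_assoc)
    also have "orbit ?g ` (D - orbit f x - orbit f y) = R"
      unfolding R_def by (rule image_cong[OF refl og])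
    also have "orbit ?g ` (orbit f x \<union> orbit f y) = (\<lambda>_. orbit f x \<union> orbit f y) ` (orbit f x \<union> orbit f y)"
      by (rule image_cong[OF refl og'])
    also have "\<dots> = {orbit f x \<union> orbit f y}" by (rule image_constant[OF UnI1[OF self]])
    finally show ?thesis .
  qed
  have fin: "finite R" using f by (simp add: R_def)
  have nR: "orbit f x \<notin> R" "orbit f y \<notin> R" using self unfolding R_def by (metis (no_types, lifting) DiffE imageE)+
  have nR': "orbit f x \<union> orbit f y \<notin> R"
  proof
    assume "orbit f x \<union> orbit f y \<in> R"
    then obtain z where "z \<in> D - orbit f x - orbit f y" "orbit f x \<union> orbit f y = orbit f z"
      by (auto simp: R_def)
    then show False using self[of z] by auto
  qed
  have ne: "orbit f x \<noteq> orbit f y" using xy(3) self by blast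
  have "card (R \<union> {orbit f x, orbit f y}) = card R + 2" using fin nR ne by simp
  moreover have "card (R \<union> {orbit f x \<union> orbit f y}) = card R + 1" using fin nR' by simp
  ultimately show ?thesis unfolding ncyc_def 1 2 by simp
qed

lemma permutes_comp_transpose:
  "f permutes D \<Longrightarrow> x \<in> D \<Longrightarrow> y \<in> D \<Longrightarrow> (f \<circ> transpose x y) permutes D"
  by (metis permutes_compose permutes_swap_id)

text \<open>A transposition is an involution, so this is \<open>ncyc_merge\<close> read backwards:
  after the composition \<open>x\<close> and \<open>y\<close> lie in different orbits, and composing
  once more restores \<open>f\<close>.\<close>

lemma ncyc_split:
  assumes f: "f permutes D" "finite D" and xy: "x \<in> D" "y \<in> orbit f x" "x \<noteq> y"
  shows "ncyc (f \<circ> transpose x y) D = Suc (ncyc f D)"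
proof -
  have perm: "permutation f" using f permutes_permutation by blast
  let ?g = "f \<circ> transpose x y"
  have yD: "y \<in> D" using permutes_orbit_subset[OF f(1) xy(1)] xy(2) by auto
  have g: "?g permutes D" using permutes_comp_transpose f xy yD by metis
  obtain A where A: "cyc f (x # A)" using support_cyc(1)[OF perm, of x] support_eq_Cons[OF perm, of x]
    by metis
  then have "y \<in> set A" using xy cyc_orbit[OF A, of x] by auto
  then obtain B C where "A = B @ y # C" by (meson split_list)
  with A have c: "cyc f (x # B @ y # C)" by simp
  have "orbit ?g x = set (x # C)" using cyc_orbit[OF cyc_split0(1)[OF c], of x] by simp
  moreover have "y \<notin> set (x # C)" using c by (auto simp: cyc_def)
  ultimately have "ncyc ?g D = Suc (ncyc (?g \<circ> transpose x y) D)"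
    using ncyc_merge[OF g f(2) xy(1) yD] by simp
  also have "?g \<circ> transpose x y = f" by (simp add: comp_assoc)
  finally show ?thesis .
qed

lemma ncyc_transpose_le:
  assumes "f permutes D" "finite D" "x \<in> D" "y \<in> D"
  shows "ncyc (f \<circ> transpose x y) D \<le> Suc (ncyc f D)"
proof (cases "x = y")
  case False
  show ?thesis
  proof (cases "y \<in> orbit f x")
    case True
    with False show ?thesis using ncyc_split[OF assms(1-3) True] by simp
  next
    case False
    then show ?thesis using ncyc_merge[OF assms] by simp
  qed
qed simp


section \<open>Exploration trees annotated with darts\<close>

text \<open>
  Children are listed clockwise, and the dart of a subtree is the upper dart of the edge leading to it.
  The word lists the darts in the order of the contour of the tree, and \<open>aleaves\<close> lists the leaves in
  traversal order, i.e. against the contour.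
\<close>

datatype 'd atree = AL (dart: 'd) int | AN (dart: 'd) "'d atree list"

fun word :: "('d \<Rightarrow> 'd) \<Rightarrow> 'd atree \<Rightarrow> 'd list" where
  "word op (AL d q) = [d, op d]"
| "word op (AN d ts) = d # concat (map (word op) ts) @ [op d]"

abbreviation words :: "('d \<Rightarrow> 'd) \<Rightarrow> 'd atree list \<Rightarrow> 'd list" where
  "words op ts \<equiv> concat (map (word op) ts)"

fun aleaves :: "'d atree \<Rightarrow> ('d \<times> int) list" where
  "aleaves (AL d q) = [(d, q)]"
| "aleaves (AN d ts) = concat (map aleaves (rev ts))"

fun ndarts :: "'d atree \<Rightarrow> 'd list" where
  "ndarts (AL d q) = []"
| "ndarts (AN d ts) = d # concat (map ndarts ts)"

fun erase :: "'d atree \<Rightarrow> dtree" where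
  "erase (AL d q) = Leaf q"
| "erase (AN d ts) = Node (rev (map erase ts))"

text \<open>The opposite of the dart of a leaf is the upper end of its back edge.\<close>

definition backs :: "('d \<Rightarrow> 'd) \<Rightarrow> 'd atree \<Rightarrow> 'd set" where
  "backs op c = op ` fst ` set (aleaves c)"

definition ups :: "('d \<Rightarrow> 'd) \<Rightarrow> int \<Rightarrow> 'd atree \<Rightarrow> 'd list" where
  "ups op p c = map (op \<circ> fst) (filter (\<lambda>(d, q). q = p) (aleaves c))"

text \<open>
  The form of the list \<open>ds\<close> of darts around a vertex with children \<open>ts\<close>: a dart of \<open>ds\<close> that is not a
  child edge has been examined before, so it lies in \<open>E\<close> or ends a back edge from an earlier child.
\<close>

fun splits :: "('d \<Rightarrow> 'd) \<Rightarrow> 'd set \<Rightarrow> 'd atree list \<Rightarrow> 'd list \<Rightarrow> bool" where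
  "splits op E [] ds \<longleftrightarrow> set ds \<subseteq> E"
| "splits op E (c # ts) ds \<longleftrightarrow>
     (\<exists>Y ds'. ds = Y @ dart c # ds' \<and> set Y \<subseteq> E \<and> splits op (E \<union> backs op c) ts ds')"

text \<open>
  The path lists, for the ancestors of a subtree from \<open>v\<close> downwards, the dart through which each
  of them was entered (the root dart in the case of \<open>v\<close>); hence the index in the path is depth plus one.
\<close>

fun explored :: "'d cmap \<Rightarrow> 'd list \<Rightarrow> 'd atree \<Rightarrow> bool" where
  "explored m path (AL d q) \<longleftrightarrow> (\<exists>i<length path. q = int i - 1 \<and> opp m d \<in> vertex m (path ! i))"
| "explored m path (AN d ts) \<longleftrightarrow>
     splits (opp m) {} ts (tl (support (rot m) (opp m d))) \<and>
     (\<forall>c\<in>set ts. explored m (path @ [opp m d]) c)"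

lemma hd_word: "\<exists>w. word op c = dart c # w"
  by (cases c) auto

lemma last_word: "\<exists>w. word op c = w @ [op (dart c)]"
  by (cases c) auto

lemma dart_in_word: "dart c \<in> set (word op c)" "op (dart c) \<in> set (word op c)"
  by (cases c; auto)+

lemma backs_AL [simp]: "backs op (AL d q) = {op d}"
  by (simp add: backs_def)

lemma backs_AN [simp]: "backs op (AN d ts) = (\<Union>c\<in>set ts. backs op c)"
  by (auto simp: backs_def)

lemma set_ups: "set (ups op p c) = {op d |d. (d, p) \<in> set (aleaves c)}"
  by (force simp: ups_def)

lemma ups_subset_backs: "set (ups op p c) \<subseteq> backs op c"
  by (force simp: set_ups backs_def)

lemma set_word_eq:
  "set (word op c) = fst ` set (aleaves c) \<union> set (ndarts c) \<union> op ` (fst ` set (aleaves c) \<union> set (ndarts c))"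
  by (induction c) (auto 0 4)

lemma backs_subset_word: "backs op c \<subseteq> set (word op c)"
  by (auto simp: set_word_eq backs_def)

abbreviation fleaves :: "'d atree list \<Rightarrow> ('d \<times> int) list" where
  "fleaves ts \<equiv> concat (map aleaves (rev ts))"

abbreviation fnodes :: "'d atree list \<Rightarrow> 'd list" where
  "fnodes ts \<equiv> concat (map ndarts ts)"

text \<open>Up to order the contour consists of the upper and the lower darts of all edges; passing
  to multisets lets distinctness of the contour carry over to these classes.\<close>

lemma mset_word:
  "mset (word op c) = mset (map fst (aleaves c)) + mset (ndarts c) +
     image_mset op (mset (map fst (aleaves c)) + mset (ndarts c))"
proof (induction c)
  case (AN d ts)
  have "mset (words op ts) = mset (map fst (fleaves ts)) + mset (fnodes ts) +
     image_mset op (mset (map fst (fleaves ts)) + mset (fnodes ts))"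
    using AN by (induction ts) (auto simp: ac_simps)
  then show ?case by simp
qed simp

lemma distinct_words_darts:
  assumes "distinct (words op ts)"
  shows "distinct (map fst (fleaves ts))" "distinct (fnodes ts)"
    "fst ` set (fleaves ts) \<inter> set (fnodes ts) = {}"
    "(fst ` set (fleaves ts) \<union> set (fnodes ts)) \<inter> op ` (fst ` set (fleaves ts) \<union> set (fnodes ts)) = {}"
proof -
  let ?l = "map fst (fleaves ts) @ fnodes ts"
  have "mset (words op ts) = mset ?l + image_mset op (mset ?l)"
    by (induction ts) (simp_all add: mset_word ac_simps)
  then have "mset (words op ts) = mset (?l @ map op ?l)"
    by (simp add: multiset.map_comp)
  then have d: "distinct (?l @ map op ?l)" using assms mset_eq_imp_distinct_iff by blast
  have gen: "distinct F \<and> distinct N \<and> set F \<inter> set N = {} \<and>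
      (set F \<union> set N) \<inter> op ` (set F \<union> set N) = {}"
    if "distinct ((F @ N) @ map op (F @ N))" for F N
    using that by auto
  show "distinct (map fst (fleaves ts))" "distinct (fnodes ts)"
    "fst ` set (fleaves ts) \<inter> set (fnodes ts) = {}"
    "(fst ` set (fleaves ts) \<union> set (fnodes ts)) \<inter> op ` (fst ` set (fleaves ts) \<union> set (fnodes ts)) = {}"
    using gen[OF d] unfolding set_map by blast+
qed

lemma set_words_eq:
  "set (words op ts) = fst ` set (fleaves ts) \<union> set (fnodes ts) \<union> op ` (fst ` set (fleaves ts) \<union> set (fnodes ts))"
  by (induction ts) (auto simp: set_word_eq image_Un)

text \<open>Only the darts of \<open>ds\<close> are ever compared with \<open>E\<close>.\<close>

lemma splits_mono:
  "splits op E ts ds \<Longrightarrow> E \<inter> set ds \<subseteq> E' \<Longrightarrow> splits op E' ts ds"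
proof (induction ts arbitrary: E E' ds)
  case (Cons c ts)
  then obtain Y ds' where 1: "ds = Y @ dart c # ds'" "set Y \<subseteq> E" "splits op (E \<union> backs op c) ts ds'"
    by auto
  have "splits op (E' \<union> backs op c) ts ds'"
    using Cons.IH[OF 1(3), of "E' \<union> backs op c"] Cons.prems(2) 1(1) by auto
  moreover have "set Y \<subseteq> E'" using 1 Cons.prems(2) by auto
  ultimately show ?case using 1(1) by auto
qed auto

lemma splits_subset:
  "splits op E ts ds \<Longrightarrow> set ds \<subseteq> E \<union> dart ` set ts \<union> (\<Union>c\<in>set ts. backs op c)"
  by (induction ts arbitrary: E ds) fastforce+

lemma splits_darts: "splits op E ts ds \<Longrightarrow> dart ` set ts \<subseteq> set ds"
  by (induction ts arbitrary: E ds) fastforce+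

text \<open>The block \<open>Ys ! i\<close> behind the dart of child \<open>i\<close> consists of
  ends of edges examined before; apart from \<open>E\<close>, these are back edges from that child
  or from the children before it.\<close>

lemma splits_form:
  assumes "splits op E ts ds"
  shows "\<exists>Y Ys. length Ys = length ts \<and> ds = Y @ concat (map2 (\<lambda>c Y. dart c # Y) ts Ys) \<and>
     set Y \<subseteq> E \<and> (\<forall>i<length ts. set (Ys ! i) \<subseteq> E \<union> (\<Union>c\<in>set (take (Suc i) ts). backs op c))"
  using assms
proof (induction ts arbitrary: E ds)
  case (Cons c ts)
  then obtain Y ds' where 1: "ds = Y @ dart c # ds'" "set Y \<subseteq> E" "splits op (E \<union> backs op c) ts ds'"
    by auto
  from Cons.IH[OF 1(3)] obtain Z Zs where 2: "length Zs = length ts"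
    "ds' = Z @ concat (map2 (\<lambda>c Y. dart c # Y) ts Zs)" "set Z \<subseteq> E \<union> backs op c"
    "\<forall>i<length ts. set (Zs ! i) \<subseteq> E \<union> backs op c \<union> (\<Union>c\<in>set (take (Suc i) ts). backs op c)"
    by auto
  have "\<forall>i<length (c # ts). set ((Z # Zs) ! i) \<subseteq> E \<union> (\<Union>c\<in>set (take (Suc i) (c # ts)). backs op c)"
  proof (intro allI impI)
    fix i assume "i < length (c # ts)"
    then show "set ((Z # Zs) ! i) \<subseteq> E \<union> (\<Union>c\<in>set (take (Suc i) (c # ts)). backs op c)"
      using 2(1,3) spec[OF 2(4), of "i - 1"] by (cases i) auto
  qed
  then show ?case using 1 2 by (intro exI[of _ Y] exI[of _ "Z # Zs"]) auto
qed auto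

section \<open>Leaves and labels of erased trees\<close>

lemma leaves_Leaf [simp]: "leaves (Leaf q) = [([], q)]"
  by (simp add: leaves_def)

lemma leaves_Node:
  "leaves (Node us) = concat (map (\<lambda>i. map (\<lambda>(a, q). (i # a, q)) (leaves (us ! i))) [0..<length us])"
proof -
  \<comment> \<open>\<open>g\<close> names the pattern match hidden in the list comprehension of
    \<open>leaves\<close>, so that \<open>concat\<close> can be moved through it.\<close>
  define g :: "nat list \<times> dtree \<Rightarrow> (nat list \<times> int) list" where
    "g = (\<lambda>x. case x of (a, Leaf p) \<Rightarrow> [(a, p)] | (a, _) \<Rightarrow> [])"
  have 1: "leaves t = concat (map g (subtrees t))" for t
    by (simp add: leaves_def g_def)
  have 2: "concat (map g (map (\<lambda>(a, s). (i # a, s)) xs)) = map (\<lambda>(a, q). (i # a, q)) (concat (map g xs))"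
    for i xs
    by (induction xs) (auto simp: g_def split: dtree.splits)
  have 3: "concat (map g (concat xss)) = concat (map (\<lambda>xs. concat (map g xs)) xss)" for xss
    by (induction xss) auto
  have "leaves (Node us) = concat (map (\<lambda>i. concat (map g (map (\<lambda>(a, s). (i # a, s)) (subtrees (us ! i)))))
      [0..<length us])"
    by (simp add: 1 3 comp_def) (simp add: g_def)
  then show ?thesis by (simp only: 2 1)
qed

lemma labels_Node: "labels (Node us) = concat (map labels us)"
proof -
  have "labels (Node us) = concat (map (\<lambda>i. labels (us ! i)) [0..<length us])"
    by (simp add: labels_def leaves_Node map_concat comp_def case_prod_beta)
  also have "map (\<lambda>i. labels (us ! i)) [0..<length us] = map labels us"
    by (rule nth_equalityI) auto
  finally show ?thesis .
qed

lemma labels_erase: "labels (erase c) = map snd (aleaves c)"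
proof (induction c)
  case (AL d q)
  then show ?case by (simp add: labels_def leaves_def)
next
  case (AN d ts)
  show ?case using AN by (simp add: labels_Node map_concat rev_map[symmetric] comp_def cong: map_cong)
qed


section \<open>Maps with an exploration tree\<close>

text \<open>All of \<open>rooted_map\<close> except connectedness, which for the closure of a tree
  comes out of the exploration tree (\<open>rooted\<close>).\<close>

locale premap =
  fixes m :: "'d cmap"
  assumes finite_darts: "finite (darts m)"
    and rot_permutes: "rot m permutes darts m"
    and opp_permutes: "opp m permutes darts m"
    and opp_inv: "d \<in> darts m \<Longrightarrow> opp m d \<noteq> d \<and> opp m (opp m d) = d"
    and root_in: "root_dart m \<in> darts m"
begin

lemma opp_in [simp]: "opp m d \<in> darts m \<longleftrightarrow> d \<in> darts m"
  using opp_permutes by (rule permutes_in_image)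

lemma rot_in [simp]: "rot m d \<in> darts m \<longleftrightarrow> d \<in> darts m"
  using rot_permutes by (rule permutes_in_image)

lemma opp_inj: "opp m d = opp m e \<Longrightarrow> d = e"
  using opp_permutes by (metis permutes_def)

lemma opp_opp [simp]: "opp m (opp m d) = d"
  using opp_inv opp_permutes by (metis permutes_def)

lemma rot_permutation: "permutation (rot m)"
  using rot_permutes finite_darts permutes_permutation by blast

lemma cyc_support_rot: "cyc (rot m) (support (rot m) d)"
  using support_cyc(1)[OF rot_permutation] .

lemma support_rot_Cons: "support (rot m) d = d # tl (support (rot m) d)"
  using support_eq_Cons[OF rot_permutation] .

lemma in_support_rot: "d \<in> set (support (rot m) d)"
  using support_rot_Cons by (metis list.set_intros(1))

lemma vertex_eq_support: "vertex m d = set (support (rot m) d)"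
  unfolding vertex_def using cyc_orbit[OF cyc_support_rot in_support_rot] .

lemma vertex_self: "d \<in> vertex m d"
  by (simp only: vertex_eq_support in_support_rot)

lemma vertex_eq: "e \<in> vertex m d \<Longrightarrow> vertex m e = vertex m d"
  using cyc_orbit[OF cyc_support_rot] vertex_eq_support unfolding vertex_def by metis

lemma vertex_sub: "d \<in> darts m \<Longrightarrow> vertex m d \<subseteq> darts m"
  unfolding vertex_def using permutes_orbit_subset[OF rot_permutes] .

lemma vertex_insert_tl: "vertex m d = insert d (set (tl (support (rot m) d)))"
  unfolding vertex_eq_support using support_rot_Cons by (metis list.simps(15))

lemma not_in_tl_support: "d \<notin> set (tl (support (rot m) d))"
  using cyc_support_rot support_rot_Cons unfolding cyc_def by (metis distinct.simps(2))

lemma distinct_support_rot: "distinct (support (rot m) d)"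
  using cyc_support_rot cyc_def by blast

lemma faces_eq_ncyc: "card (faces m) = ncyc (rot m \<circ> opp m) (darts m)"
  by (simp add: faces_def ncyc_def)

end

lemma rooted_map_premap: "rooted_map m \<Longrightarrow> premap m"
  by (auto simp: rooted_map_def premap_def)

text \<open>\<open>forest\<close> lists the subtrees at the children of \<open>v\<close>. There may
  be several, as non-separability enters only later.\<close>

locale explored_map = premap m for m :: "'d cmap" +
  fixes forest :: "'d atree list"
  assumes distinct_W: "distinct (words (opp m) forest)"
    and set_W: "set (words (opp m) forest) = darts m"
    and root_splits: "splits (opp m) {} forest (support (rot m) (root_dart m))"
    and root_explored: "c \<in> set forest \<Longrightarrow> explored m [root_dart m] c"
begin

definition "W = words (opp m) forest"
definition "LD = fst ` set (fleaves forest)"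
definition "ND = set (fnodes forest)"
text \<open>The darts through which the exploration enters the vertices, the root dart standing for
  \<open>v\<close>. They represent the vertices, each exactly once (\<open>vertices_eq\<close>,
  \<open>fam_vertex_inj\<close>).\<close>

definition "EN = insert (root_dart m) (opp m ` ND)"

text \<open>
  \<open>fam path P ts Q\<close>: the vertex entered through the last dart of \<open>path\<close> has the list of child
  subtrees \<open>ts\<close>, and \<open>P\<close> and \<open>Q\<close> are the parts of the contour before and after them.
\<close>

inductive fam :: "'d list \<Rightarrow> 'd list \<Rightarrow> 'd atree list \<Rightarrow> 'd list \<Rightarrow> bool" where
  fam_root: "fam [root_dart m] [] forest []"
| fam_child: "fam path P (us @ AN d ts # vs) Q \<Longrightarrow>
    fam (path @ [opp m d]) (P @ words (opp m) us @ [d]) ts (opp m d # words (opp m) vs @ Q)"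

text \<open>Away from \<open>v\<close> the first dart of the rotation belongs to the edge to the
  parent and is dropped; at \<open>v\<close> it is the root dart, which belongs to a child
  edge.\<close>

definition vl :: "'d list \<Rightarrow> 'd list" where
  "vl path = (if length path = 1 then support (rot m) (last path) else tl (support (rot m) (last path)))"

lemma fam_W: "fam path P ts Q \<Longrightarrow> W = P @ words (opp m) ts @ Q"
  by (induction rule: fam.induct) (auto simp: W_def)

lemma fam_path: "fam path P ts Q \<Longrightarrow> path \<noteq> [] \<and> path ! 0 = root_dart m"
  by (induction rule: fam.induct) (auto simp: nth_append)

lemma fam_explored: "fam path P ts Q \<Longrightarrow> c \<in> set ts \<Longrightarrow> explored m path c"
proof (induction arbitrary: c rule: fam.induct)
  case (fam_child path P us d ts vs Q)
  have "explored m path (AN d ts)" by (rule fam_child.IH) simp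
  then show ?case using fam_child.prems by simp
qed (simp add: root_explored)

lemma fam_splits: "fam path P ts Q \<Longrightarrow> splits (opp m) {} ts (vl path)"
proof (induction rule: fam.induct)
  case fam_root
  then show ?case using root_splits by (simp add: vl_def)
next
  case (fam_child path P us d ts vs Q)
  then have "explored m path (AN d ts)" using fam_explored by fastforce
  then show ?case using fam_path[OF fam_child(1)] by (simp add: vl_def)
qed

lemma vertex_vl: "fam path P ts Q \<Longrightarrow> vertex m (last path) = insert (last path) (set (vl path))"
  using vertex_insert_tl[of "last path"] vertex_self vertex_eq_support
  by (auto simp: vl_def simp del: set_map)

lemma distinct_vl: "distinct (vl path)"
  using distinct_support_rot by (auto simp: vl_def simp del: set_map intro: distinct_tl)

lemma distinct_sub: "distinct W"
  using distinct_W by (simp add: W_def)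

lemma set_W': "set W = darts m"
  using set_W by (simp add: W_def)

lemma fam_leaves: "fam path P ts Q \<Longrightarrow> set (fleaves ts) \<subseteq> set (fleaves forest)"
  by (induction rule: fam.induct) auto

lemma fam_nodes: "fam path P ts Q \<Longrightarrow> set (fnodes ts) \<subseteq> ND"
  by (induction rule: fam.induct) (auto simp: ND_def)

lemma fam_leaf_LD: "fam path P ts Q \<Longrightarrow> c \<in> set ts \<Longrightarrow> (d, q) \<in> set (aleaves c) \<Longrightarrow> d \<in> LD"
  using fam_leaves unfolding LD_def by force

lemma fam_backs: "fam path P ts Q \<Longrightarrow> c \<in> set ts \<Longrightarrow> backs (opp m) c \<subseteq> opp m ` LD"
  using fam_leaf_LD unfolding backs_def by force

lemma fam_EN: "fam path P ts Q \<Longrightarrow> set path \<subseteq> EN"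
proof (induction rule: fam.induct)
  case (fam_child path P us d ts vs Q)
  have "d \<in> ND" using fam_nodes[OF fam_child.hyps] by simp
  then show ?case using fam_child.IH by (simp add: EN_def)
qed (simp add: EN_def)

lemma fam_last_EN: "fam path P ts Q \<Longrightarrow> last path \<in> EN"
  using fam_EN fam_path by fastforce

lemma W_sets: "darts m = LD \<union> ND \<union> opp m ` (LD \<union> ND)"
  using set_W set_words_eq[of "opp m" forest] by (simp add: LD_def ND_def)

lemma LD_ND: "LD \<inter> ND = {}" "(LD \<union> ND) \<inter> opp m ` (LD \<union> ND) = {}"
  using distinct_words_darts[OF distinct_W] by (auto simp: LD_def ND_def)

lemma opp_LD_ND: "opp m d \<in> opp m ` LD \<Longrightarrow> d \<notin> ND" "opp m d \<in> opp m ` LD \<longleftrightarrow> d \<in> LD"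
  using LD_ND opp_inj by blast+

lemma fam_dart: "fam path P ts Q \<Longrightarrow> c \<in> set ts \<Longrightarrow> dart c \<in> LD \<union> ND"
proof -
  assume a: "fam path P ts Q" "c \<in> set ts"
  show ?thesis
  proof (cases c)
    case (AL d q)
    then show ?thesis using fam_leaf_LD[OF a, of d q] by simp
  next
    case (AN d us)
    then show ?thesis using fam_nodes[OF a(1)] a(2) by force
  qed
qed

lemma vl_subset: "fam path P ts Q \<Longrightarrow> set (vl path) \<subseteq> dart ` set ts \<union> (\<Union>c\<in>set ts. backs (opp m) c)"
  using splits_subset[OF fam_splits] by fastforce

lemma vl_subset': "fam path P ts Q \<Longrightarrow> set (vl path) \<subseteq> LD \<union> ND \<union> opp m ` LD"
  using vl_subset fam_dart fam_backs by fast

lemma dart_in_vl: "fam path P ts Q \<Longrightarrow> c \<in> set ts \<Longrightarrow> dart c \<in> set (vl path)"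
  using splits_darts[OF fam_splits] by fast

lemma root_first: "\<exists>c ts. forest = c # ts \<and> dart c = root_dart m"
proof (cases forest)
  case Nil
  then show ?thesis using root_splits in_support_rot[of "root_dart m"] by simp
next
  case (Cons c ts)
  with root_splits obtain ds where "support (rot m) (root_dart m) = dart c # ds" by auto
  then show ?thesis using Cons support_rot_Cons[of "root_dart m"] by (metis list.inject)
qed

lemma root_tree_dart: "root_dart m \<in> LD \<union> ND"
  using root_first fam_dart[OF fam_root] by (metis list.set_intros(1))

text \<open>Around a vertex all darts but the entering one are upper darts or upper ends of back
  edges (\<open>vl_subset'\<close>). The lower dart of an edge to an internal vertex is neither, so
  it can only be the entering dart.\<close>

lemma fam_vertex_inj:
  assumes "fam path P ts Q" "fam path' P' ts' Q'" "vertex m (last path) = vertex m (last path')"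
  shows "last path = last path'"
proof -
  have *: "opp m d = last path" if "opp m d \<in> vertex m (last path)" "d \<in> ND" "fam path P ts Q"
    for path P ts Q d
  proof (rule ccontr)
    assume "opp m d \<noteq> last path"
    then have "opp m d \<in> set (vl path)" using that vertex_vl by blast
    then have "opp m d \<in> LD \<union> ND \<union> opp m ` LD" using vl_subset'[OF that(3)] by blast
    then show False using LD_ND opp_LD_ND that(2) by blast
  qed
  have "last path \<in> EN" "last path' \<in> EN" using assms fam_last_EN by auto
  then show ?thesis using *[OF _ _ assms(1)] *[OF _ _ assms(2)] assms(3) vertex_self
    unfolding EN_def by (metis imageE insertE)
qed

lemma node_fam:
  assumes "fam path P ts Q" "c \<in> set ts" "d \<in> set (ndarts c)"
  shows "\<exists>path' P' ts' Q'. fam (path @ path' @ [opp m d]) P' ts' Q'"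
  using assms
proof (induction c arbitrary: path P ts Q)
  case (AN e us)
  obtain as bs where ts: "ts = as @ AN e us # bs" using AN.prems(2) by (meson split_list)
  have f: "fam (path @ [opp m e]) (P @ words (opp m) as @ [e]) us (opp m e # words (opp m) bs @ Q)"
    using fam_child AN.prems(1) ts by simp
  show ?case
  proof (cases "d = e")
    case True
    then show ?thesis using f by (metis append_Nil)
  next
    case False
    then obtain c where "c \<in> set us" "d \<in> set (ndarts c)" using AN.prems by auto
    from AN.IH[OF this(1) f this] show ?thesis by (metis append.assoc)
  qed
qed simp

lemma leaf_fam:
  assumes "fam path P ts Q" "c \<in> set ts" "(d, q) \<in> set (aleaves c)"
  shows "\<exists>path' P' us vs Q'. fam (path @ path') P' (us @ AL d q # vs) Q'"
  using assms
proof (induction c arbitrary: path P ts Q)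
  case (AL e r)
  then obtain as bs where ts: "ts = as @ AL d q # bs" by (auto dest: split_list)
  then show ?case using AL.prems(1) by (metis append_Nil2)
next
  case (AN e us)
  obtain as bs where ts: "ts = as @ AN e us # bs" using AN.prems(2) by (meson split_list)
  have f: "fam (path @ [opp m e]) (P @ words (opp m) as @ [e]) us (opp m e # words (opp m) bs @ Q)"
    using fam_child AN.prems(1) ts by simp
  obtain c where "c \<in> set us" "(d, q) \<in> set (aleaves c)" using AN.prems by auto
  from AN.IH[OF this(1) f this] show ?case by (metis append.assoc)
qed

lemma EN_fam: "e \<in> EN \<Longrightarrow> \<exists>path P ts Q. fam path P ts Q \<and> last path = e"
proof -
  assume "e \<in> EN"
  then consider "e = root_dart m" | d where "d \<in> ND" "e = opp m d" unfolding EN_def by auto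
  then show ?thesis
  proof cases
    case 1
    then show ?thesis using fam_root by fastforce
  next
    case 2
    then obtain c where "c \<in> set forest" "d \<in> set (ndarts c)" by (auto simp: ND_def)
    from node_fam[OF fam_root this] 2 show ?thesis by (metis append_is_Nil_conv last_appendR last_snoc not_Cons_self2)
  qed
qed

text \<open>An upper dart lies at the vertex of its family, the lower dart of an edge to an internal
  vertex enters that vertex, and the upper end of a back edge lies at a vertex of the path by
  \<open>explored\<close>.\<close>

lemma in_vertex_EN:
  assumes "fam path P ts Q" "c \<in> set ts" "y \<in> set (word (opp m) c)"
  shows "\<exists>e\<in>EN. y \<in> vertex m e"
  using assms
proof (induction c arbitrary: path P ts Q)
  case (AL d q)
  have "d \<in> vertex m (last path)" using dart_in_vl[OF AL.prems(1,2)] vertex_vl[OF AL.prems(1)] by simp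
  moreover have "last path \<in> EN" using fam_last_EN AL.prems by blast
  moreover obtain i where "i < length path" "opp m d \<in> vertex m (path ! i)"
    using fam_explored[OF AL.prems(1,2)] by auto
  moreover have "path ! i \<in> EN" using fam_EN[OF AL.prems(1)] calculation by force
  ultimately show ?case using AL.prems(3) by auto
next
  case (AN d us)
  have "d \<in> vertex m (last path)" using dart_in_vl[OF AN.prems(1,2)] vertex_vl[OF AN.prems(1)] by simp
  moreover have "last path \<in> EN" using fam_last_EN AN.prems by blast
  moreover have "d \<in> ND" using fam_nodes[OF AN.prems(1)] AN.prems(2) by force
  moreover have "\<exists>e\<in>EN. y \<in> vertex m e" if "c \<in> set us" "y \<in> set (word (opp m) c)" for c
  proof -
    obtain as bs where ts: "ts = as @ AN d us # bs" using AN.prems(2) by (meson split_list)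
    then show ?thesis using AN.IH[OF that(1) fam_child that] AN.prems(1) by simp
  qed
  ultimately show ?case using AN.prems(3) vertex_self[of "opp m d"] by (auto simp: EN_def)
qed

lemma vertices_eq: "vertices m = vertex m ` EN"
proof -
  have "EN \<subseteq> darts m" using root_in W_sets by (auto simp: EN_def)
  moreover have "\<exists>e\<in>EN. vertex m y = vertex m e" if y: "y \<in> darts m" for y
  proof -
    obtain c where "c \<in> set forest" "y \<in> set (word (opp m) c)" using y unfolding set_W[symmetric] by auto
    from in_vertex_EN[OF fam_root this] show ?thesis using vertex_eq by metis
  qed
  ultimately show ?thesis unfolding vertices_def by blast
qed

lemma card_LD: "card LD = length (fleaves forest)"
  unfolding LD_def using distinct_card[OF distinct_words_darts(1)[OF distinct_W]] by simp

lemma card_vertices: "card (vertices m) = Suc (length (fnodes forest))"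
proof -
  have "inj_on (vertex m) EN"
  proof (rule inj_onI)
    fix e e' assume "e \<in> EN" "e' \<in> EN" "vertex m e = vertex m e'"
    then show "e = e'" using EN_fam fam_vertex_inj by metis
  qed
  then have "card (vertices m) = card EN" by (simp add: vertices_eq card_image)
  also have "\<dots> = Suc (card (opp m ` ND))"
    unfolding EN_def using root_tree_dart LD_ND by (subst card_insert_disjoint) (auto simp: ND_def)
  also have "card (opp m ` ND) = card ND" by (rule card_image) (auto intro: inj_onI opp_inj)
  also have "card ND = length (fnodes forest)"
    unfolding ND_def using distinct_card[OF distinct_words_darts(2)[OF distinct_W]] .
  finally show ?thesis .
qed

lemma card_edges: "card (edges m) = length (fleaves forest) + length (fnodes forest)"
proof -
  have "edges m = (\<lambda>d. {d, opp m d}) ` (LD \<union> ND)"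
    unfolding edges_def W_sets by (auto simp: image_Un image_image insert_commute)
  moreover have "inj_on (\<lambda>d. {d, opp m d}) (LD \<union> ND)"
    by (rule inj_onI) (use LD_ND in \<open>auto simp: doubleton_eq_iff\<close>)
  ultimately have "card (edges m) = card (LD \<union> ND)" by (simp add: card_image)
  also have "\<dots> = card LD + card ND" using LD_ND(1) by (intro card_Un_disjoint) (auto simp: LD_def ND_def)
  also have "card ND = length (fnodes forest)"
    unfolding ND_def using distinct_card[OF distinct_words_darts(2)[OF distinct_W]] .
  finally show ?thesis by (simp add: card_LD)
qed

text \<open>There are \<open>card ND + 1\<close> vertices and \<open>card LD + card ND\<close>
  edges, so the number of internal vertices cancels in Euler's relation.\<close>

lemma planar_map_iff:
  "rooted_map m \<Longrightarrow> planar_map m \<longleftrightarrow> ncyc (rot m \<circ> opp m) (darts m) = Suc (card LD)"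
  unfolding planar_map_def card_vertices card_edges faces_eq_ncyc card_LD by auto

text \<open>An entering dart other than the root dart closes the contour of its subtree, so it still
  lies ahead, in \<open>Q\<close>. The contour is distinct, and the root dart, being an upper dart,
  differs from all lower darts.\<close>

lemma fam_path_distinct: "fam path P ts Q \<Longrightarrow> distinct path \<and> set (tl path) \<subseteq> set Q"
proof (induction rule: fam.induct)
  case (fam_child path P us d ts vs Q)
  have W: "W = P @ words (opp m) (us @ AN d ts # vs) @ Q" using fam_W[OF fam_child(1)] .
  have "opp m d \<notin> set Q" using distinct_sub unfolding W by auto
  moreover have "opp m d \<noteq> root_dart m"
    using root_tree_dart fam_nodes[OF fam_child(1)] LD_ND(2)
    by (metis (no_types, lifting) IntI UnI2 empty_iff fam_dart[OF fam_child(1), of "AN d ts"]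
        atree.sel(2) imageI in_set_conv_decomp)
  moreover have "path = root_dart m # tl path"
    using fam_path[OF fam_child(1)] by (metis list.collapse hd_conv_nth)
  ultimately have "opp m d \<notin> set path" using fam_child.IH by (metis set_ConsD subsetD)
  then show ?case using fam_child.IH fam_path[OF fam_child(1)] by auto
qed simp

lemma fam_prefix:
  "fam path P ts Q \<Longrightarrow> i < length path \<Longrightarrow> \<exists>P' ts' Q'. fam (take (Suc i) path) P' ts' Q'"
proof (induction rule: fam.induct)
  case fam_root
  then show ?case using fam.fam_root by auto
next
  case (fam_child path P us d ts vs Q)
  show ?case
  proof (cases "i < length path")
    case True
    then show ?thesis using fam_child.IH by simp
  next
    case False
    then show ?thesis using fam_child.prems fam.fam_child[OF fam_child.hyps] by simp blast
  qed
qed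

lemma fam_path_vertex_inj:
  assumes "fam path P ts Q" "i < length path" "j < length path"
    "vertex m (path ! i) = vertex m (path ! j)"
  shows "i = j"
proof -
  obtain P1 ts1 Q1 where 1: "fam (take (Suc i) path) P1 ts1 Q1" using fam_prefix assms by blast
  obtain P2 ts2 Q2 where 2: "fam (take (Suc j) path) P2 ts2 Q2" using fam_prefix assms by blast
  have "path ! i = path ! j" using fam_vertex_inj[OF 1 2] assms by (simp add: take_Suc_conv_app_nth)
  then show ?thesis using fam_path_distinct[OF assms(1)] assms by (simp add: nth_eq_iff_index_eq)
qed

text \<open>The path of the leaf itself extends \<open>path\<close>, and different positions on it
  belong to different vertices; so the label and the vertex where the back edge ends determine each
  other.\<close>

lemma leaf_explored:
  assumes "fam path P ts Q" "c \<in> set ts" "(d, q) \<in> set (aleaves c)"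
  shows "-1 \<le> q" and "q < int (length path) - 1 \<Longrightarrow> opp m d \<in> vertex m (path ! nat (q + 1))"
    and "i < length path \<Longrightarrow> opp m d \<in> vertex m (path ! i) \<Longrightarrow> q = int i - 1"
proof -
  obtain path' P' us vs Q' where f: "fam (path @ path') P' (us @ AL d q # vs) Q'"
    using leaf_fam[OF assms] by blast
  then have "explored m (path @ path') (AL d q)" using fam_explored by fastforce
  then obtain j where j: "j < length (path @ path')" "q = int j - 1"
    "opp m d \<in> vertex m ((path @ path') ! j)" by auto
  then show "-1 \<le> q" by simp
  show "opp m d \<in> vertex m (path ! nat (q + 1))" if "q < int (length path) - 1"
    using j that by (simp add: nth_append split: if_splits)
  show "q = int i - 1" if "i < length path" "opp m d \<in> vertex m (path ! i)"
  proof -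
    have "vertex m ((path @ path') ! i) = vertex m ((path @ path') ! j)"
      using that j(3) vertex_eq by (metis nth_append)
    from fam_path_vertex_inj[OF f _ j(1) this] that j show ?thesis by simp
  qed
qed

end


section \<open>Connectedness\<close>

context premap
begin

definition "step = {(x, rot m x) |x. True} \<union> {(x, opp m x) |x. True}"

lemma vertex_reach: "y \<in> vertex m e \<Longrightarrow> (e, y) \<in> step\<^sup>*"
proof -
  assume "y \<in> vertex m e"
  then have "y \<in> orbit (rot m) e" by (simp add: vertex_def)
  then show ?thesis
    by induct (auto simp: step_def intro: rtrancl_into_rtrancl)
qed

lemma opp_reach: "(d, opp m d) \<in> step\<^sup>*"
  by (auto simp: step_def)

end

context explored_map
begin

lemma fam_reach: "fam path P ts Q \<Longrightarrow>
  (root_dart m, last path) \<in> step\<^sup>* \<and> (last path, root_dart m) \<in> step\<^sup>*"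
proof (induction rule: fam.induct)
  case (fam_child path P us d ts vs Q)
  have "d \<in> vertex m (last path)"
    using dart_in_vl[OF fam_child.hyps, of "AN d ts"] vertex_vl[OF fam_child.hyps] by simp
  then have "(last path, d) \<in> step\<^sup>*" "(d, last path) \<in> step\<^sup>*"
    using vertex_reach vertex_eq vertex_self by metis+
  moreover have "(d, opp m d) \<in> step\<^sup>*" "(opp m d, d) \<in> step\<^sup>*"
    using opp_reach[of d] opp_reach[of "opp m d"] by auto
  ultimately show ?case using fam_child.IH by (metis last_snoc rtrancl_trans)
qed simp

lemma reach: "y \<in> darts m \<Longrightarrow> (root_dart m, y) \<in> step\<^sup>* \<and> (y, root_dart m) \<in> step\<^sup>*"
proof -
  assume "y \<in> darts m"
  then have "vertex m y \<in> vertex m ` EN" using vertices_eq by (auto simp: vertices_def)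
  then obtain e where "e \<in> EN" "vertex m y = vertex m e" by auto
  then show ?thesis using EN_fam fam_reach vertex_reach vertex_self by (metis rtrancl_trans)
qed

lemma rooted: "rooted_map m"
  unfolding rooted_map_def step_def[symmetric]
  using finite_darts rot_permutes opp_permutes opp_inv root_in reach by (meson rtrancl_trans)

end


section \<open>The contour of the tree\<close>

text \<open>\<open>r\<close> is the rotation left after cutting all back edges at their upper ends:
  such an end is a fixed point, and around an internal vertex the entering dart is followed by the
  child darts alone.\<close>

fun tree_perm :: "('d \<Rightarrow> 'd) \<Rightarrow> ('d \<Rightarrow> 'd) \<Rightarrow> 'd atree \<Rightarrow> bool" where
  "tree_perm op r (AL d q) \<longleftrightarrow> r (op d) = op d"
| "tree_perm op r (AN d ts) \<longleftrightarrow> map r (op d # map dart ts) = map dart ts @ [op d] \<and>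
     (\<forall>c\<in>set ts. tree_perm op r c)"

text \<open>\<open>f\<close> runs through blocks one after the other: each block leads to
  \<open>nx c\<close>, which is the head of the next block or, for the last one, \<open>y\<close>.
  This yields both the contour of a tree and the vertex cycles of the closure.\<close>

lemma map_chain:
  assumes "\<And>c. c \<in> set cs \<Longrightarrow> map f (x c # w c) = w c @ [nx c]" and "map nx cs = tl (map x cs) @ [y]"
  shows "map f (concat (map (\<lambda>c. x c # w c) cs)) = tl (concat (map (\<lambda>c. x c # w c) cs)) @ [y]"
  using assms
proof (induction cs)
  case (Cons c cs)
  show ?case
  proof (cases cs)
    case Nil
    then show ?thesis using Cons.prems by simp
  next
    case (Cons c' ds)
    have 1: "nx c = x c'" "map nx cs = tl (map x cs) @ [y]" using Cons.prems(2) Cons by auto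
    have "map f (concat (map (\<lambda>c. x c # w c) cs)) = tl (concat (map (\<lambda>c. x c # w c) cs)) @ [y]"
      using Cons.IH[OF Cons.prems(1) 1(2)] by simp
    then show ?thesis using Cons.prems(1)[of c] Cons 1(1) by simp
  qed
qed simp

lemma map_words:
  assumes "\<And>c. c \<in> set ts \<Longrightarrow> map f (word op c) = tl (word op c) @ [r (dart c)]"
    and "map r (map dart ts) = tl (map dart ts) @ [y]"
  shows "map f (words op ts) = tl (words op ts) @ [y]"
proof -
  have w: "dart c # tl (word op c) = word op c" for c using hd_word[of op c] by auto
  show ?thesis
    using map_chain[of ts f dart "\<lambda>c. tl (word op c)" "\<lambda>c. r (dart c)" y] assms
    unfolding w by (simp add: comp_def)
qed

lemma tree_perm_word:
  assumes "\<And>d. op (op d) = d" "tree_perm op r c"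
  shows "map (r \<circ> op) (word op c) = tl (word op c) @ [r (dart c)]"
  using assms(2)
proof (induction c)
  case (AN d ts)
  show ?case
  proof (cases ts)
    case Nil
    then show ?thesis using AN assms(1) by simp
  next
    case (Cons c us)
    obtain w where w: "word op c = dart c # w" using hd_word[of op c] by blast
    have "map (r \<circ> op) (words op ts) = tl (words op ts) @ [op d]"
    proof (rule map_words[where r = r])
      show "map (r \<circ> op) (word op c) = tl (word op c) @ [r (dart c)]" if "c \<in> set ts" for c
        using AN.IH[OF that] AN.prems that by (simp add: comp_def)
    qed (use AN.prems Cons in simp)
    moreover have "r (op d) = dart c" using AN.prems Cons by simp
    ultimately show ?thesis using assms(1) Cons w by (simp add: comp_def)
  qed
qed (use assms(1) in auto)

lemma tree_perm_cyc:
  assumes "\<And>d. op (op d) = d" "\<And>c. c \<in> set ts \<Longrightarrow> tree_perm op r c" "cyc r (map dart ts)"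
    and "distinct (words op ts)"
  shows "cyc (r \<circ> op) (words op ts)"
proof (cases ts)
  case Nil
  then show ?thesis by (simp add: cyc_def)
next
  case (Cons c us)
  obtain w where w: "word op c = dart c # w" using hd_word[of op c] by blast
  have "map (r \<circ> op) (words op ts) = tl (words op ts) @ [dart c]"
    by (rule map_words[where r = r]) (use tree_perm_word[OF assms(1,2)] assms(3) Cons in \<open>auto simp: cyc_def\<close>)
  then show ?thesis using assms(4) Cons w by (simp add: cyc_def)
qed

lemma transpose_comp_involution:
  assumes "\<And>d. op (op d) = d"
  shows "transpose a b \<circ> op = op \<circ> transpose (op a) (op b)"
  using assms by (auto simp: fun_eq_iff transpose_def)

lemma not_hd_pred: "x \<in> set l \<Longrightarrow> hd l \<noteq> x \<Longrightarrow> \<exists>A e B. l = A @ e # x # B"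
proof -
  assume a: "x \<in> set l" "hd l \<noteq> x"
  then obtain A B where l: "l = A @ x # B" by (meson split_list)
  with a have "A \<noteq> []" by auto
  then obtain A' e where "A = A' @ [e]" by (metis rev_exhaust)
  then show ?thesis using l by auto
qed

lemma splits_filter:
  assumes "splits op E ts ds" "E \<subseteq> B" "\<And>c. c \<in> set ts \<Longrightarrow> backs op c \<subseteq> B" "\<And>c. c \<in> set ts \<Longrightarrow> dart c \<notin> B"
  shows "filter (\<lambda>y. y \<notin> B) ds = map dart ts"
  using assms
proof (induction ts arbitrary: E ds)
  case Nil
  then show ?case by (auto simp: filter_empty_conv)
next
  case (Cons c ts)
  then obtain Y ds' where 1: "ds = Y @ dart c # ds'" "set Y \<subseteq> E" "splits op (E \<union> backs op c) ts ds'"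
    by auto
  have "filter (\<lambda>y. y \<notin> B) ds' = map dart ts"
    by (rule Cons.IH[OF 1(3)]) (use Cons.prems in auto)
  moreover have "filter (\<lambda>y. y \<notin> B) Y = []" using 1 Cons.prems(2) by (auto simp: filter_empty_conv)
  ultimately show ?case using 1 Cons.prems(4)[of c] by simp
qed


section \<open>Removing back edges\<close>

context explored_map
begin

definition "BK = opp m ` LD"

text \<open>
  The back edges whose upper ends lie in \<open>Z\<close> have been cut: each of these ends has become a vertex of
  its own.
\<close>

definition removed :: "'d set \<Rightarrow> ('d \<Rightarrow> 'd) \<Rightarrow> bool" where
  "removed Z r \<longleftrightarrow> r permutes darts m \<and>
     (\<forall>e\<in>EN. cyc r (filter (\<lambda>y. y \<notin> Z) (support (rot m) e))) \<and> (\<forall>z\<in>Z. r z = z)"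

lemma BK_subset: "BK \<subseteq> darts m"
  using W_sets by (auto simp: BK_def)

text \<open>Entering darts survive every cut. Hence what is left of a vertex still starts with its
  entering dart, and each end that remains to be cut has a predecessor there.\<close>

lemma EN_BK: "e \<in> EN \<Longrightarrow> e \<notin> BK"
proof
  assume e: "e \<in> EN" "e \<in> BK"
  show False
  proof (cases "e = root_dart m")
    case True
    then show False using e root_tree_dart LD_ND(2) unfolding BK_def by blast
  next
    case False
    then obtain d where "d \<in> ND" "e = opp m d" using e unfolding EN_def by blast
    then show False using e(2) opp_LD_ND(1) unfolding BK_def by blast
  qed
qed

lemma EN_darts: "EN \<subseteq> darts m"
  using root_in W_sets by (auto simp: EN_def)

lemma dart_BK: "fam path P ts Q \<Longrightarrow> c \<in> set ts \<Longrightarrow> dart c \<notin> BK"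
  using fam_dart LD_ND unfolding BK_def by fast

lemma support_disjoint:
  assumes "e \<in> EN" "e' \<in> EN" "y \<in> set (support (rot m) e)" "y \<in> set (support (rot m) e')"
  shows "e = e'"
proof -
  have "vertex m e = vertex m e'"
    using assms(3,4) vertex_eq unfolding vertex_eq_support[symmetric] by metis
  then show ?thesis using EN_fam fam_vertex_inj assms(1,2) by metis
qed

lemma removed_comp_opp:
  "(r \<circ> transpose e x) \<circ> opp m = (r \<circ> opp m) \<circ> transpose (opp m e) (opp m x)"
  using transpose_comp_involution[of "opp m" e x, OF opp_opp] by (simp add: comp_assoc)

text \<open>\<open>e\<close> immediately precedes \<open>x\<close> among the darts that are left, so
  the transposition makes \<open>e\<close> skip \<open>x\<close> and turns \<open>x\<close> into a
  fixed point.\<close>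

lemma remove_step:
  assumes r: "removed Z r" and x: "x \<in> BK" "x \<notin> Z" and e0: "e0 \<in> EN"
    and l: "filter (\<lambda>y. y \<notin> Z) (support (rot m) e0) = A @ e # x # B"
  shows "removed (insert x Z) (r \<circ> transpose e x)" "e \<in> darts m"
proof -
  let ?r = "r \<circ> transpose e x"
  have c: "cyc r (A @ e # x # B)" using r e0 l by (metis removed_def)
  have mem: "e \<in> set (filter (\<lambda>y. y \<notin> Z) (support (rot m) e0))"
    "x \<in> set (filter (\<lambda>y. y \<notin> Z) (support (rot m) e0))" unfolding l by simp_all
  then have mem': "e \<in> set (support (rot m) e0)" "x \<in> set (support (rot m) e0)" "e \<notin> Z"
    unfolding set_filter by blast+
  show e: "e \<in> darts m" using mem'(1) vertex_sub EN_darts e0 vertex_eq_support by blast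
  have 1: "cyc ?r (A @ e # B)" "cyc ?r [x]" using cyc_split[of r A e "[]" x B] c by auto
  have f: "filter (\<lambda>y. y \<notin> insert x Z) l = filter (\<lambda>y. y \<noteq> x) (filter (\<lambda>y. y \<notin> Z) l)" for l
    by (auto intro: filter_cong)
  have d: "distinct (A @ e # x # B)" using c by (simp add: cyc_def)
  have "cyc ?r (filter (\<lambda>y. y \<notin> insert x Z) (support (rot m) e'))" if e': "e' \<in> EN" for e'
  proof (cases "e' = e0")
    case True
    have "filter (\<lambda>y. y \<noteq> x) (A @ e # x # B) = A @ e # B"
      using d filter_True[of A "\<lambda>y. y \<noteq> x"] filter_True[of B "\<lambda>y. y \<noteq> x"] by fastforce
    then show ?thesis using True 1 f l by metis
  next
    case False
    then have ne: "e \<notin> set (support (rot m) e')" "x \<notin> set (support (rot m) e')"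
      using support_disjoint e' e0 mem' by blast+
    have "filter (\<lambda>y. y \<notin> insert x Z) (support (rot m) e') = filter (\<lambda>y. y \<notin> Z) (support (rot m) e')"
      using ne(2) by (intro filter_cong) auto
    moreover have "cyc r (filter (\<lambda>y. y \<notin> Z) (support (rot m) e'))" using r e' by (auto simp: removed_def)
    ultimately show ?thesis using ne by (metis cyc_transpose_other filter_is_subset subsetD)
  qed
  moreover have "?r permutes darts m"
    using permutes_comp_transpose[of r "darts m" e x] r e x BK_subset by (auto simp: removed_def)
  moreover have "?r z = z" if "z \<in> insert x Z" for z
  proof (cases "z = x")
    case True
    then show ?thesis using 1(2) by (simp add: cyc_def)
  next
    case False
    then have "z \<in> Z" "z \<noteq> e" using that mem' by auto
    then show ?thesis using False r by (simp add: removed_def)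
  qed
  ultimately show "removed (insert x Z) ?r" by (simp add: removed_def)
qed

lemma removed_empty: "removed {} (rot m)"
  using rot_permutes cyc_support_rot by (simp add: removed_def del: filter_map)

lemma BK_support: "x \<in> BK \<Longrightarrow> \<exists>e\<in>EN. x \<in> set (support (rot m) e)"
proof -
  assume "x \<in> BK"
  then have "vertex m x \<in> vertex m ` EN" using vertices_eq BK_subset unfolding vertices_def by blast
  then show ?thesis using vertex_self vertex_eq_support by (metis imageE)
qed

text \<open>The ends are cut one at a time. A cut may merge two faces or split one; only the bound
  that it loses at most one face is available in either case.\<close>

lemma removal_exists:
  assumes "finite Z" "Z \<subseteq> BK"
  shows "\<exists>r. removed Z r \<and> ncyc (rot m \<circ> opp m) (darts m) \<le> ncyc (r \<circ> opp m) (darts m) + card Z"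
  using assms
proof (induction Z)
  case empty
  then show ?case using removed_empty by auto
next
  case (insert x Z)
  then obtain r where r: "removed Z r"
    "ncyc (rot m \<circ> opp m) (darts m) \<le> ncyc (r \<circ> opp m) (darts m) + card Z" by (metis insert_subset)
  obtain e0 where e0: "e0 \<in> EN" "x \<in> set (support (rot m) e0)" using BK_support insert.prems by (metis insert_subset)
  let ?l = "filter (\<lambda>y. y \<notin> Z) (support (rot m) e0)"
  have "hd ?l = e0"
  proof -
    have "e0 \<notin> Z" using insert.prems EN_BK e0 by auto
    then show ?thesis by (subst support_rot_Cons) simp
  qed
  moreover have "e0 \<noteq> x" using EN_BK[OF e0(1)] insert.prems by auto
  moreover have "x \<in> set ?l" using e0 insert.hyps by (simp del: set_map)
  ultimately obtain A e B where l: "?l = A @ e # x # B" using not_hd_pred[of x ?l] by auto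
  have xB: "x \<in> BK" using insert.prems by simp
  let ?r = "r \<circ> transpose e x"
  have 1: "removed (insert x Z) ?r" "e \<in> darts m"
    using remove_step[OF r(1) xB insert.hyps(2) e0(1) l] by auto
  have "(?r \<circ> transpose e x) \<circ> opp m = (?r \<circ> opp m) \<circ> transpose (opp m e) (opp m x)"
    by (rule removed_comp_opp)
  then have "r \<circ> opp m = (?r \<circ> opp m) \<circ> transpose (opp m e) (opp m x)" by (simp add: comp_assoc)
  moreover have "?r \<circ> opp m permutes darts m"
    using 1(1) opp_permutes permutes_compose by (auto simp: removed_def)
  ultimately have "ncyc (r \<circ> opp m) (darts m) \<le> Suc (ncyc (?r \<circ> opp m) (darts m))"
    using ncyc_transpose_le[OF _ finite_darts] 1(2) xB BK_subset by (metis opp_in subsetD)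
  moreover have "card (insert x Z) = Suc (card Z)" using insert.hyps by simp
  ultimately have "ncyc (rot m \<circ> opp m) (darts m) \<le> ncyc (?r \<circ> opp m) (darts m) + card (insert x Z)"
    using r(2) by linarith
  then show ?case using 1(1) by blast
qed

lemma filter_vl: "fam path P ts Q \<Longrightarrow> filter (\<lambda>y. y \<notin> BK) (vl path) = map dart ts"
  using splits_filter[OF fam_splits, of path P ts Q BK] fam_backs dart_BK unfolding BK_def by blast

lemma removed_tree_perm:
  assumes "removed BK r" "fam path P ts Q" "c \<in> set ts"
  shows "tree_perm (opp m) r c"
  using assms(2,3)
proof (induction c arbitrary: path P ts Q)
  case (AL d q)
  then have "opp m d \<in> BK" using fam_leaf_LD by (fastforce simp: BK_def)
  then show ?case using assms(1) by (simp add: removed_def)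
next
  case (AN d us)
  then obtain as bs where "ts = as @ AN d us # bs" by (meson split_list)
  with AN.prems have f: "fam (path @ [opp m d]) (P @ words (opp m) as @ [d]) us (opp m d # words (opp m) bs @ Q)"
    using fam_child by blast
  have e: "opp m d \<in> EN" using fam_last_EN[OF f] by simp
  have "vl (path @ [opp m d]) = tl (support (rot m) (opp m d))"
    using fam_path[OF AN.prems(1)] by (simp add: vl_def)
  then have "filter (\<lambda>y. y \<notin> BK) (tl (support (rot m) (opp m d))) = map dart us"
    using filter_vl[OF f] by simp
  then have "filter (\<lambda>y. y \<notin> BK) (support (rot m) (opp m d)) = opp m d # map dart us"
    using EN_BK[OF e] by (subst support_rot_Cons) simp
  then have "cyc r (opp m d # map dart us)" using assms(1) e by (metis removed_def)
  then show ?case using AN.IH f by (auto simp: cyc_Cons_iff)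
qed

lemma removed_contour:
  assumes "removed BK r"
  shows "cyc (r \<circ> opp m) W"
proof -
  have "vl [root_dart m] = support (rot m) (root_dart m)" by (simp add: vl_def)
  then have "filter (\<lambda>y. y \<notin> BK) (support (rot m) (root_dart m)) = map dart forest"
    using filter_vl[OF fam_root] by simp
  then have "cyc r (map dart forest)" using assms by (metis removed_def EN_def insertI1)
  then show ?thesis unfolding W_def
    using tree_perm_cyc[OF opp_opp removed_tree_perm[OF assms fam_root]] distinct_W by blast
qed

lemma filter_between:
  "set Y \<subseteq> Z \<Longrightarrow> a \<notin> Z \<Longrightarrow> x \<notin> Z \<Longrightarrow>
    filter (\<lambda>y. y \<notin> Z) (A @ a # Y @ x # B) = filter (\<lambda>y. y \<notin> Z) A @ a # x # filter (\<lambda>y. y \<notin> Z) B"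
  by (auto simp: filter_empty_conv)

text \<open>
  In a planar map cutting a back edge always merges two faces. Cutting all of them but two leaves
  two chords on the contour of the tree, and these cannot cross.
\<close>

lemma chords:
  assumes planar: "ncyc (rot m \<circ> opp m) (darts m) = Suc (card LD)"
    and e: "e1 \<in> EN" "e2 \<in> EN"
    and l1: "support (rot m) e1 = A1 @ a1 # Y1 @ x1 # B1"
    and l2: "support (rot m) e2 = A2 @ a2 # Y2 @ x2 # B2"
    and Y: "set Y1 \<subseteq> BK" "set Y2 \<subseteq> BK" "x1 \<notin> set Y2"
    and x: "x1 \<in> BK" "x2 \<in> BK" "x1 \<noteq> x2" and a: "a1 \<notin> BK" "a2 \<notin> BK"
    and W: "W = P @ opp m x1 # M @ opp m a1 # S"
  shows "opp m x2 \<in> set (M @ [opp m a1]) \<longleftrightarrow> opp m a2 \<in> set (M @ [opp m a1])"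
proof (rule ccontr)
  assume neg: "\<not> ?thesis"
  have finBK: "finite BK" using BK_subset finite_darts finite_subset by blast
  have cardBK: "card BK = card LD"
    unfolding BK_def by (rule card_image) (auto intro: inj_onI opp_inj)
  define Z where "Z = BK - {x1, x2}"
  have cZ: "card BK = card Z + 2"
  proof -
    have "card (BK - {x1, x2}) = card BK - card {x1, x2}" using x by (intro card_Diff_subset) auto
    moreover have "card {x1, x2} \<le> card BK" using x finBK by (intro card_mono) auto
    ultimately show ?thesis using x(3) by (simp add: Z_def)
  qed
  obtain r2 where r2: "removed Z r2"
    "ncyc (rot m \<circ> opp m) (darts m) \<le> ncyc (r2 \<circ> opp m) (darts m) + card Z"
    using removal_exists[of Z] finBK by (auto simp: Z_def)
  have d2: "distinct (A2 @ a2 # Y2 @ x2 # B2)" using distinct_support_rot l2 by metis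
  have d1: "distinct (A1 @ a1 # Y1 @ x1 # B1)" using distinct_support_rot l1 by metis
  \<comment> \<open>The condition on \<open>x1\<close> and \<open>Y2\<close> has no counterpart for
    \<open>x2\<close> and \<open>Y1\<close>: the end \<open>x2\<close> is cut first, so it no longer
    separates \<open>a1\<close> from \<open>x1\<close> when \<open>x1\<close> is cut.\<close>
  have Y2: "set Y2 \<subseteq> Z" using Y d2 by (auto simp: Z_def)
  have Y1: "set Y1 \<subseteq> insert x2 Z" using Y d1 by (auto simp: Z_def)
  define r1 where "r1 = r2 \<circ> transpose a2 x2"
  have r1: "removed (insert x2 Z) r1" and a2: "a2 \<in> darts m"
    using remove_step[OF r2(1) x(2) _ e(2)] filter_between[OF Y2, of a2 x2 A2 B2] a x(2) l2
    unfolding r1_def Z_def by (metis Diff_iff insertCI)+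
  define r0 where "r0 = r1 \<circ> transpose a1 x1"
  have 1: "x1 \<notin> insert x2 Z" "a1 \<notin> insert x2 Z" using x a by (auto simp: Z_def)
  have "filter (\<lambda>y. y \<notin> insert x2 Z) (support (rot m) e1) =
      filter (\<lambda>y. y \<notin> insert x2 Z) A1 @ a1 # x1 # filter (\<lambda>y. y \<notin> insert x2 Z) B1"
    unfolding l1 by (rule filter_between[OF Y1 1(2,1)])
  then have r0': "removed (insert x1 (insert x2 Z)) r0" and a1: "a1 \<in> darts m"
    using remove_step[OF r1 x(1) 1(1) e(1)] unfolding r0_def by auto
  have "insert x1 (insert x2 Z) = BK" using x by (auto simp: Z_def)
  then have r0: "removed BK r0" using r0' by simp
  have c0: "cyc (r0 \<circ> opp m) W" by (rule removed_contour[OF r0])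
  have p: "(r1 \<circ> opp m) permutes darts m" "(r0 \<circ> opp m) permutes darts m"
    using r1 r0 opp_permutes permutes_compose by (auto simp: removed_def)
  have xd: "opp m x1 \<in> darts m" "opp m x2 \<in> darts m" "opp m a1 \<in> darts m" "opp m a2 \<in> darts m"
    using x BK_subset a1 a2 by auto
  have "orbit (r0 \<circ> opp m) y = darts m" if "y \<in> darts m" for y
    using cyc_orbit[OF c0, of y] that by (simp add: set_W')
  then have "orbit (r0 \<circ> opp m) ` darts m = {darts m}" using root_in by blast
  then have n0: "ncyc (r0 \<circ> opp m) (darts m) = 1" by (simp add: ncyc_def)
  have "r1 = r0 \<circ> transpose a1 x1" by (simp add: r0_def comp_assoc)
  then have 2: "r1 \<circ> opp m = (r0 \<circ> opp m) \<circ> transpose (opp m x1) (opp m a1)"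
    using removed_comp_opp transpose_commute by metis
  have "r2 = r1 \<circ> transpose a2 x2" by (simp add: r1_def comp_assoc)
  then have 3: "r2 \<circ> opp m = (r1 \<circ> opp m) \<circ> transpose (opp m a2) (opp m x2)"
    using removed_comp_opp by metis
  \<comment> \<open>The bare tree has one face, so a single chord gives at most two.\<close>
  have n1: "ncyc (r1 \<circ> opp m) (darts m) \<le> 2"
    unfolding 2 using ncyc_transpose_le[OF p(2) finite_darts xd(1,3)] n0 by simp
  have c1: "cyc (r1 \<circ> opp m) (M @ [opp m a1])"
    unfolding 2 by (rule cyc_split(2)[of _ P _ _ _ S]) (use c0 W in simp)
  \<comment> \<open>If the chords crossed, the ends of the second one would lie on different faces
    of the map with one chord. Gluing it would leave at most one face, and the remaining
    \<open>card LD - 2\<close> gluings cannot raise this to \<open>card LD + 1\<close>.\<close>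
  have "opp m x2 \<notin> orbit (r1 \<circ> opp m) (opp m a2)"
  proof
    assume o: "opp m x2 \<in> orbit (r1 \<circ> opp m) (opp m a2)"
    have perm: "permutation (r1 \<circ> opp m)" using p(1) finite_darts permutes_permutation by blast
    have "orbit (r1 \<circ> opp m) (opp m x2) = orbit (r1 \<circ> opp m) (opp m a2)"
      using o perm cyclic_on_orbit' orbit_cyclic_eq3 by metis
    then show False using neg cyc_orbit[OF c1] permutation_self_in_orbit[OF perm] by metis
  qed
  then have "ncyc (r1 \<circ> opp m) (darts m) = Suc (ncyc (r2 \<circ> opp m) (darts m))"
    unfolding 3 using ncyc_merge[OF p(1) finite_darts xd(4,2)] by blast
  then show False using r2(2) planar cZ cardBK n1 by simp
qed

end


section \<open>Separability\<close>

lemma opp_closed_word: "(\<And>d. op (op d) = d) \<Longrightarrow> op y \<in> set (word op c) \<longleftrightarrow> y \<in> set (word op c)"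
proof -
  assume op: "\<And>d. op (op d) = d"
  have "op y \<in> A \<union> op ` A \<longleftrightarrow> y \<in> A \<union> op ` A" for A
  proof -
    have "op z \<in> A \<union> op ` A" if "z \<in> A \<union> op ` A" for z using that op by auto
    from this[of y] this[of "op y"] show ?thesis using op by auto
  qed
  from this[of "fst ` set (aleaves c) \<union> set (ndarts c)"] show ?thesis unfolding set_word_eq .
qed

lemma incidentI: "e \<in> E \<Longrightarrow> y \<in> e \<Longrightarrow> y \<in> x \<Longrightarrow> incident x E"
  unfolding incident_def by (rule bexI[of _ e]) auto

context explored_map
begin

lemma fam_sub_word: "fam path P (us @ c # vs) Q \<Longrightarrow> set (word (opp m) c) \<subseteq> darts m"
  using fam_W set_W' by fastforce

text \<open>A subtree touches the rest of the map only through its upper dart and through back edges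
  that leave it. The current vertex has depth \<open>length path - 2\<close>, so the bound on
  \<open>q\<close> says that the back edge ends at this vertex or above it.\<close>

lemma inside_cases:
  assumes "fam path P ts Q" "c \<in> set ts" "y \<in> set (word (opp m) c)"
  shows "y = dart c \<or> vertex m y \<subseteq> set (word (opp m) c) \<or>
    (\<exists>d q. y = opp m d \<and> (d, q) \<in> set (aleaves c) \<and> q < int (length path) - 1)"
  using assms
proof (induction c arbitrary: path P ts Q)
  case (AL d q)
  have "explored m path (AL d q)" using fam_explored[OF AL.prems(1,2)] .
  then show ?case using AL.prems(3) by auto
next
  case (AN d us)
  obtain as bs where ts: "ts = as @ AN d us # bs" using AN.prems(2) by (meson split_list)
  have f: "fam (path @ [opp m d]) (P @ words (opp m) as @ [d]) us (opp m d # words (opp m) bs @ Q)"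
    using fam_child AN.prems(1) ts by simp
  have V: "vertex m (opp m d) \<subseteq> set (word (opp m) (AN d us))"
  proof -
    have "vertex m (opp m d) = insert (opp m d) (set (vl (path @ [opp m d])))"
      using vertex_vl[OF f] by simp
    moreover have "set (vl (path @ [opp m d])) \<subseteq> set (words (opp m) us)"
      using vl_subset[OF f] dart_in_word(1)[of _ "opp m"] backs_subset_word[of "opp m"] by fastforce
    ultimately show ?thesis by auto
  qed
  have in_V: "vertex m y \<subseteq> set (word (opp m) (AN d us))" if "y \<in> vertex m (opp m d)" for y
    using vertex_eq[OF that] V by simp
  consider "y = d" | "y = opp m d" | c where "c \<in> set us" "y \<in> set (word (opp m) c)"
    using AN.prems(3) by auto
  then show ?case
  proof cases
    case 3
    have sub: "set (word (opp m) c) \<subseteq> set (word (opp m) (AN d us))" using 3 by auto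
    from AN.IH[OF 3(1) f 3] consider "y = dart c" | "vertex m y \<subseteq> set (word (opp m) c)"
      | e q where "y = opp m e" "(e, q) \<in> set (aleaves c)" "q < int (length path)"
      by fastforce
    then show ?thesis
    proof cases
      case 1
      then have "y \<in> vertex m (opp m d)" using dart_in_vl[OF f 3(1)] vertex_vl[OF f] by simp
      then show ?thesis using in_V by blast
    next
      case 2
      then show ?thesis using sub by blast
    next
      case (3 e q)
      have mem: "(e, q) \<in> set (aleaves (AN d us))" using 3(2) \<open>c \<in> set us\<close> by auto
      show ?thesis
      proof (cases "q < int (length path) - 1")
        case True
        then show ?thesis using 3(1) mem by blast
      next
        case False
        then have "nat (q + 1) = length path" using 3(3) by simp
        then have "y \<in> vertex m (opp m d)"
          using leaf_explored(2)[OF f \<open>c \<in> set us\<close> 3(2)] 3 by simp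
        then show ?thesis using in_V by blast
      qed
    qed
  qed (use V in auto)
qed

text \<open>If no back edge from \<open>c\<close> ends above the current vertex, then by
  \<open>inside_cases\<close> the edges of \<open>c\<close> meet the others in that vertex alone.
  The last hypothesis provides an edge outside \<open>c\<close> there, to the parent or to another
  child.\<close>

lemma separable_child:
  assumes f: "fam path P (us @ c # vs) Q"
    and high: "\<And>d q. (d, q) \<in> set (aleaves c) \<Longrightarrow> int (length path) - 2 \<le> q"
    and other: "length path > 1 \<or> us \<noteq> [] \<or> vs \<noteq> []"
  shows "separable m"
proof -
  let ?S = "set (word (opp m) c)" and ?s = "vertex m (last path)"
  define E1 where "E1 = {e \<in> edges m. e \<subseteq> ?S}"
  define E2 where "E2 = edges m - E1"
  have closed: "opp m y \<in> ?S \<longleftrightarrow> y \<in> ?S" for y using opp_closed_word[OF opp_opp] .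
  have cts: "c \<in> set (us @ c # vs)" by simp
  have edge_in: "{y, opp m y} \<in> E1" if "y \<in> ?S" for y
    using that closed fam_sub_word[OF f] by (auto simp: E1_def edges_def)
  have edge_out: "{y, opp m y} \<in> E2" if "y \<notin> ?S" "y \<in> darts m" for y
    using that by (auto simp: E1_def E2_def edges_def)
  have E1D: "y \<in> ?S" if "e \<in> E1" "y \<in> e" for e y using that by (auto simp: E1_def)
  have E2D: "y \<notin> ?S" if "e \<in> E2" "y \<in> e" for e y
    using that closed by (auto simp: E1_def E2_def edges_def)
  have dc: "dart c \<in> ?s" using dart_in_vl[OF f cts] vertex_vl[OF f] by simp
  have W: "W = P @ words (opp m) us @ word (opp m) c @ words (opp m) vs @ Q" using fam_W[OF f] by simp
  have lastD: "last path \<in> darts m" using fam_last_EN[OF f] EN_darts by auto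
  obtain y where y: "y \<in> ?s" "y \<notin> ?S"
  proof (cases "length path > 1")
    case True
    then have "last path \<in> set (tl path)" by (cases path) auto
    then have "last path \<in> set Q" using fam_path_distinct[OF f] by auto
    then have "last path \<notin> ?S" using distinct_sub unfolding W by auto
    then show ?thesis using that vertex_self by blast
  next
    case False
    then obtain c' where c': "c' \<in> set (us @ vs)" using other by (cases us; cases vs) auto
    then have "dart c' \<in> ?s" using dart_in_vl[OF f, of c'] vertex_vl[OF f] by auto
    moreover have "dart c' \<notin> ?S"
    proof -
      have "dart c' \<in> set (words (opp m) us) \<union> set (words (opp m) vs)"
        using c' dart_in_word(1)[of c' "opp m"] by auto
      then show ?thesis using distinct_sub unfolding W by (auto simp del: set_concat)
    qed
    ultimately show ?thesis using that by blast
  qed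
  have yD: "y \<in> darts m" using y(1) vertex_sub[OF lastD] by blast
  have "E1 \<noteq> {}" using edge_in dart_in_word(1)[of c "opp m"] by blast
  moreover have "E2 \<noteq> {}" using edge_out[OF y(2) yD] by blast
  moreover have "E1 \<inter> E2 = {}" "E1 \<union> E2 = edges m" by (auto simp: E1_def E2_def)
  moreover have uniq: "\<exists>!v. v \<in> vertices m \<and> incident v E1 \<and> incident v E2"
  proof (rule ex1I)
    have "?s \<in> vertices m" using lastD by (simp add: vertices_def)
    moreover have "incident ?s E1"
      by (rule incidentI[OF edge_in[OF dart_in_word(1)] _ dc]) simp
    moreover have "incident ?s E2" by (rule incidentI[OF edge_out[OF y(2) yD] _ y(1)]) simp
    ultimately show "?s \<in> vertices m \<and> incident ?s E1 \<and> incident ?s E2" by blast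
  next
    fix x assume x: "x \<in> vertices m \<and> incident x E1 \<and> incident x E2"
    then obtain y1 y2 where y12: "y1 \<in> x" "y1 \<in> ?S" "y2 \<in> x" "y2 \<notin> ?S"
      using E1D E2D unfolding incident_def by blast
    obtain d where "x = vertex m d" using x by (auto simp: vertices_def)
    then have x1: "vertex m y1 = x" using y12 vertex_eq by blast
    from inside_cases[OF f cts y12(2)] show "x = ?s"
    proof (elim disjE exE conjE)
      assume "y1 = dart c"
      then show ?thesis using dc vertex_eq x1 by blast
    next
      assume "vertex m y1 \<subseteq> ?S"
      then show ?thesis using x1 y12 by blast
    next
      fix d q assume y1: "y1 = opp m d" and dq: "(d, q) \<in> set (aleaves c)" and q: "q < int (length path) - 1"
      have "nat (q + 1) = length path - 1" using high[OF dq] q by simp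
      then have "y1 \<in> vertex m (path ! (length path - 1))"
        using leaf_explored(2)[OF f cts dq q] y1 by simp
      then show ?thesis using x1 vertex_eq fam_path[OF f] by (metis last_conv_nth)
    qed
  qed
  ultimately show ?thesis unfolding separable_def
    by (intro exI[of _ E1] exI[of _ E2] conjI) (assumption | rule uniq)+
qed

text \<open>Colour the edges by the side of a separating partition; exactly one vertex then has both
  colours. Where the colour first changes from a vertex to a child, that vertex is the bicoloured
  one, so the subtree of the child is monochromatic. But a leaf of low label carries the new colour
  to a proper ancestor, which becomes bicoloured as well.\<close>

lemma not_separableI:
  assumes single: "forest = [\<tau>]"
    and low: "\<And>path P ts Q c. fam path P ts Q \<Longrightarrow> length path > 1 \<Longrightarrow> c \<in> set ts \<Longrightarrow>
      \<exists>d q. (d, q) \<in> set (aleaves c) \<and> q < int (length path) - 2"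
  shows "\<not> separable m"
proof
  assume "separable m"
  then obtain E1 E2 where E: "E1 \<noteq> {}" "E2 \<noteq> {}" "E1 \<inter> E2 = {}" "E1 \<union> E2 = edges m"
    and un: "\<exists>!v. v \<in> vertices m \<and> incident v E1 \<and> incident v E2" unfolding separable_def by (elim exE conjE)
  define col where "col y \<longleftrightarrow> {y, opp m y} \<in> E1" for y
  have col_opp: "col (opp m y) = col y" for y by (simp add: col_def insert_commute)
  have bi: "incident x E1 \<and> incident x E2" if "y \<in> x" "y' \<in> x" "col y \<noteq> col y'" "x \<subseteq> darts m" for x y y'
  proof -
    have "incident x E1" if "y \<in> x" "col y" for y
      by (rule incidentI[OF that(2)[unfolded col_def] _ that(1)]) simp
    moreover have "incident x E2" if "y \<in> x" "\<not> col y" for y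
    proof -
      have "{y, opp m y} \<in> edges m" using that \<open>x \<subseteq> darts m\<close> by (auto simp: edges_def)
      then have "{y, opp m y} \<in> E2" using E that by (auto simp: col_def)
      from incidentI[OF this _ that(1)] show ?thesis by simp
    qed
    ultimately show ?thesis using that by blast
  qed
  have uniq: "vertex m e = vertex m e'" if "e \<in> EN" "e' \<in> EN" "y \<in> vertex m e" "z \<in> vertex m e" "col y \<noteq> col z"
    "y' \<in> vertex m e'" "z' \<in> vertex m e'" "col y' \<noteq> col z'" for e e' y z y' z'
  proof -
    have "vertex m e \<subseteq> darts m" "vertex m e' \<subseteq> darts m" "vertex m e \<in> vertices m" "vertex m e' \<in> vertices m"
      using that(1,2) EN_darts vertex_sub by (auto simp: vertices_def)
    then show ?thesis using bi[OF that(3-5)] bi[OF that(6-8)] un by blast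
  qed
  have mono_word: "col y = col (dart c)"
    if "fam path P ts Q" "c \<in> set ts" "y \<in> set (word (opp m) c)"
      "\<And>d z z'. d \<in> set (ndarts c) \<Longrightarrow> z \<in> vertex m (opp m d) \<Longrightarrow> z' \<in> vertex m (opp m d) \<Longrightarrow> col z = col z'"
    for path P ts Q c y
    using that
  proof (induction c arbitrary: path P ts Q)
    case (AL d q)
    then show ?case using col_opp by auto
  next
    case (AN d us)
    obtain as bs where ts: "ts = as @ AN d us # bs" using AN.prems(2) by (meson split_list)
    have f: "fam (path @ [opp m d]) (P @ words (opp m) as @ [d]) us (opp m d # words (opp m) bs @ Q)"
      using fam_child AN.prems(1) ts by simp
    consider "y = d" | "y = opp m d" | c where "c \<in> set us" "y \<in> set (word (opp m) c)"
      using AN.prems(3) by auto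
    then show ?case
    proof cases
      case 3
      have "col y = col (dart c)"
        using AN.IH[OF 3(1) f 3] AN.prems(4) 3(1) by auto
      also have "\<dots> = col (opp m d)"
        using AN.prems(4)[of d] dart_in_vl[OF f 3(1)] vertex_vl[OF f] vertex_self by auto
      finally show ?thesis using col_opp by simp
    qed (simp_all add: col_opp)
  qed
  have child: "col (dart c) = col (root_dart m)"
    if f: "fam path P ts Q" and c: "c \<in> set ts" and pc: "\<And>e. e \<in> set path \<Longrightarrow> col e = col (root_dart m)"
    for path P ts Q c
  proof (rule ccontr)
    assume ne: "col (dart c) \<noteq> col (root_dart m)"
    \<comment> \<open>At \<open>v\<close> there is a single child, and its dart is the root dart
      itself.\<close>
    have len: "length path > 1"
    proof (rule ccontr)
      assume "\<not> length path > 1"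
      with f have "ts = forest"
        by cases (use fam_path in fastforce)+
      then show False using ne c root_first single by auto
    qed
    let ?s = "vertex m (last path)"
    have lp: "last path \<in> set path" using fam_path[OF f] by simp
    have dc: "dart c \<in> ?s" using dart_in_vl[OF f c] vertex_vl[OF f] by simp
    have s: "dart c \<in> ?s" "last path \<in> ?s" "col (dart c) \<noteq> col (last path)"
      using dc vertex_self pc[OF lp] ne by auto
    have EN: "last path \<in> EN" using fam_last_EN[OF f] .
    have mono: "col z = col z'"
      if d: "d \<in> set (ndarts c)" and z: "z \<in> vertex m (opp m d)" "z' \<in> vertex m (opp m d)" for d z z'
    proof (rule ccontr)
      assume nz: "col z \<noteq> col z'"
      obtain path' P' ts' Q' where f': "fam (path @ path' @ [opp m d]) P' ts' Q'" using node_fam[OF f c d] by blast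
      have "opp m d \<in> EN" using fam_last_EN[OF f'] by simp
      from uniq[OF this EN z nz s] have "vertex m (opp m d) = ?s" .
      then have "opp m d = last path" using fam_vertex_inj[OF f' f] by simp
      then show False using fam_path_distinct[OF f'] lp by auto
    qed
    obtain d q where dq: "(d, q) \<in> set (aleaves c)" "q < int (length path) - 2" using low[OF f len c] by blast
    have "opp m d \<in> set (word (opp m) c)" unfolding set_word_eq using dq(1) by force
    then have cd: "col (opp m d) = col (dart c)" using mono_word[OF f c] mono by blast
    let ?i = "nat (q + 1)"
    have q: "-1 \<le> q" and x: "opp m d \<in> vertex m (path ! ?i)"
      using leaf_explored[OF f c dq(1)] dq(2) by auto
    have i: "?i < length path" "?i \<noteq> length path - 1" using q dq(2) by auto
    have pi: "path ! ?i \<in> set path" using i by simp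
    then have "path ! ?i \<in> EN" using fam_EN[OF f] by blast
    moreover have "col (opp m d) \<noteq> col (path ! ?i)" using cd ne pc[OF pi] by simp
    ultimately have "vertex m (path ! ?i) = ?s" using uniq[OF _ EN x vertex_self _ s] by blast
    then have "vertex m (path ! ?i) = vertex m (path ! (length path - 1))"
      using fam_path[OF f] by (simp add: last_conv_nth)
    from fam_path_vertex_inj[OF f i(1) _ this] i fam_path[OF f] show False by simp
  qed
  have path_col: "fam path P ts Q \<Longrightarrow> e \<in> set path \<Longrightarrow> col e = col (root_dart m)" for path P ts Q e
  proof (induction arbitrary: e rule: fam.induct)
    case (fam_child path P us d ts vs Q)
    have "col d = col (root_dart m)" using child[OF fam_child.hyps, of "AN d ts"] fam_child.IH by simp
    then show ?case using fam_child col_opp by auto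
  qed simp
  have LDcol: "col d = col (root_dart m)" if d: "d \<in> LD" for d
  proof -
    obtain c q where "c \<in> set forest" "(d, q) \<in> set (aleaves c)" using d unfolding LD_def by auto
    from leaf_fam[OF fam_root this] obtain path P us vs Q where f: "fam path P (us @ AL d q # vs) Q" by blast
    from child[OF f, of "AL d q"] path_col[OF f] show ?thesis by simp
  qed
  have NDcol: "col d = col (root_dart m)" if d: "d \<in> ND" for d
  proof -
    have "opp m d \<in> EN" using d by (simp add: EN_def)
    then obtain path P ts Q where f: "fam path P ts Q" "last path = opp m d" using EN_fam by blast
    then show ?thesis using path_col[OF f(1), of "opp m d"] fam_path[OF f(1)] col_opp by (metis last_in_set)
  qed
  have all: "col y = col (root_dart m)" if "y \<in> darts m" for y
    using that LDcol NDcol col_opp unfolding W_sets by auto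
  obtain e1 where "e1 \<in> E1" using E by blast
  moreover have "e1 \<in> edges m" using calculation E(4) by (metis UnI1)
  then obtain y1 where y1: "y1 \<in> darts m" "e1 = {y1, opp m y1}" unfolding edges_def by (elim imageE)
  ultimately have y1c: "col y1" by (simp add: col_def)
  obtain e2 where e2: "e2 \<in> E2" using E by blast
  then have "e2 \<in> edges m" using E(4) by (metis UnI2)
  then obtain y2 where y2: "y2 \<in> darts m" "e2 = {y2, opp m y2}" unfolding edges_def by (elim imageE)
  then have "\<not> col y2" using E(3) e2 unfolding col_def by (metis IntI empty_iff)
  then show False using all[OF y1(1)] all[OF y2(1)] y1c by simp
qed

end


section \<open>Back edges of a planar map\<close>

text \<open>At a vertex with \<open>E = {}\<close> the first alternative is impossible, so every end
  of a back edge stands behind some child dart, with nothing but ends of back edges in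
  between.\<close>

lemma splits_anchor:
  assumes "splits op E ts ds" "x \<in> set ds" "x \<notin> dart ` set ts"
  shows "(\<exists>Y B. ds = Y @ x # B \<and> set Y \<subseteq> E \<and> x \<in> E) \<or>
    (\<exists>us c vs A Y B. ts = us @ c # vs \<and> ds = A @ dart c # Y @ x # B \<and>
       set (Y @ [x]) \<subseteq> E \<union> (\<Union>c\<in>set (us @ [c]). backs op c))"
  using assms
proof (induction ts arbitrary: E ds)
  case Nil
  then show ?case by (metis in_set_conv_decomp splits.simps(1) le_sup_iff set_append subsetD)
next
  case (Cons c ts)
  then obtain Y ds' where 1: "ds = Y @ dart c # ds'" "set Y \<subseteq> E" "splits op (E \<union> backs op c) ts ds'"
    by auto
  show ?case
  proof (cases "x \<in> set Y")
    case True
    then obtain Y1 Y2 where "Y = Y1 @ x # Y2" by (meson split_list)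
    then have "ds = Y1 @ x # (Y2 @ dart c # ds') \<and> set Y1 \<subseteq> E \<and> x \<in> E" using 1 by auto
    then show ?thesis by blast
  next
    case False
    then have "x \<in> set ds'" using Cons.prems 1 by auto
    moreover have "x \<notin> dart ` set ts" using Cons.prems(3) by simp
    ultimately have "(\<exists>Y B. ds' = Y @ x # B \<and> set Y \<subseteq> E \<union> backs op c \<and> x \<in> E \<union> backs op c) \<or>
      (\<exists>us ca vs A Y B. ts = us @ ca # vs \<and> ds' = A @ dart ca # Y @ x # B \<and>
        set (Y @ [x]) \<subseteq> E \<union> backs op c \<union> (\<Union>c\<in>set (us @ [ca]). backs op c))"
      using Cons.IH[OF 1(3)] by metis
    then show ?thesis
    proof (elim disjE exE conjE)
      fix Y' B assume "ds' = Y' @ x # B" "set Y' \<subseteq> E \<union> backs op c" "x \<in> E \<union> backs op c"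
      then have "c # ts = [] @ c # ts" "ds = Y @ dart c # Y' @ x # B"
        "set (Y' @ [x]) \<subseteq> E \<union> (\<Union>c\<in>set ([] @ [c]). backs op c)"
        using 1 by auto
      then show ?thesis by blast
    next
      fix us c' vs A Y' B
      assume "ts = us @ c' # vs" "ds' = A @ dart c' # Y' @ x # B"
        "set (Y' @ [x]) \<subseteq> E \<union> backs op c \<union> (\<Union>c\<in>set (us @ [c']). backs op c)"
      then have "c # ts = (c # us) @ c' # vs" "ds = (Y @ dart c # A) @ dart c' # Y' @ x # B"
        "set (Y' @ [x]) \<subseteq> E \<union> (\<Union>c\<in>set ((c # us) @ [c']). backs op c)"
        using 1 by auto
      then show ?thesis by blast
    qed
  qed
qed

lemma sorted_wrt_unique:
  assumes "sorted_wrt R xs" "sorted_wrt R ys" "set xs = set ys" "\<And>x y. R x y \<Longrightarrow> \<not> R y x"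
  shows "xs = ys"
  using assms(1-3)
proof (induction xs arbitrary: ys)
  case (Cons x xs)
  then obtain y zs where ys: "ys = y # zs" by (cases ys) auto
  have "x = y"
  proof (rule ccontr)
    assume "x \<noteq> y"
    then have "x \<in> set zs" "y \<in> set xs" using Cons.prems(3) ys by auto
    then have "R y x" "R x y" using Cons.prems(1,2) ys by auto
    then show False using assms(4) by blast
  qed
  have "x \<notin> set xs" "y \<notin> set zs" using Cons.prems(1,2) ys assms(4) by auto
  then have "set xs = set zs" using Cons.prems(3) ys \<open>x = y\<close> by auto
  then have "xs = zs" using Cons.IH[of zs] Cons.prems ys by simp
  then show ?case using ys \<open>x = y\<close> by simp
qed simp

lemma filter_split:
  "filter P w = xs @ y # ys \<Longrightarrow> \<exists>us vs. w = us @ y # vs \<and> filter P vs = ys"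
proof (induction w arbitrary: xs)
  case (Cons a w)
  show ?case
  proof (cases "P a \<and> xs = []")
    case True
    then have "a # w = [] @ y # w \<and> filter P w = ys" using Cons.prems by auto
    then show ?thesis by blast
  next
    case False
    then have "filter P w = xs @ y # ys \<or> filter P w = tl xs @ y # ys"
      using Cons.prems by (cases xs) (auto split: if_splits)
    then obtain us vs where "w = us @ y # vs" "filter P vs = ys" using Cons.IH by blast
    then have "a # w = (a # us) @ y # vs \<and> filter P vs = ys" by simp
    then show ?thesis by blast
  qed
qed simp

section \<open>Corners of the tree in which back edges end\<close>

context explored_map
begin

text \<open>\<open>a\<close> is the nearest dart before \<open>x\<close> that survives the cutting
  of all back edges, so \<open>x\<close> sits in the corner behind \<open>a\<close> of the bare
  tree. The contour passes this corner when it leaves \<open>opp m a\<close>; hence the chord of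
  \<open>x\<close> joins the leaf dart \<open>opp m x\<close> to \<open>opp m a\<close>.\<close>

definition anchored :: "'d \<Rightarrow> 'd \<Rightarrow> bool" where
  "anchored a x \<longleftrightarrow> (\<exists>e\<in>EN. \<exists>A Y B. support (rot m) e = A @ a # Y @ x # B \<and> set Y \<subseteq> BK \<and> a \<notin> BK)"

lemma vl_support:
  assumes "fam path P ts Q" "vl path = A @ l"
  shows "\<exists>A'. support (rot m) (last path) = A' @ l"
proof (cases "length path = 1")
  case True
  then show ?thesis using assms(2) by (auto simp: vl_def)
next
  case False
  then have "support (rot m) (last path) = last path # A @ l"
    using assms(2) support_rot_Cons[of "last path"] by (simp add: vl_def)
  then show ?thesis by (metis append_Cons)
qed

lemma leaf_in_vl:
  assumes "fam path P ts Q" "c \<in> set ts" "(d, q) \<in> set (aleaves c)" "q = int (length path) - 2"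
  shows "opp m d \<in> set (vl path)"
proof -
  have ne: "path \<noteq> []" using fam_path[OF assms(1)] by simp
  then have "nat (q + 1) = length path - 1" "q < int (length path) - 1" using assms(4) by (cases path; simp)+
  then have "opp m d \<in> vertex m (last path)"
    using leaf_explored(2)[OF assms(1-3)] ne by (simp add: last_conv_nth)
  moreover have "opp m d \<noteq> last path"
    using EN_BK[OF fam_last_EN[OF assms(1)]] fam_leaf_LD[OF assms(1-3)] unfolding BK_def by (metis imageI)
  ultimately show ?thesis using vertex_vl[OF assms(1)] by blast
qed

lemma leaf_label_vl:
  assumes "fam path P ts Q" "c \<in> set ts" "(d, q) \<in> set (aleaves c)" "opp m d \<in> set (vl path)"
  shows "q = int (length path) - 2"
proof -
  have ne: "path \<noteq> []" using fam_path[OF assms(1)] by simp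
  have "opp m d \<in> vertex m (path ! (length path - 1))"
    using assms(4) vertex_vl[OF assms(1)] ne by (metis insertI2 last_conv_nth)
  from leaf_explored(3)[OF assms(1-3) _ this] ne show ?thesis by (cases path) auto
qed

text \<open>The end of a back edge from \<open>c\<close> is met as an examined edge only after
  \<open>c\<close> has been explored, so the corner that contains it follows \<open>c\<close> or a
  later child.\<close>

lemma anchor_same:
  assumes f: "fam path P (us @ c # vs) Q" and d: "(d, q) \<in> set (aleaves c)" "q = int (length path) - 2"
  shows "\<exists>c'\<in>set (c # vs). \<exists>A Y B. vl path = A @ dart c' # Y @ opp m d # B \<and> set Y \<subseteq> BK"
proof -
  let ?x = "opp m d"
  have cts: "c \<in> set (us @ c # vs)" by simp
  have x: "?x \<in> set (vl path)" using leaf_in_vl[OF f cts d] .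
  have xB: "?x \<in> BK" using fam_leaf_LD[OF f cts d(1)] by (auto simp: BK_def)
  then have nd: "?x \<notin> dart ` set (us @ c # vs)" using dart_BK[OF f] by (metis imageE)
  from splits_anchor[OF fam_splits[OF f] x nd] obtain us' c' vs' A Y B where
    1: "us @ c # vs = us' @ c' # vs'" "vl path = A @ dart c' # Y @ ?x # B"
      "set (Y @ [?x]) \<subseteq> (\<Union>c\<in>set (us' @ [c']). backs (opp m) c)"
    by (metis empty_iff sup_bot_left)
  have ts: "set (us' @ [c']) \<subseteq> set (us @ c # vs)" using 1(1) by auto
  have "(\<Union>c\<in>set (us' @ [c']). backs (opp m) c) \<subseteq> BK"
    using fam_backs[OF f] ts unfolding BK_def by (meson UN_least subsetD)
  then have "set Y \<subseteq> BK" using 1(3) unfolding set_append by (meson le_sup_iff subset_trans)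
  moreover have "c' \<in> set (c # vs)"
  proof (rule ccontr)
    assume nc: "c' \<notin> set (c # vs)"
    from 1(1) obtain ws where "us = us' @ ws \<and> ws @ c # vs = c' # vs' \<or> us @ ws = us' \<and> c # vs = ws @ c' # vs'"
      unfolding append_eq_append_conv2 by metis
    then have "set (us' @ [c']) \<subseteq> set us" using nc by (cases ws) auto
    then have "(\<Union>c\<in>set (us' @ [c']). backs (opp m) c) \<subseteq> set (words (opp m) us)"
      using backs_subset_word[of "opp m"] unfolding set_concat set_map by blast
    then have "?x \<in> set (words (opp m) us)" using 1(3) by auto
    moreover have "?x \<in> set (word (opp m) c)" using d(1) backs_subset_word[of "opp m" c] unfolding backs_def by force
    moreover have "distinct (P @ words (opp m) us @ word (opp m) c @ words (opp m) vs @ Q)"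
      using distinct_sub fam_W[OF f] by simp
    then have "set (words (opp m) us) \<inter> set (word (opp m) c) = {}" by (auto simp del: set_concat)
    ultimately show False by blast
  qed
  ultimately show ?thesis using 1(2) by blast
qed

lemma anchor_same_anchored:
  assumes "fam path P ts Q" "c \<in> set ts" "vl path = A @ dart c # Y @ x # B" "set Y \<subseteq> BK"
  shows "anchored (dart c) x"
proof -
  obtain A' where "support (rot m) (last path) = A' @ dart c # Y @ x # B"
    using vl_support[OF assms(1,3)] by blast
  then show ?thesis unfolding anchored_def using assms(4) dart_BK[OF assms(1,2)] fam_last_EN[OF assms(1)] by blast
qed

text \<open>At the ancestor where the back edge ends, its corner follows the branch leading here or
  a later child (\<open>anchor_same\<close>). The lower darts of these come after the current family
  in the contour, hence lie in \<open>Q\<close>.\<close>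

lemma anchor_below:
  assumes "fam path P ts Q" "c \<in> set ts" "(d, q) \<in> set (aleaves c)" "q < int (length path) - 2"
  shows "\<exists>a. anchored a (opp m d) \<and> opp m a \<in> set Q"
  using assms
proof (induction arbitrary: c rule: fam.induct)
  case fam_root
  then show ?case using leaf_explored(1)[OF fam.fam_root fam_root(1,2)] by simp
next
  case (fam_child path P us d0 ts vs Q)
  have leaf: "(d, q) \<in> set (aleaves (AN d0 ts))" using fam_child.prems by auto
  show ?case
  proof (cases "q < int (length path) - 2")
    case True
    then show ?thesis using fam_child.IH[OF _ leaf] by auto
  next
    case False
    then have q: "q = int (length path) - 2" using fam_child.prems by simp
    from anchor_same[OF fam_child.hyps leaf q] obtain c' A Y B where
      c': "c' \<in> set (AN d0 ts # vs)" "vl path = A @ dart c' # Y @ opp m d # B" "set Y \<subseteq> BK" by blast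
    have "anchored (dart c') (opp m d)"
      using anchor_same_anchored[OF fam_child.hyps _ c'(2,3)] c'(1) by auto
    moreover have "opp m (dart c') \<in> set (opp m d0 # words (opp m) vs @ Q)"
      using c'(1) dart_in_word(2)[of "opp m" c'] by auto
    ultimately show ?thesis by blast
  qed
qed

text \<open>The chord of \<open>d1\<close> ends at the current vertex, in the corner behind
  \<open>a\<close>, and \<open>d2\<close> lies between its two ends. The back edge of
  \<open>d2\<close> goes to a proper ancestor, so the other end of its chord is in \<open>Q\<close>
  by \<open>anchor_below\<close>, and the chords cross.\<close>

lemma noncross:
  assumes planar: "ncyc (rot m \<circ> opp m) (darts m) = Suc (card LD)" and f: "fam path P ts Q"
    and w: "words (opp m) ts = w1 @ d1 # w2 @ d2 # w3 @ opp m a # w4"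
    and c1: "c1 \<in> set ts" "(d1, q1) \<in> set (aleaves c1)"
    and v: "vl path = A @ a # Y @ opp m d1 # B" "set Y \<subseteq> BK" "a \<notin> BK"
    and c2: "c2 \<in> set ts" "(d2, q2) \<in> set (aleaves c2)" "q2 < int (length path) - 2"
  shows False
proof -
  obtain A' where l1: "support (rot m) (last path) = A' @ a # Y @ opp m d1 # B"
    using vl_support[OF f v(1)] by blast
  obtain a2 where a2: "anchored a2 (opp m d2)" "opp m a2 \<in> set Q" using anchor_below[OF f c2] by blast
  then obtain e2 A2 Y2 B2 where e2: "e2 \<in> EN" "support (rot m) e2 = A2 @ a2 # Y2 @ opp m d2 # B2"
    "set Y2 \<subseteq> BK" "a2 \<notin> BK" unfolding anchored_def by blast
  \<comment> \<open>\<open>chords\<close> requires that \<open>opp m d1\<close> does not stand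
    between \<open>a2\<close> and \<open>opp m d2\<close>; it is not even at the same vertex,
    because \<open>q2\<close> is the depth of a proper ancestor.\<close>
  have nx: "opp m d1 \<notin> set Y2"
  proof
    assume "opp m d1 \<in> set Y2"
    then have "opp m d1 \<in> set (support (rot m) e2)" unfolding e2(2) by simp
    moreover have "opp m d1 \<in> set (support (rot m) (last path))" unfolding l1 by simp
    ultimately have "e2 = last path" using support_disjoint e2(1) fam_last_EN[OF f] by blast
    then have "opp m d2 \<in> set (support (rot m) (last path))" using e2(2) by simp
    then have "opp m d2 \<in> vertex m (path ! (length path - 1))"
      unfolding vertex_eq_support using fam_path[OF f] last_conv_nth by metis
    from leaf_explored(3)[OF f c2(1,2) _ this] c2(3) fam_path[OF f] show False by (cases path) auto
  qed
  have B1: "opp m d1 \<in> BK" and B2: "opp m d2 \<in> BK"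
    using fam_leaf_LD[OF f c1] fam_leaf_LD[OF f c2(1,2)] by (auto simp: BK_def)
  have W: "W = (P @ w1) @ opp m (opp m d1) # (w2 @ d2 # w3) @ opp m a # (w4 @ Q)"
    using fam_W[OF f] w by simp
  have dW: "distinct ((P @ w1) @ d1 # (w2 @ d2 # w3) @ opp m a # (w4 @ Q))" using distinct_sub W by simp
  then have "d1 \<noteq> d2" by auto
  then have ne: "opp m d1 \<noteq> opp m d2" using opp_inj by blast
  have "opp m (opp m d2) \<in> set ((w2 @ d2 # w3) @ [opp m a]) \<longleftrightarrow> opp m a2 \<in> set ((w2 @ d2 # w3) @ [opp m a])"
    by (rule chords[OF planar fam_last_EN[OF f] e2(1) l1 e2(2) v(2) e2(3) nx B1 B2 ne v(3) e2(4) W])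
  moreover have "opp m a2 \<notin> set ((w2 @ d2 # w3) @ [opp m a])" using dW a2(2) by auto
  ultimately show False by simp
qed

text \<open>Chords ending in the same corner are nested, so their ends stand around the vertex in
  the reverse of the contour order, i.e. in the traversal order of the leaves.\<close>

lemma noncross_same:
  assumes planar: "ncyc (rot m \<circ> opp m) (darts m) = Suc (card LD)" and f: "fam path P ts Q"
    and w: "words (opp m) ts = w1 @ d2 # w2 @ d1 # w3 @ opp m a # w4"
    and d: "d1 \<in> LD" "d2 \<in> LD"
    and v: "vl path = A @ a # Y @ opp m d2 # Y' @ opp m d1 # B" "set Y \<subseteq> BK" "set Y' \<subseteq> BK" "a \<notin> BK"
  shows False
proof -
  have B1: "opp m d1 \<in> BK" and B2: "opp m d2 \<in> BK" using d by (auto simp: BK_def)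
  obtain A' where l: "support (rot m) (last path) = A' @ a # Y @ opp m d2 # Y' @ opp m d1 # B"
    using vl_support[OF f v(1)] by blast
  then have l': "support (rot m) (last path) = A' @ a # (Y @ opp m d2 # Y') @ opp m d1 # B" by simp
  have "distinct (A' @ a # Y @ opp m d2 # Y' @ opp m d1 # B)" using distinct_support_rot l by metis
  then have nx: "opp m d1 \<notin> set Y" and ne: "opp m d1 \<noteq> opp m d2" by auto
  have W: "W = (P @ w1 @ d2 # w2) @ opp m (opp m d1) # w3 @ opp m a # (w4 @ Q)"
    using fam_W[OF f] w by simp
  have dW: "distinct ((P @ w1 @ d2 # w2) @ d1 # w3 @ opp m a # (w4 @ Q))" using distinct_sub W by simp
  have Y: "set (Y @ opp m d2 # Y') \<subseteq> BK" using v B2 by auto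
  have "opp m (opp m d2) \<in> set (w3 @ [opp m a]) \<longleftrightarrow> opp m a \<in> set (w3 @ [opp m a])"
    by (rule chords[OF planar fam_last_EN[OF f] fam_last_EN[OF f] l' l Y v(2) nx B1 B2 ne v(4) v(4) W])
  then show False using dW by auto
qed

text \<open>The contour visits children clockwise and \<open>aleaves\<close> visits them
  counterclockwise, hence the reversal.\<close>

lemma word_leaves_filter:
  assumes "fam path P ts Q" "c \<in> set ts"
  shows "filter (\<lambda>y. y \<in> LD) (word (opp m) c) = rev (map fst (aleaves c))"
  using assms
proof (induction c arbitrary: path P ts Q)
  case (AL d q)
  then have "d \<in> LD" using fam_leaf_LD[OF AL] by simp
  moreover have "opp m d \<notin> LD" using calculation LD_ND by blast
  ultimately show ?case by simp
next
  case (AN d us)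
  obtain as bs where ts: "ts = as @ AN d us # bs" using AN.prems(2) by (meson split_list)
  have f: "fam (path @ [opp m d]) (P @ words (opp m) as @ [d]) us (opp m d # words (opp m) bs @ Q)"
    using fam_child AN.prems(1) ts by simp
  have "d \<in> ND" using fam_nodes[OF AN.prems(1)] AN.prems(2) by force
  then have "d \<notin> LD" "opp m d \<notin> LD" using LD_ND by blast+
  moreover have "filter (\<lambda>y. y \<in> LD) (words (opp m) us) = concat (map (\<lambda>c. rev (map fst (aleaves c))) us)"
    unfolding filter_concat map_map comp_def using AN.IH[OF _ f] by (auto intro!: arg_cong[of _ _ concat])
  moreover have "rev (map fst (fleaves us)) = concat (map (\<lambda>c. rev (map fst (aleaves c))) us)"
    by (induction us) auto
  ultimately show ?case by simp
qed

lemma leaf_order: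
  assumes "fam path P ts Q" "c \<in> set ts" "aleaves c = L1 @ (d2, q2) # L2 @ (d1, q1) # L3"
  shows "\<exists>w1 w2 w3. word (opp m) c = w1 @ d1 # w2 @ d2 # w3"
proof -
  have "filter (\<lambda>y. y \<in> LD) (word (opp m) c) =
      rev (map fst L3) @ d1 # rev (map fst L2) @ d2 # rev (map fst L1)"
    unfolding word_leaves_filter[OF assms(1,2)] assms(3) by simp
  then show ?thesis using filter_split by metis
qed

end


section \<open>Positions of the back edges around a vertex\<close>

lemma list_split2:
  assumes "i < k" "k < length l"
  shows "\<exists>A B C. l = A @ l ! i # B @ l ! k # C"
proof -
  have "l = take i l @ l ! i # drop (Suc i) l" using assms by (intro id_take_nth_drop) simp
  moreover have "l ! k \<in> set (drop (Suc i) l)"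
    using assms by (auto simp: in_set_conv_nth intro!: exI[of _ "k - Suc i"])
  then obtain B C where "drop (Suc i) l = B @ l ! k # C" by (meson split_list)
  ultimately show ?thesis by metis
qed

lemma two_elems_order:
  assumes "x \<in> set l" "y \<in> set l" "x \<noteq> y"
  shows "(\<exists>A B C. l = A @ x # B @ y # C) \<or> (\<exists>A B C. l = A @ y # B @ x # C)"
proof -
  obtain i k where "i < length l" "l ! i = x" "k < length l" "l ! k = y"
    using assms by (auto simp: in_set_conv_nth)
  then show ?thesis using list_split2[of i k l] list_split2[of k i l] assms(3)
    by (cases i k rule: linorder_cases) auto
qed

lemma order_asym:
  assumes "distinct l" "l = A @ x # B @ y # C" "l = A' @ y # B' @ x # C'"
  shows False
proof -
  have "l ! length A = x" "l ! (length A + length B + 1) = y" "length A + length B + 1 < length l"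
    unfolding assms(2) by (simp_all add: nth_append)
  moreover have "l ! length A' = y" "l ! (length A' + length B' + 1) = x" "length A' + length B' + 1 < length l"
    unfolding assms(3) by (simp_all add: nth_append)
  ultimately have "length A = length A' + length B' + 1" "length A + length B + 1 = length A'"
    using nth_eq_iff_index_eq[OF assms(1)] by (metis add_lessD1)+
  then show False by simp
qed

lemma concat_map2_split:
  assumes "i < length xs" "length ys = length xs"
  shows "\<exists>A B. concat (map2 g xs ys) = A @ g (xs ! i) (ys ! i) @ B"
proof -
  let ?z = "map2 g xs ys"
  have "?z = take i ?z @ ?z ! i # drop (Suc i) ?z" using assms by (intro id_take_nth_drop) simp
  then have "concat ?z = concat (take i ?z) @ ?z ! i @ concat (drop (Suc i) ?z)"
    by (metis concat.simps(2) concat_append)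
  moreover have "?z ! i = g (xs ! i) (ys ! i)" using assms by simp
  ultimately show ?thesis by metis
qed

lemma distinct_concat_nth:
  assumes "distinct (concat xss)" "i < length xss" "k < length xss" "x \<in> set (xss ! i)" "x \<in> set (xss ! k)"
  shows "i = k"
proof -
  have *: False if ik: "i < k" "k < length xss" "x \<in> set (xss ! i)" "x \<in> set (xss ! k)" for i k
  proof -
    obtain A B C where "xss = A @ xss ! i # B @ xss ! k # C" using list_split2[OF ik(1,2)] by blast
    then have "distinct (concat (A @ xss ! i # B @ xss ! k # C))" using assms(1) by simp
    then show False using ik(3,4) by auto
  qed
  show ?thesis using *[of i k] *[of k i] assms by (cases i k rule: linorder_cases) auto
qed

context explored_map
begin

lemma word_butlast:
  assumes "d \<in> LD" "c \<in> set ts" "fam path P ts Q" "d \<in> set (word (opp m) c)"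
    "word (opp m) c = w @ [opp m (dart c)]"
  shows "d \<in> set w"
proof -
  have "d \<noteq> opp m (dart c)" using assms(1) fam_dart[OF assms(3,2)] LD_ND(2) by blast
  then show ?thesis using assms(4,5) by auto
qed

lemma leaf_in_word: "(d, q) \<in> set (aleaves c) \<Longrightarrow> d \<in> set (word op c)"
  unfolding set_word_eq by force

text \<open>This is condition (3) at the current vertex, of depth \<open>length path - 2\<close>. A
  leaf of smaller label that precedes \<open>d1\<close> in traversal order follows it in the
  contour; the chord of \<open>d1\<close> ends in the corner behind \<open>c\<close> or a later
  child and would be crossed by the chord of that leaf.\<close>

lemma cond3:
  assumes planar: "ncyc (rot m \<circ> opp m) (darts m) = Suc (card LD)" and f: "fam path P (us @ c # vs) Q"
    and kj: "k < j" "j < length (aleaves c)" "snd (aleaves c ! j) = int (length path) - 2"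
  shows "int (length path) - 2 \<le> snd (aleaves c ! k)"
proof (rule ccontr)
  assume neg: "\<not> ?thesis"
  obtain d1 q1 where 1: "aleaves c ! j = (d1, q1)" by (cases "aleaves c ! j")
  obtain d2 q2 where 2: "aleaves c ! k = (d2, q2)" by (cases "aleaves c ! k")
  obtain L1 L2 L3 where L: "aleaves c = L1 @ (d2, q2) # L2 @ (d1, q1) # L3"
    using list_split2[OF kj(1,2)] 1 2 by auto
  have cts: "c \<in> set (us @ c # vs)" by simp
  obtain w1 w2 w3 where w: "word (opp m) c = w1 @ d1 # w2 @ d2 # w3" using leaf_order[OF f cts L] by blast
  have m1: "(d1, q1) \<in> set (aleaves c)" and m2: "(d2, q2) \<in> set (aleaves c)" using L by auto
  have q: "q1 = int (length path) - 2" "q2 < int (length path) - 2" using kj(3) neg 1 2 by auto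
  obtain c' A Y B where c': "c' \<in> set (c # vs)" "vl path = A @ dart c' # Y @ opp m d1 # B" "set Y \<subseteq> BK"
    using anchor_same[OF f m1 q(1)] by blast
  have c'ts: "c' \<in> set (us @ c # vs)" using c'(1) by auto
  have "opp m (dart c') \<in> set (w3 @ words (opp m) vs)"
  proof (cases "c' = c")
    case True
    have "d2 \<noteq> opp m (dart c)"
      using fam_leaf_LD[OF f cts m2] fam_dart[OF f cts] LD_ND(2) by blast
    moreover obtain w where "word (opp m) c = w @ [opp m (dart c)]" using last_word[of "opp m" c] by blast
    then have "last (word (opp m) c) = opp m (dart c)" by simp
    ultimately have "w3 \<noteq> [] \<and> last w3 = opp m (dart c)" using w by (cases "w3 = []") auto
    then show ?thesis using True last_in_set by fastforce
  next
    case False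
    then show ?thesis using c'(1) dart_in_word(2)[of "opp m" c'] by auto
  qed
  then obtain m1' m2' where "w3 @ words (opp m) vs = m1' @ opp m (dart c') # m2'" by (meson split_list)
  then have "words (opp m) (us @ c # vs) = (words (opp m) us @ w1) @ d1 # w2 @ d2 # m1' @ opp m (dart c') # m2'"
    using w by simp
  from noncross[OF planar f this cts m1 c'(2,3) dart_BK[OF f c'ts] cts m2 q(2)] show False .
qed

text \<open>Let \<open>Ys ! i\<close> be the block behind the \<open>i\<close>-th child. If a member
  came from an earlier child, a low leaf of child \<open>i\<close> would lie between its leaf and
  its corner, against \<open>noncross\<close>. So each block consists of the ends that come from its
  own child, and \<open>noncross_same\<close> fixes their order.\<close>

lemma tight_vl:
  assumes planar: "ncyc (rot m \<circ> opp m) (darts m) = Suc (card LD)"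
    and single: "forest = [\<tau>]"
    and low: "\<And>path P ts Q c. fam path P ts Q \<Longrightarrow> length path > 1 \<Longrightarrow> c \<in> set ts \<Longrightarrow>
      \<exists>d q. (d, q) \<in> set (aleaves c) \<and> q < int (length path) - 2"
    and f: "fam path P ts Q"
  shows "vl path = concat (map (\<lambda>c. dart c # ups (opp m) (int (length path) - 2) c) ts)"
proof -
  let ?p = "int (length path) - 2"
  obtain Y Ys where len: "length Ys = length ts" and v: "vl path = Y @ concat (map2 (\<lambda>c Y. dart c # Y) ts Ys)"
    and Y: "set Y \<subseteq> {}"
    and Ysub: "\<forall>i<length ts. set (Ys ! i) \<subseteq> {} \<union> (\<Union>c\<in>set (take (Suc i) ts). backs (opp m) c)"
    using splits_form[OF fam_splits[OF f]] by blast
  have v: "vl path = concat (map2 (\<lambda>c Y. dart c # Y) ts Ys)" using v Y by simp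
  have vi: "\<exists>A B. vl path = A @ dart (ts ! i) # Ys ! i @ B" if "i < length ts" for i
    using concat_map2_split[OF that len, of "\<lambda>c Y. dart c # Y"] unfolding v by simp
  have YBK: "set (Ys ! i) \<subseteq> BK" if i: "i < length ts" for i
  proof -
    have "(\<Union>c\<in>set (take (Suc i) ts). backs (opp m) c) \<subseteq> BK"
      using fam_backs[OF f] unfolding BK_def by (meson UN_least in_set_takeD)
    then show ?thesis using Ysub i by (metis subset_trans sup_bot_left)
  qed
  have dW: "distinct (words (opp m) ts)" using distinct_sub fam_W[OF f] by simp
  \<comment> \<open>At \<open>v\<close> low leaves cannot be used, but there is one child only,
    hence no earlier child to exclude.\<close>
  have len1: "length ts = 1" if "\<not> length path > 1"
  proof -
    from f that have "ts = forest" by cases (use fam_path in fastforce)+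
    then show ?thesis using single by simp
  qed
  have sub: "x \<in> set (ups (opp m) ?p (ts ! i))" if i: "i < length ts" and x: "x \<in> set (Ys ! i)" for x i
  proof -
    have "x \<in> (\<Union>c\<in>set (take (Suc i) ts). backs (opp m) c)" using Ysub i x by auto
    then obtain j where "j < Suc i" and jx: "x \<in> backs (opp m) (ts ! j)"
      using i by (auto simp: in_set_conv_nth)
    then have j: "j \<le> i" "x \<in> backs (opp m) (ts ! j)" by auto
    then obtain d q where d: "x = opp m d" "(d, q) \<in> set (aleaves (ts ! j))" unfolding backs_def by force
    have jts: "ts ! j \<in> set ts" "ts ! i \<in> set ts" using i j by auto
    obtain A B where AB: "vl path = A @ dart (ts ! i) # Ys ! i @ B" using vi[OF i] by blast
    have "opp m d \<in> set (vl path)" using AB x d by simp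
    from leaf_label_vl[OF f jts(1) d(2) this] have q: "q = ?p" .
    show ?thesis
    proof (cases "j = i")
      case True
      then show ?thesis using d q unfolding set_ups by blast
    next
      case False
      then have ji: "j < i" using j by simp
      then have "length path > 1" using len1 i by linarith
      then obtain d2 q2 where d2: "(d2, q2) \<in> set (aleaves (ts ! i))" "q2 < ?p" using low[OF f _ jts(2)] by blast
      obtain us vs ws where ts: "ts = us @ ts ! j # vs @ ts ! i # ws" using list_split2[OF ji i] by blast
      obtain u1 u2 where u: "word (opp m) (ts ! j) = u1 @ d # u2"
        using leaf_in_word[OF d(2)] by (meson split_list)
      obtain w where w: "word (opp m) (ts ! i) = w @ [opp m (dart (ts ! i))]" using last_word[of "opp m"] by blast
      have "d2 \<in> set w"
        using word_butlast[OF fam_leaf_LD[OF f jts(2) d2(1)] jts(2) f leaf_in_word[OF d2(1)] w] .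
      then obtain v1 v2 where w': "w = v1 @ d2 # v2" by (meson split_list)
      obtain Ya Yb where Y': "Ys ! i = Ya @ opp m d # Yb" using x d(1) by (meson split_list)
      have "words (opp m) ts = words (opp m) (us @ ts ! j # vs @ ts ! i # ws)" using ts by simp
      also have "\<dots> = (words (opp m) us @ u1) @ d # (u2 @ words (opp m) vs @ v1) @ d2 # v2 @
          opp m (dart (ts ! i)) # words (opp m) ws"
        using u w w' by simp
      finally have W: "words (opp m) ts = (words (opp m) us @ u1) @ d # (u2 @ words (opp m) vs @ v1) @ d2 # v2 @
          opp m (dart (ts ! i)) # words (opp m) ws" .
      have "vl path = A @ dart (ts ! i) # Ya @ opp m d # (Yb @ B)" using AB Y' by simp
      moreover have "set Ya \<subseteq> BK" using YBK[OF i] Y' by auto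
      ultimately show ?thesis
        using noncross[OF planar f W jts(1) d(2) _ _ dart_BK[OF f jts(2)] jts(2) d2] by blast
    qed
  qed
  have sup: "x \<in> set (Ys ! i)" if i: "i < length ts" and x: "x \<in> set (ups (opp m) ?p (ts ! i))" for x i
  proof -
    obtain d where d: "x = opp m d" "(d, ?p) \<in> set (aleaves (ts ! i))" using x unfolding set_ups by blast
    have its: "ts ! i \<in> set ts" using i by simp
    have "x \<in> set (vl path)" using leaf_in_vl[OF f its d(2) refl] d by simp
    moreover have "x \<in> BK" using fam_leaf_LD[OF f its d(2)] d(1) by (simp add: BK_def)
    then have "x \<notin> dart ` set ts" using dart_BK[OF f] by (metis imageE)
    ultimately obtain k where k: "k < length ts" "x \<in> set (Ys ! k)"
      unfolding v using len by (fastforce simp: set_zip)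
    \<comment> \<open>By \<open>sub\<close> the end comes from child \<open>k\<close>, in whose
      block it was found; contours of different children are disjoint, so
      \<open>k = i\<close>.\<close>
    then have "x \<in> set (ups (opp m) ?p (ts ! k))" using sub by blast
    then have "x \<in> set (word (opp m) (ts ! k))" "x \<in> set (word (opp m) (ts ! i))"
      using x ups_subset_backs backs_subset_word by (metis subsetD)+
    then have "k = i" using distinct_concat_nth[OF dW, of k i x] k i by simp
    then show ?thesis using k by simp
  qed
  have eq: "Ys ! i = ups (opp m) ?p (ts ! i)" if i: "i < length ts" for i
  proof -
    let ?c = "ts ! i"
    \<comment> \<open>\<open>R\<close> compares two ends by the reversed contour order of their
      leaves. It is asymmetric, and two lists with the same members that are sorted by it
      coincide.\<close>
    define R where "R x y \<longleftrightarrow> (\<exists>w1 w2 w3. word (opp m) ?c = w1 @ opp m y # w2 @ opp m x # w3)" for x y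
    have its: "?c \<in> set ts" using i by simp
    have dc: "distinct (word (opp m) ?c)"
      using dW its by (metis distinct_concat_iff image_eqI list.set_map)
    have asym: "\<not> R y x" if "R x y" for x y
    proof
      assume "R y x"
      then obtain w1 w2 w3 where w: "word (opp m) ?c = w1 @ opp m x # w2 @ opp m y # w3" unfolding R_def by blast
      obtain v1 v2 v3 where v: "word (opp m) ?c = v1 @ opp m y # v2 @ opp m x # v3"
        using \<open>R x y\<close> unfolding R_def by blast
      show False using order_asym[OF dc w v] .
    qed
    obtain A B where AB: "vl path = A @ dart ?c # Ys ! i @ B" using vi[OF i] by blast
    have dY: "distinct (Ys ! i)" using distinct_vl[of path] AB by simp
    have "sorted_wrt R (Ys ! i)"
    proof (unfold sorted_wrt_iff_nth_less, intro allI impI)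
      fix a b assume ab: "a < b" "b < length (Ys ! i)"
      let ?x = "Ys ! i ! a" and ?y = "Ys ! i ! b"
      obtain Ya Yb Yc where Y': "Ys ! i = Ya @ ?x # Yb @ ?y # Yc" using list_split2[OF ab] by blast
      have "?x \<in> set (Ys ! i)" "?y \<in> set (Ys ! i)" using ab by auto
      then obtain d1 d2 where d: "?x = opp m d2" "(d2, ?p) \<in> set (aleaves ?c)"
        "?y = opp m d1" "(d1, ?p) \<in> set (aleaves ?c)"
        using sub[OF i] unfolding set_ups by blast
      have Y'': "Ys ! i = Ya @ opp m d2 # Yb @ opp m d1 # Yc" using Y' unfolding d(1,3) .
      have ne: "d1 \<noteq> d2" using dY ab d by (metis nth_eq_iff_index_eq less_imp_neq order.strict_trans)
      have LDs: "d1 \<in> LD" "d2 \<in> LD" using fam_leaf_LD[OF f its] d by blast+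
      obtain w where w: "word (opp m) ?c = w @ [opp m (dart ?c)]" using last_word[of "opp m"] by blast
      have "d1 \<in> set w" "d2 \<in> set w"
        using word_butlast[OF _ its f _ w] LDs leaf_in_word[OF d(2)] leaf_in_word[OF d(4)] by blast+
      from two_elems_order[OF this ne] show "R ?x ?y"
      proof (elim disjE exE)
        fix w1 w2 w3 assume "w = w1 @ d1 # w2 @ d2 # w3"
        then have "word (opp m) ?c = w1 @ opp m ?y # w2 @ opp m ?x # (w3 @ [opp m (dart ?c)])"
          using w d(1,3) by simp
        then show ?thesis unfolding R_def by blast
      next
        fix w1 w2 w3 assume w': "w = w1 @ d2 # w2 @ d1 # w3"
        obtain us vs where ts: "ts = us @ ?c # vs" using its by (meson split_list)
        have "words (opp m) ts = words (opp m) (us @ ?c # vs)" using ts by simp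
        also have "\<dots> = (words (opp m) us @ w1) @ d2 # w2 @ d1 # w3 @ opp m (dart ?c) # words (opp m) vs"
          using w w' by simp
        finally have W: "words (opp m) ts =
          (words (opp m) us @ w1) @ d2 # w2 @ d1 # w3 @ opp m (dart ?c) # words (opp m) vs" .
        have "vl path = A @ dart ?c # Ya @ opp m d2 # Yb @ opp m d1 # (Yc @ B)" using AB Y'' by simp
        moreover have "set Ya \<subseteq> BK" "set Yb \<subseteq> BK" using YBK[OF i] unfolding Y'' by auto
        ultimately show ?thesis using noncross_same[OF planar f W LDs _ _ _ dart_BK[OF f its]] by blast
      qed
    qed
    moreover have "sorted_wrt R (ups (opp m) ?p ?c)"
    proof -
      have "sorted_wrt (\<lambda>x y. R (opp m (fst x)) (opp m (fst y))) (aleaves ?c)"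
      proof (unfold sorted_wrt_iff_nth_less, intro allI impI)
        fix a b assume ab: "a < b" "b < length (aleaves ?c)"
        obtain d2 q2 where 2: "aleaves ?c ! a = (d2, q2)" by (cases "aleaves ?c ! a")
        obtain d1 q1 where 1: "aleaves ?c ! b = (d1, q1)" by (cases "aleaves ?c ! b")
        obtain L1 L2 L3 where "aleaves ?c = L1 @ (d2, q2) # L2 @ (d1, q1) # L3"
          using list_split2[OF ab] 1 2 by auto
        from leaf_order[OF f its this] show "R (opp m (fst (aleaves ?c ! a))) (opp m (fst (aleaves ?c ! b)))"
          unfolding R_def 1 2 by simp
      qed
      then show ?thesis unfolding ups_def sorted_wrt_map comp_def by (rule sorted_wrt_filter)
    qed
    moreover have "set (Ys ! i) = set (ups (opp m) ?p ?c)" using sub[OF i] sup[OF i] by blast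
    ultimately show ?thesis using sorted_wrt_unique[of R] asym by blast
  qed
  have "map2 (\<lambda>c Y. dart c # Y) ts Ys = map (\<lambda>c. dart c # ups (opp m) ?p c) ts"
    using len eq by (intro nth_equalityI) auto
  then show ?thesis using v by simp
qed

end


section \<open>Decorated trees, recursively\<close>

definition ok3 :: "int \<Rightarrow> int list \<Rightarrow> bool" where
  "ok3 p l \<longleftrightarrow> (\<forall>j k. k < j \<and> j < length l \<and> l ! j = p \<longrightarrow> p \<le> l ! k)"

text \<open>In \<open>loc p s\<close> and \<open>dec p s\<close> the depth \<open>p\<close> is that of the parent of the subtree \<open>s\<close>.\<close>

fun loc :: "int \<Rightarrow> dtree \<Rightarrow> bool" where
  "loc p (Leaf q) \<longleftrightarrow> -1 \<le> q \<and> q < p"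
| "loc p (Node ts) \<longleftrightarrow> (\<exists>q\<in>set (labels (Node ts)). q < p) \<and> ok3 p (labels (Node ts))"

fun dec :: "int \<Rightarrow> dtree \<Rightarrow> bool" where
  "dec p (Leaf q) \<longleftrightarrow> loc p (Leaf q)"
| "dec p (Node ts) \<longleftrightarrow> loc p (Node ts) \<and> (\<forall>c\<in>set ts. dec (p + 1) c)"

lemma subtrees_Node_iff:
  "(a, s) \<in> set (subtrees (Node ts)) \<longleftrightarrow>
     a = [] \<and> s = Node ts \<or> (\<exists>i b. a = i # b \<and> i < length ts \<and> (b, s) \<in> set (subtrees (ts ! i)))"
  by auto

lemma dec_iff: "dec p t \<longleftrightarrow> (\<forall>a s. (a, s) \<in> set (subtrees t) \<longrightarrow> loc (p + int (length a)) s)"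
proof (induction t arbitrary: p)
  case (Leaf q)
  then show ?case by simp
next
  case (Node ts)
  have "(\<forall>c\<in>set ts. dec (p + 1) c) \<longleftrightarrow> (\<forall>i<length ts. dec (p + 1) (ts ! i))"
    by (simp add: all_set_conv_all_nth)
  also have "\<dots> \<longleftrightarrow> (\<forall>i<length ts. \<forall>a s. (a, s) \<in> set (subtrees (ts ! i)) \<longrightarrow> loc (p + 1 + int (length a)) s)"
    using Node by simp
  finally have 1: "dec p (Node ts) \<longleftrightarrow> loc p (Node ts) \<and>
     (\<forall>i<length ts. \<forall>a s. (a, s) \<in> set (subtrees (ts ! i)) \<longrightarrow> loc (p + 1 + int (length a)) s)"
    by (simp only: dec.simps)
  show ?case unfolding 1
  proof (intro iffI conjI allI impI)
    fix a s assume 2: "loc p (Node ts) \<and>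
      (\<forall>i<length ts. \<forall>a s. (a, s) \<in> set (subtrees (ts ! i)) \<longrightarrow> loc (p + 1 + int (length a)) s)"
      "(a, s) \<in> set (subtrees (Node ts))"
    from 2(2) show "loc (p + int (length a)) s"
      unfolding subtrees_Node_iff
    proof (elim disjE exE conjE)
      fix i b assume "a = i # b" "i < length ts" "(b, s) \<in> set (subtrees (ts ! i))"
      then have "loc (p + 1 + int (length b)) s" using 2(1) by blast
      then show ?thesis using \<open>a = i # b\<close> by (simp add: add.assoc)
    qed (use 2(1) in simp)
  next
    assume 2: "\<forall>a s. (a, s) \<in> set (subtrees (Node ts)) \<longrightarrow> loc (p + int (length a)) s"
    have "([], Node ts) \<in> set (subtrees (Node ts))" by simp
    from 2[rule_format, OF this] show "loc p (Node ts)" by simp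
    fix i a s assume "i < length ts" "(a, s) \<in> set (subtrees (ts ! i))"
    then have "(i # a, s) \<in> set (subtrees (Node ts))" unfolding subtrees_Node_iff by blast
    from 2[rule_format, OF this] show "loc (p + 1 + int (length a)) s" by (simp add: add.assoc)
  qed
qed

lemma set_labels: "q \<in> set (labels t) \<longleftrightarrow> (\<exists>a. (a, Leaf q) \<in> set (subtrees t))"
  by (force simp: labels_def leaves_def split: dtree.splits)

text \<open>Each condition concerns one subtree below the root together with the depth of its
  parent. The root itself is exempt, and its children have a parent of depth 0.\<close>

lemma decorated_iff: "decorated t \<longleftrightarrow> (\<exists>ts. t = Node ts \<and> (\<forall>c\<in>set ts. dec 0 c))"
proof -
  have 1: "decorated t \<longleftrightarrow> (\<exists>ts. t = Node ts) \<and>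
      (\<forall>a i s. (a @ [i], s) \<in> set (subtrees t) \<longrightarrow> loc (int (length a)) s)" (is "_ \<longleftrightarrow> ?R")
  proof
    assume d: "decorated t"
    have "loc (int (length a)) s" if s: "(a @ [i], s) \<in> set (subtrees t)" for a i s
    proof (cases s)
      case (Leaf q)
      then show ?thesis using d s set_labels unfolding decorated_def by auto
    next
      case (Node us)
      \<comment> \<open>The vertex is one level below its parent, so the bound depth minus 2 of
        condition (2) is a strict bound by the depth of the parent.\<close>
      have "\<exists>q\<in>set (labels (Node us)). q \<le> int (length (a @ [i])) - 2"
        using d s Node unfolding decorated_def by blast
      moreover have "ok3 (int (length a)) (labels s)"
        using d s unfolding decorated_def ok3_def by blast
      ultimately show ?thesis using Node by fastforce
    qed
    then show ?R using d unfolding decorated_def plane_tree_def by blast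
  next
    assume R: ?R
    then obtain ts where t: "t = Node ts" by blast
    have l: "loc (int (length a) - 1) s" if "(a, s) \<in> set (subtrees t)" "a \<noteq> []" for a s
      using R that by (cases a rule: rev_cases) auto
    \<comment> \<open>A childless \<open>Node\<close> below the root has no labels at all and would
      violate the condition on low leaves.\<close>
    have c1: "a = []" if "(a, Node []) \<in> set (subtrees t)" for a
      using l[OF that] by (auto simp: labels_Node)
    have c2: "- 1 \<le> p" if p: "p \<in> set (labels t)" for p
    proof -
      obtain a where a: "(a, Leaf p) \<in> set (subtrees t)" using p unfolding set_labels by (elim exE)
      then have "a \<noteq> []" using t by auto
      from l[OF a this] show ?thesis by simp
    qed
    have c3: "p < int (length a)" if "(a @ [i], Leaf p) \<in> set (subtrees t)" for a i p
      using l[OF that] by simp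
    have c4: "\<exists>p\<in>set (labels (Node us)). p \<le> int (length a) - 2"
      if "(a, Node us) \<in> set (subtrees t)" "length a > 0" for a us
    proof -
      have "a \<noteq> []" using that(2) by auto
      from l[OF that(1) this] obtain q where "q \<in> set (labels (Node us))" "q < int (length a) - 1" by auto
      then show ?thesis by (intro bexI[of _ q]) auto
    qed
    have c5: "ok3 (int (length a)) (labels s)" if "(a @ [i], s) \<in> set (subtrees t)" for a i s
    proof (cases s)
      case (Leaf q)
      then show ?thesis by (simp add: ok3_def labels_def)
    next
      case (Node us)
      then show ?thesis using l[OF that] by simp
    qed
    show "decorated t" unfolding decorated_def plane_tree_def
    proof (intro conjI)
      show "\<forall>a i s. (a @ [i], s) \<in> set (subtrees t) \<longrightarrow>
        (\<forall>j k. k < j \<and> j < length (labels s) \<and> labels s ! j = int (length a) \<longrightarrow> int (length a) \<le> labels s ! k)"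
        using c5 unfolding ok3_def by blast
    qed (use t c1 c2 c3 c4 in blast)+
  qed
  have "(\<forall>a i s. (a @ [i], s) \<in> set (subtrees (Node ts)) \<longrightarrow> loc (int (length a)) s) \<longleftrightarrow>
      (\<forall>c\<in>set ts. dec 0 c)" for ts
  proof -
    have "(\<forall>a i s. (a @ [i], s) \<in> set (subtrees (Node ts)) \<longrightarrow> loc (int (length a)) s) \<longleftrightarrow>
        (\<forall>a s. (a, s) \<in> set (subtrees (Node ts)) \<longrightarrow> a \<noteq> [] \<longrightarrow> loc (int (length a) - 1) s)"
      (is "?A \<longleftrightarrow> ?B")
    proof
      assume ?A then show ?B by (metis append_butlast_last_id length_append_singleton of_nat_Suc diff_add_cancel
        add.commute add_diff_cancel_left')
    next
      assume B: ?B
      show ?A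
      proof (intro allI impI)
        fix a i s assume "(a @ [i], s) \<in> set (subtrees (Node ts))"
        with B have "loc (int (length (a @ [i])) - 1) s" by blast
        then show "loc (int (length a)) s" by simp
      qed
    qed
    also have "\<dots> \<longleftrightarrow> (\<forall>i<length ts. \<forall>b s. (b, s) \<in> set (subtrees (ts ! i)) \<longrightarrow> loc (0 + int (length b)) s)"
      unfolding subtrees_Node_iff by fastforce
    also have "\<dots> \<longleftrightarrow> (\<forall>c\<in>set ts. dec 0 c)"
      unfolding dec_iff[symmetric] by (simp add: all_set_conv_all_nth)
    finally show ?thesis .
  qed
  then show ?thesis using 1 by blast
qed

lemma dec_low: "dec p s \<Longrightarrow> \<exists>q\<in>set (labels s). q < p"
  by (cases s) (auto simp: labels_def)

text \<open>
  \<open>tight m p c\<close>: at every vertex in the subtree \<open>c\<close>, whose root has depth \<open>p\<close>, each child edge is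
  immediately followed by the back edges from its subtree, in the order produced by the map \<open>S\<close>.
\<close>

fun tight :: "'d cmap \<Rightarrow> int \<Rightarrow> 'd atree \<Rightarrow> bool" where
  "tight m p (AL d q) \<longleftrightarrow> True"
| "tight m p (AN d ts) \<longleftrightarrow>
     tl (support (rot m) (opp m d)) = concat (map (\<lambda>c. dart c # ups (opp m) p c) ts) \<and>
     (\<forall>c\<in>set ts. tight m (p + 1) c)"

context explored_map
begin

text \<open>Non-separability enters through \<open>separable_child\<close>: it gives
  \<open>v\<close> a single child, and every child subtree of a vertex other than \<open>v\<close> a
  leaf of low label.\<close>

lemma nonseparable_tree:
  assumes m: "planar_map m" "\<not> separable m" "card (edges m) \<ge> 2"
  shows "\<exists>\<tau>. forest = [\<tau>] \<and> decorated (erase \<tau>) \<and> tight m 0 \<tau> \<and>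
    support (rot m) (root_dart m) = root_dart m # ups (opp m) (-1) \<tau>"
proof -
  have planar: "ncyc (rot m \<circ> opp m) (darts m) = Suc (card LD)"
    using planar_map_iff m rooted by blast
  obtain \<tau> ts where fo: "forest = \<tau> # ts" and rt: "dart \<tau> = root_dart m" using root_first by blast
  have "ts = []"
  \<comment> \<open>No label is below -1, the depth of \<open>v\<close>, so with a second child
    \<open>v\<close> would be a cut vertex.\<close>
  proof (rule ccontr)
    assume ne: "ts \<noteq> []"
    have f: "fam [root_dart m] [] ([] @ \<tau> # ts) []" using fam_root fo by simp
    have "separable m"
      by (rule separable_child[OF f]) (use leaf_explored(1)[OF f, of \<tau>] ne in auto)
    then show False using m by blast
  qed
  then have single: "forest = [\<tau>]" using fo by simp
  \<comment> \<open>A leaf as the only child of \<open>v\<close> would mean that the map has a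
    single edge.\<close>
  obtain d us where \<tau>: "\<tau> = AN d us"
  proof (cases \<tau>)
    case (AL d q)
    then show ?thesis using card_edges m(3) single by simp
  qed blast
  have low: "\<exists>d q. (d, q) \<in> set (aleaves c) \<and> q < int (length path) - 2"
    if f: "fam path P ts Q" and "length path > 1" "c \<in> set ts" for path P ts Q c
  proof (rule ccontr)
    assume neg: "\<not> ?thesis"
    obtain as bs where "ts = as @ c # bs" using \<open>c \<in> set ts\<close> by (meson split_list)
    then have "fam path P (as @ c # bs) Q" using f by simp
    from separable_child[OF this] neg \<open>length path > 1\<close> have "separable m" by force
    then show False using m by blast
  qed
  have dec: "dec (int (length path) - 2) (erase c)"
    if "fam path P ts Q" "length path > 1" "c \<in> set ts" for path P ts Q c
    using that
  proof (induction c arbitrary: path P ts Q)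
    case (AL d q)
    then show ?case using low[OF AL] leaf_explored(1)[OF AL(1,3)] by auto
  next
    case (AN d us)
    obtain as bs where ts: "ts = as @ AN d us # bs" using AN.prems(3) by (meson split_list)
    have f': "fam path P (as @ AN d us # bs) Q" using AN.prems(1) ts by simp
    have f: "fam (path @ [opp m d]) (P @ words (opp m) as @ [d]) us (opp m d # words (opp m) bs @ Q)"
      using fam_child[OF f'] .
    have l: "labels (Node (rev (map erase us))) = map snd (aleaves (AN d us))"
      using labels_erase[of "AN d us"] by simp
    have "\<exists>q\<in>set (map snd (aleaves (AN d us))). q < int (length path) - 2"
      using low[OF AN.prems] by force
    moreover have "ok3 (int (length path) - 2) (map snd (aleaves (AN d us)))"
      unfolding ok3_def
    proof (intro allI impI, elim conjE)
      fix j k assume kj: "k < j" "j < length (map snd (aleaves (AN d us)))"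
        "map snd (aleaves (AN d us)) ! j = int (length path) - 2"
      have j: "j < length (aleaves (AN d us))" using kj(2) by (simp only: length_map)
      have k: "k < length (aleaves (AN d us))" using kj(1) j by simp
      show "int (length path) - 2 \<le> map snd (aleaves (AN d us)) ! k"
        using cond3[OF planar f' kj(1) j] kj(3) unfolding nth_map[OF j] nth_map[OF k] by blast
    qed
    moreover have "dec (int (length path) - 2 + 1) (erase c)" if "c \<in> set us" for c
      using AN.IH[OF that f _ that] fam_path[OF AN.prems(1)] by (simp add: algebra_simps)
    ultimately show ?case using l by (simp del: labels_erase)
  qed
  have f1: "fam ([root_dart m] @ [opp m d]) ([] @ words (opp m) [] @ [d]) us (opp m d # words (opp m) [] @ [])"
    using fam_child[of "[root_dart m]" "[]" "[]" d us "[]" "[]"] fam_root single \<tau> by simp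
  have "decorated (erase \<tau>)"
    unfolding decorated_iff \<tau> using dec[OF f1] by auto
  moreover have tight: "tight m (int (length path) - 1) c" if "fam path P ts Q" "c \<in> set ts" for path P ts Q c
    using that
  proof (induction c arbitrary: path P ts Q)
    case (AN d us)
    obtain as bs where ts: "ts = as @ AN d us # bs" using AN.prems(2) by (meson split_list)
    have f: "fam (path @ [opp m d]) (P @ words (opp m) as @ [d]) us (opp m d # words (opp m) bs @ Q)"
      using fam_child AN.prems(1) ts by simp
    have "vl (path @ [opp m d]) = tl (support (rot m) (opp m d))"
      using fam_path[OF AN.prems(1)] by (simp add: vl_def)
    moreover have "tight m (int (length path) - 1 + 1) c" if "c \<in> set us" for c
      using AN.IH[OF that f that] by (simp add: algebra_simps)
    ultimately show ?case using tight_vl[OF planar single low f] by simp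
  qed simp
  have "tight m 0 \<tau>" using tight[OF fam_root, of \<tau>] single by simp
  moreover have "support (rot m) (root_dart m) = root_dart m # ups (opp m) (-1) \<tau>"
    using tight_vl[OF planar single low fam_root] single rt by (simp add: vl_def)
  ultimately show ?thesis using single by (intro exI[of _ \<tau>] conjI)
qed

end


section \<open>Depth-first exploration\<close>

lemma splits_Cons_skip: "splits op E ts ds \<Longrightarrow> d \<in> E \<Longrightarrow> splits op E ts (d # ds)"
proof (cases ts)
  case (Cons c us)
  assume s: "splits op E ts ds" and d: "d \<in> E"
  obtain Y ds' where "ds = Y @ dart c # ds'" "set Y \<subseteq> E" "splits op (E \<union> backs op c) us ds'"
    using s Cons by auto
  then have "d # ds = (d # Y) @ dart c # ds'" "set (d # Y) \<subseteq> E" "splits op (E \<union> backs op c) us ds'"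
    using d by auto
  then show ?thesis unfolding Cons splits.simps by blast
qed simp

context premap
begin

text \<open>Visited vertices are finished unless they lie on the current path.\<close>

definition expl_inv :: "'d list \<Rightarrow> ('d set \<rightharpoonup> int) \<Rightarrow> 'd set \<Rightarrow> bool" where
  "expl_inv path dep ex \<longleftrightarrow>
     path \<noteq> [] \<and> set path \<subseteq> darts m \<and>
     (\<forall>i<length path. dep (vertex m (path ! i)) = Some (int i - 1)) \<and>
     (\<forall>x\<in>vertices m. \<forall>q. dep x = Some q \<longrightarrow>
        x \<subseteq> ex \<or> (\<exists>i<length path. x = vertex m (path ! i) \<and> q = int i - 1)) \<and>
     (\<forall>x\<in>vertices m. dep x = None \<longrightarrow> x \<inter> ex = {}) \<and>
     ex \<subseteq> darts m \<and> opp m ` ex \<subseteq> ex"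

lemma expl_invD:
  assumes "expl_inv path dep ex"
  shows "path \<noteq> []" "set path \<subseteq> darts m"
    "\<forall>i<length path. dep (vertex m (path ! i)) = Some (int i - 1)"
    "\<forall>x\<in>vertices m. \<forall>q. dep x = Some q \<longrightarrow>
        x \<subseteq> ex \<or> (\<exists>i<length path. x = vertex m (path ! i) \<and> q = int i - 1)"
    "\<forall>x\<in>vertices m. dep x = None \<longrightarrow> x \<inter> ex = {}"
    "ex \<subseteq> darts m" "opp m ` ex \<subseteq> ex"
  by (rule assms[unfolded expl_inv_def, THEN conjunct1]
      assms[unfolded expl_inv_def, THEN conjunct2, THEN conjunct1]
      assms[unfolded expl_inv_def, THEN conjunct2, THEN conjunct2, THEN conjunct1]
      assms[unfolded expl_inv_def, THEN conjunct2, THEN conjunct2, THEN conjunct2, THEN conjunct1]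
      assms[unfolded expl_inv_def, THEN conjunct2, THEN conjunct2, THEN conjunct2, THEN conjunct2, THEN conjunct1]
      assms[unfolded expl_inv_def, THEN conjunct2, THEN conjunct2, THEN conjunct2, THEN conjunct2, THEN conjunct2, THEN conjunct1]
      assms[unfolded expl_inv_def, THEN conjunct2, THEN conjunct2, THEN conjunct2, THEN conjunct2, THEN conjunct2, THEN conjunct2])+

lemma finite_vertices: "finite (vertices m)"
  using finite_darts by (simp add: vertices_def)

lemma in_vertices: "d \<in> darts m \<Longrightarrow> vertex m d \<in> vertices m"
  by (simp add: vertices_def)

lemma vertices_eqI: "x \<in> vertices m \<Longrightarrow> y \<in> x \<Longrightarrow> x = vertex m y"
  using vertex_eq by (auto simp: vertices_def)

lemma expl_inv_last: "expl_inv path dep ex \<Longrightarrow> dep (vertex m (last path)) = Some (int (length path) - 2)"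
  unfolding expl_inv_def by (cases path rule: rev_cases) (auto simp: nth_append)

lemma expl_inv_add:
  assumes "expl_inv path dep ex" "d \<in> darts m" "dep (vertex m d) \<noteq> None" "dep (vertex m (opp m d)) \<noteq> None"
  shows "expl_inv path dep (ex \<union> {d, opp m d})"
proof -
  have "x \<inter> (ex \<union> {d, opp m d}) = {}" if "x \<in> vertices m" "dep x = None" for x
  proof -
    have "d \<notin> x" "opp m d \<notin> x" using vertices_eqI[OF that(1)] assms(3,4) that(2) by auto
    then show ?thesis using expl_invD(5)[OF assms(1)] that by auto
  qed
  moreover have "opp m ` (ex \<union> {d, opp m d}) \<subseteq> ex \<union> {d, opp m d}"
    using expl_invD(7)[OF assms(1)] by auto
  moreover have "ex \<union> {d, opp m d} \<subseteq> darts m" using expl_invD(6)[OF assms(1)] assms(2) by simp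
  moreover have "\<forall>x\<in>vertices m. \<forall>q. dep x = Some q \<longrightarrow>
        x \<subseteq> ex \<union> {d, opp m d} \<or> (\<exists>i<length path. x = vertex m (path ! i) \<and> q = int i - 1)"
    using expl_invD(4)[OF assms(1)] by (metis le_supI1)
  ultimately show ?thesis unfolding expl_inv_def using expl_invD(1-3)[OF assms(1)]
    by (intro conjI) (assumption | (intro ballI impI, simp only:))+
qed

lemma expl_inv_push:
  assumes "expl_inv path dep ex" "d \<in> vertex m (last path)" "d \<in> darts m" "dep (vertex m (opp m d)) = None"
  shows "expl_inv (path @ [opp m d]) (dep(vertex m (opp m d) \<mapsto> int (length path) - 1)) (ex \<union> {d, opp m d})"
proof -
  let ?x = "vertex m (opp m d)" and ?e = "ex \<union> {d, opp m d}"
  let ?dep = "dep(?x \<mapsto> int (length path) - 1)"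
  note inv = expl_invD[OF assms(1)]
  have last: "dep (vertex m (last path)) = Some (int (length path) - 2)" using expl_inv_last[OF assms(1)] .
  have vd: "vertex m d = vertex m (last path)" using vertex_eq assms(2) by blast
  have 1: "?dep (vertex m ((path @ [opp m d]) ! i)) = Some (int i - 1)" if "i < length (path @ [opp m d])" for i
  proof (cases "i < length path")
    case True
    then have "dep (vertex m (path ! i)) = Some (int i - 1)" using inv(3) by blast
    then show ?thesis using True assms(4) by (auto simp: nth_append)
  next
    case False
    then have "i = length path" using that by simp
    then show ?thesis by simp
  qed
  have 2: "x \<subseteq> ?e \<or> (\<exists>i<length (path @ [opp m d]). x = vertex m ((path @ [opp m d]) ! i) \<and> q = int i - 1)"
    if x: "x \<in> vertices m" "?dep x = Some q" for x q
  proof (cases "x = ?x")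
    case True
    then have "x = vertex m ((path @ [opp m d]) ! length path) \<and> q = int (length path) - 1"
      using x(2) by simp
    then show ?thesis by (intro disjI2 exI[of _ "length path"]) simp
  next
    case False
    then have "dep x = Some q" using x(2) by simp
    then have "x \<subseteq> ex \<or> (\<exists>i<length path. x = vertex m (path ! i) \<and> q = int i - 1)" using inv(4) x(1) by blast
    then show ?thesis
    proof (elim disjE exE conjE)
      fix i assume "i < length path" "x = vertex m (path ! i)" "q = int i - 1"
      then show ?thesis by (intro disjI2 exI[of _ i]) (simp add: nth_append)
    qed blast
  qed
  have 3: "x \<inter> ?e = {}" if x: "x \<in> vertices m" "?dep x = None" for x
  proof -
    have ne: "x \<noteq> ?x" "dep x = None" using x(2) by (auto split: if_splits)
    then have "d \<notin> x" "opp m d \<notin> x" using vertices_eqI[OF x(1)] vd last by fastforce+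
    moreover have "x \<inter> ex = {}" using inv(5) x(1) ne(2) by blast
    ultimately show ?thesis by blast
  qed
  have 4: "?e \<subseteq> darts m" "opp m ` ?e \<subseteq> ?e" "set (path @ [opp m d]) \<subseteq> darts m"
    using inv(2,6,7) assms(3) by auto
  show ?thesis unfolding expl_inv_def using 1 2 3 4 by (intro conjI allI ballI impI) auto
qed

lemma expl_inv_pop:
  assumes "expl_inv (path @ [e]) dep ex" "path \<noteq> []" "vertex m e \<subseteq> ex"
  shows "expl_inv path dep ex"
proof -
  note inv = expl_invD[OF assms(1)]
  have "dep (vertex m (path ! i)) = Some (int i - 1)" if "i < length path" for i
  proof -
    have "dep (vertex m ((path @ [e]) ! i)) = Some (int i - 1)" using inv(3) that by (metis length_append_singleton less_SucI)
    then show ?thesis using that by (simp add: nth_append)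
  qed
  moreover have "x \<subseteq> ex \<or> (\<exists>i<length path. x = vertex m (path ! i) \<and> q = int i - 1)"
    if x: "x \<in> vertices m" "dep x = Some q" for x q
  proof -
    have "x \<subseteq> ex \<or> (\<exists>i<length (path @ [e]). x = vertex m ((path @ [e]) ! i) \<and> q = int i - 1)"
      using inv(4) x by blast
    then show ?thesis
    proof (elim disjE exE conjE)
      fix i assume i: "i < length (path @ [e])" "x = vertex m ((path @ [e]) ! i)" "q = int i - 1"
      show ?thesis
      proof (cases "i < length path")
        case True
        then show ?thesis using i by (intro disjI2 exI[of _ i]) (simp add: nth_append)
      next
        case False
        then have "i = length path" using i(1) by simp
        then show ?thesis using i(2) assms(3) by simp
      qed
    qed blast
  qed
  moreover have "set path \<subseteq> darts m" using inv(2) by simp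
  ultimately show ?thesis unfolding expl_inv_def using inv(5-7) assms(2)
    by (intro conjI allI ballI impI; blast)
qed

text \<open>\<open>k\<close> bounds the number of unvisited vertices, as each descent visits a new
  one. The last conclusion concerns vertices visited before the call: of their darts, only darts of
  the new children and upper ends of back edges get examined. This is what makes the remaining darts
  of the current vertex satisfy \<open>splits\<close> after a descent.\<close>

lemma explore_sound:
  assumes "expl_inv path dep ex" "p = int (length path) - 2" "distinct ds" "set ds \<subseteq> vertex m (last path)"
    "card {x \<in> vertices m. dep x = None} \<le> k"
  shows "\<exists>ts dep' ex'. explore k m p ds (dep, ex) = (map erase ts, (dep', ex')) \<and>
    expl_inv path dep' ex' \<and> ex' = ex \<union> set (words (opp m) ts) \<and> distinct (words (opp m) ts) \<and>
    set (words (opp m) ts) \<inter> ex = {} \<and> dep \<subseteq>\<^sub>m dep' \<and> splits (opp m) ex ts ds \<and>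
    (\<forall>c\<in>set ts. explored m path c) \<and>
    (\<forall>y\<in>set (words (opp m) ts). dep (vertex m y) \<noteq> None \<longrightarrow>
       y \<in> dart ` set ts \<union> (\<Union>c\<in>set ts. backs (opp m) c))"
  using assms
proof (induction k arbitrary: path p ds dep ex rule: less_induct)
  case (less k)
  note IHk = less.IH
  from less.prems show ?case
  proof (induction ds arbitrary: dep ex)
    case Nil
    then show ?case by (intro exI[of _ "[]"] exI[of _ dep] exI[of _ ex]) simp
  next
    case (Cons d ds)
    note inv = Cons.prems(1)
    have dl: "d \<in> vertex m (last path)" and dds: "d \<notin> set ds" and ds: "distinct ds" "set ds \<subseteq> vertex m (last path)"
      using Cons.prems by auto
    have lastD: "last path \<in> darts m" using expl_invD(1,2)[OF inv] by (metis last_in_set subsetD)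
    have dD: "d \<in> darts m" using dl vertex_sub[OF lastD] by blast
    have vd: "vertex m d = vertex m (last path)" using vertex_eq[OF dl] .
    have depl: "dep (vertex m (last path)) \<noteq> None" using expl_inv_last[OF inv] by simp
    let ?x = "vertex m (opp m d)" and ?e = "ex \<union> {d, opp m d}"
    have xV: "?x \<in> vertices m" using dD in_vertices by simp
    show ?case
    proof (cases "d \<in> ex")
      case True
      have e: "explore k m p (d # ds) (dep, ex) = explore k m p ds (dep, ex)" using True by simp
      from Cons.IH[OF inv Cons.prems(2) ds Cons.prems(5)] obtain ts dep' ex' where
          r: "explore k m p ds (dep, ex) = (map erase ts, (dep', ex'))" "expl_inv path dep' ex'"
            "ex' = ex \<union> set (words (opp m) ts)" "distinct (words (opp m) ts)"
            "set (words (opp m) ts) \<inter> ex = {}" "dep \<subseteq>\<^sub>m dep'" "splits (opp m) ex ts ds"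
            "\<forall>c\<in>set ts. explored m path c"
            "\<forall>y\<in>set (words (opp m) ts). dep (vertex m y) \<noteq> None \<longrightarrow>
              y \<in> dart ` set ts \<union> (\<Union>c\<in>set ts. backs (opp m) c)" by blast
      show ?thesis unfolding e
        by (intro exI[of _ ts] exI[of _ dep'] exI[of _ ex'] conjI)
          (fact r(1-6) splits_Cons_skip[OF r(7) True] r(8,9))+
    next
      case False
      have oex: "opp m d \<notin> ex"
        using False expl_invD(7)[OF inv] opp_opp by (metis image_subset_iff)
      show ?thesis
      proof (cases "dep ?x")
        case (Some q)
        \<comment> \<open>A finished vertex has no unexamined dart, so a visited \<open>?x\<close>
          must lie on the current path: edges to visited vertices lead to ancestors.\<close>
        have "\<not> ?x \<subseteq> ex" using vertex_self oex by blast
        then obtain i where i: "i < length path" "?x = vertex m (path ! i)" "q = int i - 1"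
          using expl_invD(4)[OF inv] xV Some by blast
        have inv': "expl_inv path dep ?e"
          using expl_inv_add[OF inv dD] depl vd Some by simp
        from Cons.IH[OF inv' Cons.prems(2) ds Cons.prems(5)] obtain ts dep' ex' where
          r: "explore k m p ds (dep, ?e) = (map erase ts, (dep', ex'))" "expl_inv path dep' ex'"
            "ex' = ?e \<union> set (words (opp m) ts)" "distinct (words (opp m) ts)"
            "set (words (opp m) ts) \<inter> ?e = {}" "dep \<subseteq>\<^sub>m dep'" "splits (opp m) ?e ts ds"
            "\<forall>c\<in>set ts. explored m path c"
            "\<forall>y\<in>set (words (opp m) ts). dep (vertex m y) \<noteq> None \<longrightarrow>
              y \<in> dart ` set ts \<union> (\<Union>c\<in>set ts. backs (opp m) c)" by blast
        let ?ts = "AL d q # ts"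
        have e: "explore k m p (d # ds) (dep, ex) = (map erase ?ts, (dep', ex'))"
          using False Some r(1) by (simp add: Let_def case_prod_beta)
        have 1: "ex' = ex \<union> set (words (opp m) ?ts)" using r(3) by auto
        have 2: "distinct (words (opp m) ?ts)" using r(4,5) opp_inv[OF dD] by auto
        have 3: "set (words (opp m) ?ts) \<inter> ex = {}" using r(5) False oex by auto
        have "splits (opp m) (ex \<union> backs (opp m) (AL d q)) ts ds"
          by (rule splits_mono[OF r(7)]) (use dds in auto)
        then have 4: "splits (opp m) ex ?ts (d # ds)"
          unfolding splits.simps by (intro exI[of _ "[]"] exI[of _ ds]) simp
        have 5: "\<forall>c\<in>set ?ts. explored m path c" using r(8) i vertex_self[of "opp m d"] by auto
        have 6: "\<forall>y\<in>set (words (opp m) ?ts). dep (vertex m y) \<noteq> None \<longrightarrow>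
              y \<in> dart ` set ?ts \<union> (\<Union>c\<in>set ?ts. backs (opp m) c)" using r(9) by auto
        show ?thesis
          by (intro exI[of _ ?ts] exI[of _ dep'] exI[of _ ex'] conjI) (fact e r(2) 1 2 3 r(6) 4 5 6)+
      next
        case None
        have "?x \<in> {x \<in> vertices m. dep x = None}" using xV None by simp
        then have pos: "card {x \<in> vertices m. dep x = None} > 0" using finite_vertices by (auto simp: card_gt_0_iff)
        then obtain k' where k: "k = Suc k'" using Cons.prems(5) by (cases k) auto
        let ?dep1 = "dep(?x \<mapsto> p + 1)"
        let ?path = "path @ [opp m d]"
        have p1: "p + 1 = int (length path) - 1" using Cons.prems(2) by simp
        have inv1: "expl_inv ?path ?dep1 ?e" using expl_inv_push[OF inv dl dD None] unfolding p1 .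
        let ?ds1 = "tl (support (rot m) (opp m d))"
        have "{x \<in> vertices m. ?dep1 x = None} \<subset> {x \<in> vertices m. dep x = None}"
          using xV None by auto
        then have "card {x \<in> vertices m. ?dep1 x = None} < card {x \<in> vertices m. dep x = None}"
          using finite_vertices by (intro psubset_card_mono) auto
        then have c1: "card {x \<in> vertices m. ?dep1 x = None} \<le> k'" using Cons.prems(5) k by simp
        have vx: "?x = insert (opp m d) (set ?ds1)" by (rule vertex_insert_tl)
        have d1: "distinct ?ds1" using distinct_support_rot distinct_tl by blast
        have s1: "set ?ds1 \<subseteq> vertex m (last ?path)" using vx by auto
        have p1': "p + 1 = int (length ?path) - 2" using p1 by simp
        have k': "k' < k" using k by simp
        from IHk[OF k' inv1 p1' d1 s1 c1] obtain us dep2 ex2 where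
          u: "explore k' m (p + 1) ?ds1 (?dep1, ?e) = (map erase us, (dep2, ex2))" "expl_inv ?path dep2 ex2"
            "ex2 = ?e \<union> set (words (opp m) us)" "distinct (words (opp m) us)"
            "set (words (opp m) us) \<inter> ?e = {}" "?dep1 \<subseteq>\<^sub>m dep2" "splits (opp m) ?e us ?ds1"
            "\<forall>c\<in>set us. explored m ?path c"
            "\<forall>y\<in>set (words (opp m) us). ?dep1 (vertex m y) \<noteq> None \<longrightarrow>
              y \<in> dart ` set us \<union> (\<Union>c\<in>set us. backs (opp m) c)" by blast
        have eu: "explore k' m (p + 1) (support (rot m) (opp m d)) (?dep1, ?e) = (map erase us, (dep2, ex2))"
          using u(1) by (subst support_rot_Cons) simp
        have dx: "d \<notin> ?x" using vertex_eq[of d "opp m d"] vd depl None by auto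
        have xex: "?x \<inter> ex = {}" using expl_invD(5)[OF inv] xV None by blast
        have nds1: "opp m d \<notin> set ?ds1" by (rule not_in_tl_support)
        \<comment> \<open>An unvisited vertex has no examined dart, so on entering \<open>?x\<close>
          only \<open>opp m d\<close> is examined there, and this dart is not in the tail.\<close>
        have sp0: "splits (opp m) {} us ?ds1"
        proof (rule splits_mono[OF u(7)])
          have "set ?ds1 \<subseteq> ?x" using vx by blast
          then show "?e \<inter> set ?ds1 \<subseteq> {}" using dx xex nds1 by blast
        qed
        let ?c = "AN d us"
        have wc: "set (word (opp m) ?c) = {d, opp m d} \<union> set (words (opp m) us)" by auto
        have exc: "explored m path ?c" using sp0 u(8) by simp
        \<comment> \<open>All darts of \<open>?x\<close> are examined by now, so \<open>?x\<close>
          is finished and can leave the path.\<close>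
        have "set ?ds1 \<subseteq> set (words (opp m) us)"
          using splits_subset[OF sp0] dart_in_word(1)[of _ "opp m"] backs_subset_word[of "opp m"] by fastforce
        then have "?x \<subseteq> ex2" using vx u(3) by auto
        then have inv2: "expl_inv path dep2 ex2"
          using expl_inv_pop[OF u(2)] expl_invD(1)[OF inv] by blast
        have le1: "dep \<subseteq>\<^sub>m dep2"
        proof -
          have "dep \<subseteq>\<^sub>m ?dep1" using None by (auto simp: map_le_def)
          then show ?thesis using u(6) map_le_trans by blast
        qed
        have noneD: "dep y = None" if "dep2 y = None" for y
          using le1 that unfolding map_le_def by (metis domIff)
        have "card {x \<in> vertices m. dep2 x = None} \<le> card {x \<in> vertices m. dep x = None}"
          using finite_vertices noneD by (intro card_mono) auto
        then have c2: "card {x \<in> vertices m. dep2 x = None} \<le> k" using Cons.prems(5) by simp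
        from Cons.IH[OF inv2 Cons.prems(2) ds c2] obtain ts dep' ex' where
          r: "explore k m p ds (dep2, ex2) = (map erase ts, (dep', ex'))" "expl_inv path dep' ex'"
            "ex' = ex2 \<union> set (words (opp m) ts)" "distinct (words (opp m) ts)"
            "set (words (opp m) ts) \<inter> ex2 = {}" "dep2 \<subseteq>\<^sub>m dep'" "splits (opp m) ex2 ts ds"
            "\<forall>c\<in>set ts. explored m path c"
            "\<forall>y\<in>set (words (opp m) ts). dep2 (vertex m y) \<noteq> None \<longrightarrow>
              y \<in> dart ` set ts \<union> (\<Union>c\<in>set ts. backs (opp m) c)" by blast
        let ?ts = "?c # ts"
        have e: "explore k m p (d # ds) (dep, ex) = (map erase ?ts, (dep', ex'))"
          using False None r(1) eu k by (simp add: Let_def case_prod_beta rev_map)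
        have 1: "ex' = ex \<union> set (words (opp m) ?ts)" using r(3) u(3) by auto
        have 2: "distinct (words (opp m) ?ts)" using r(4,5) u(3-5) opp_inv[OF dD] by auto
        have 3: "set (words (opp m) ?ts) \<inter> ex = {}" using r(5) u(3,5) False oex by auto
        have cC: "y \<in> dart ` {?c} \<union> backs (opp m) ?c"
          if y: "y \<in> set (word (opp m) ?c)" "dep (vertex m y) \<noteq> None" for y
        proof -
          have "y \<noteq> opp m d" using y(2) None by auto
          moreover have "y \<in> backs (opp m) ?c" if yu: "y \<in> set (words (opp m) us)"
          proof -
            have "y \<notin> ?x" using vertex_eq[of y "opp m d"] y(2) None by auto
            then have "y \<notin> dart ` set us" using splits_darts[OF sp0] vx by blast
            moreover have "?dep1 (vertex m y) \<noteq> None" using y(2) by simp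
            ultimately have "y \<in> (\<Union>c\<in>set us. backs (opp m) c)" using u(9) yu by blast
            then show ?thesis by simp
          qed
          ultimately show ?thesis using y(1) unfolding wc by auto
        qed
        have "splits (opp m) (ex \<union> backs (opp m) ?c) ts ds"
        proof (rule splits_mono[OF r(7)])
          show "ex2 \<inter> set ds \<subseteq> ex \<union> backs (opp m) ?c"
          proof
            fix y assume y: "y \<in> ex2 \<inter> set ds"
            then have "vertex m y = vertex m (last path)" using ds(2) vertex_eq by blast
            then have dy: "dep (vertex m y) \<noteq> None" using depl by simp
            have "y \<noteq> d" using y dds by auto
            show "y \<in> ex \<union> backs (opp m) ?c"
            proof (cases "y \<in> ex")
              case False
              then have "y \<in> set (word (opp m) ?c)" using y u(3) unfolding wc by blast
              from cC[OF this dy] \<open>y \<noteq> d\<close> show ?thesis by auto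
            qed simp
          qed
        qed
        then have 4: "splits (opp m) ex ?ts (d # ds)"
          unfolding splits.simps by (intro exI[of _ "[]"] exI[of _ ds]) simp
        have 5: "\<forall>c\<in>set ?ts. explored m path c" using r(8) exc by simp
        have 6: "\<forall>y\<in>set (words (opp m) ?ts). dep (vertex m y) \<noteq> None \<longrightarrow>
              y \<in> dart ` set ?ts \<union> (\<Union>c\<in>set ?ts. backs (opp m) c)"
        proof (intro ballI impI)
          fix y assume y: "y \<in> set (words (opp m) ?ts)" "dep (vertex m y) \<noteq> None"
          show "y \<in> dart ` set ?ts \<union> (\<Union>c\<in>set ?ts. backs (opp m) c)"
          proof (cases "y \<in> set (word (opp m) ?c)")
            case True
            from cC[OF this y(2)] show ?thesis by auto
          next
            case False
            then have "y \<in> set (words (opp m) ts)" using y(1) by auto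
            moreover have "dep2 (vertex m y) \<noteq> None" using contrapos_nn[OF y(2) noneD] .
            ultimately have "y \<in> dart ` set ts \<union> (\<Union>c\<in>set ts. backs (opp m) c)" using r(9) by blast
            then show ?thesis by auto
          qed
        qed
        have 7: "dep \<subseteq>\<^sub>m dep'" using le1 r(6) map_le_trans by blast
        show ?thesis
          by (intro exI[of _ ?ts] exI[of _ dep'] exI[of _ ex'] conjI) (fact e r(2) 1 2 3 7 4 5 6)+
      qed
    qed
  qed
qed

end

lemma explored_map_exists:
  assumes "rooted_map m"
  shows "\<exists>forest. explored_map m forest \<and> dfs_tree m = erase (hd forest)"
proof -
  interpret premap m using rooted_map_premap[OF assms] .
  let ?r = "root_dart m"
  let ?dep = "[vertex m ?r \<mapsto> -1] :: 'a set \<rightharpoonup> int"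
  have inv: "expl_inv [?r] ?dep {}"
    using root_in by (auto simp: expl_inv_def split: if_splits)
  have "card {x \<in> vertices m. ?dep x = None} \<le> card (vertices m)"
    using finite_vertices by (intro card_mono) auto
  also have "\<dots> \<le> card (darts m)" unfolding vertices_def using card_image_le finite_darts by blast
  finally have k: "card {x \<in> vertices m. ?dep x = None} \<le> card (darts m)" .
  have p: "-1 = int (length [?r]) - 2" by simp
  have s: "set (support (rot m) ?r) \<subseteq> vertex m (last [?r])" using vertex_eq_support[of ?r] by simp
  from explore_sound[OF inv p distinct_support_rot s k] obtain ts dep' ex' where
    r: "explore (card (darts m)) m (-1) (support (rot m) ?r) (?dep, {}) = (map erase ts, (dep', ex'))"
      "expl_inv [?r] dep' ex'" "ex' = {} \<union> set (words (opp m) ts)" "distinct (words (opp m) ts)"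
      "splits (opp m) {} ts (support (rot m) ?r)" "\<forall>c\<in>set ts. explored m [?r] c" by blast
  have ts: "ts \<noteq> []" using r(5) in_support_rot[of ?r] by (cases ts) auto
  have vr: "vertex m ?r \<subseteq> ex'"
  proof -
    have "dart ` set ts \<union> (\<Union>c\<in>set ts. backs (opp m) c) \<subseteq> ex'"
      using r(3) dart_in_word(1)[of _ "opp m"] backs_subset_word[of "opp m"] by auto
    then show ?thesis unfolding vertex_eq_support using splits_subset[OF r(5)]
      by (metis subset_trans sup_bot_left)
  qed
  have exD: "ex' \<subseteq> darts m" using expl_invD(6)[OF r(2)] .
  \<comment> \<open>A vertex with an examined dart has been visited, and after the run all visited
    vertices are finished. So the examined darts are closed under both permutations, and
    connectedness yields all darts.\<close>
  have closed: "rot m y \<in> ex'" "opp m y \<in> ex'" if y: "y \<in> ex'" for y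
  proof -
    have yD: "y \<in> darts m" using y exD by blast
    have "dep' (vertex m y) \<noteq> None"
      using expl_invD(5)[OF r(2)] y in_vertices[OF yD] vertex_self[of y] by blast
    then obtain q where "dep' (vertex m y) = Some q" by blast
    then have "vertex m y \<subseteq> ex' \<or> (\<exists>i<length [?r]. vertex m y = vertex m ([?r] ! i))"
      using expl_invD(4)[OF r(2)] in_vertices[OF yD] by blast
    then have "vertex m y \<subseteq> ex'" using vr by auto
    moreover have "rot m y \<in> vertex m y" unfolding vertex_def by (rule orbit.base)
    ultimately show "rot m y \<in> ex'" by blast
    show "opp m y \<in> ex'" using expl_invD(7)[OF r(2)] y by blast
  qed
  have "y \<in> ex'" if y: "y \<in> darts m" for y
  proof -
    have "(?r, y) \<in> ({(x, rot m x) |x. True} \<union> {(x, opp m x) |x. True})\<^sup>*"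
      using assms y root_in unfolding rooted_map_def by blast
    then show ?thesis
    proof induction
      case base
      then show ?case using vr vertex_self by blast
    next
      case (step y z)
      then show ?case using closed by blast
    qed
  qed
  then have "ex' = darts m" using exD by blast
  then have W: "set (words (opp m) ts) = darts m" using r(3) by simp
  have "explored_map m ts"
    by unfold_locales (use r W in auto)
  moreover have "dfs_tree m = erase (hd ts)"
    unfolding dfs_tree_def r(1) using ts by (simp add: hd_map)
  ultimately show ?thesis by blast
qed


section \<open>Exploration of a map with a known tree\<close>

lemma explore_skip: "set Y \<subseteq> ex \<Longrightarrow> explore k m p (Y @ ds) (dep, ex) = explore k m p ds (dep, ex)"
  by (induction Y) auto

lemma explore_skip_all: "set ds \<subseteq> ex \<Longrightarrow> explore k m p ds (dep, ex) = ([], (dep, ex))"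
  using explore_skip[of ds ex k m p "[]" dep] by simp

context explored_map
begin

lemma node_vertex_inj:
  assumes "d \<in> ND" "d' \<in> ND" "vertex m (opp m d) = vertex m (opp m d')"
  shows "d = d'"
proof -
  have "opp m d \<in> EN" "opp m d' \<in> EN" using assms by (auto simp: EN_def)
  then have "opp m d = opp m d'" using EN_fam fam_vertex_inj assms(3) by metis
  then show ?thesis by (rule opp_inj)
qed

text \<open>\<open>splits\<close> and \<open>explored\<close> determine the run: child darts are met
  unexamined, all other darts examined. The induction is on the length of the contour because an
  internal child leads to two calls, on its own children and on the remaining siblings;
  \<open>as\<close> holds the siblings already done. Depths change only at vertices below
  \<open>ts\<close>, which keeps the vertices of later siblings unvisited.\<close>

lemma explore_complete:
  assumes "fam path P (as @ ts) Q" "p = int (length path) - 2" "splits (opp m) E ts ds" "E \<subseteq> ex"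
    "set (words (opp m) ts) \<inter> ex = {}"
    "\<forall>i<length path. dep (vertex m (path ! i)) = Some (int i - 1)"
    "\<forall>d\<in>set (fnodes ts). dep (vertex m (opp m d)) = None" "length (fnodes ts) \<le> k"
  shows "\<exists>dep'. explore k m p ds (dep, ex) = (map erase ts, (dep', ex \<union> set (words (opp m) ts))) \<and>
    (\<forall>x. x \<notin> (\<lambda>d. vertex m (opp m d)) ` set (fnodes ts) \<longrightarrow> dep' x = dep x)"
  using assms
proof (induction "length (words (opp m) ts)" arbitrary: path P as ts Q p E ds ex dep k rule: less_induct)
  case less
  note IH = less.hyps
  show ?case
  proof (cases ts)
    case Nil
    then have "set ds \<subseteq> ex" using less.prems(3,4) by auto
    then show ?thesis using Nil explore_skip_all[of ds ex k m p dep] by auto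
  next
    case (Cons c us)
    obtain Y ds' where ds: "ds = Y @ dart c # ds'" "set Y \<subseteq> E" "splits (opp m) (E \<union> backs (opp m) c) us ds'"
      using less.prems(3) Cons by auto
    have e0: "explore k m p ds (dep, ex) = explore k m p (dart c # ds') (dep, ex)"
      unfolding ds(1) by (rule explore_skip) (use ds(2) less.prems(4) in auto)
    have f: "fam path P ((as @ [c]) @ us) Q" using less.prems(1) Cons by simp
    have f0: "fam path P (as @ c # us) Q" using less.prems(1) Cons by simp
    have cex: "explored m path c" using fam_explored[OF f0] by simp
    have "W = (P @ words (opp m) as) @ words (opp m) (c # us) @ Q" using fam_W[OF f0] by simp
    then have dW: "distinct (words (opp m) (c # us))" using distinct_sub by (metis distinct_append)
    then have dW': "set (word (opp m) c) \<inter> set (words (opp m) us) = {}" by simp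
    have dN: "distinct (fnodes (c # us))" using distinct_words_darts(2)[OF dW] .
    have wex: "set (word (opp m) c) \<inter> ex = {}" "set (words (opp m) us) \<inter> ex = {}"
      using less.prems(5) Cons by auto
    have dc: "dart c \<notin> ex" using wex(1) dart_in_word(1)[of c "opp m"] by blast
    have lt: "length (words (opp m) us) < length (words (opp m) ts)"
      using Cons hd_word[of "opp m" c] by auto
    show ?thesis
    proof (cases c)
      case (AL d q)
      obtain i where i: "i < length path" "q = int i - 1" "opp m d \<in> vertex m (path ! i)" using cex AL by auto
      then have dep: "dep (vertex m (opp m d)) = Some q" using less.prems(6) vertex_eq by metis
      have a1: "E \<union> backs (opp m) c \<subseteq> ex \<union> {d, opp m d}" using AL less.prems(4) by auto
      have a2: "set (words (opp m) us) \<inter> (ex \<union> {d, opp m d}) = {}" using dW' wex AL by auto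
      have a3: "\<forall>d\<in>set (fnodes us). dep (vertex m (opp m d)) = None" "length (fnodes us) \<le> k"
        using less.prems(7,8) Cons by auto
      obtain dep' where r: "explore k m p ds' (dep, ex \<union> {d, opp m d}) =
          (map erase us, (dep', ex \<union> {d, opp m d} \<union> set (words (opp m) us)))"
        "\<forall>x. x \<notin> (\<lambda>d. vertex m (opp m d)) ` set (fnodes us) \<longrightarrow> dep' x = dep x"
        using IH[OF lt f less.prems(2) ds(3) a1 a2 less.prems(6) a3] by blast
      have "explore k m p ds (dep, ex) = (map erase ts, (dep', ex \<union> set (words (opp m) ts)))"
        unfolding e0 using dc AL dep r(1) Cons by (simp add: Let_def case_prod_beta insert_commute)
      moreover have "fnodes ts = fnodes us" using Cons AL by simp
      ultimately show ?thesis using r(2) by metis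
    next
      case (AN d vs)
      let ?x = "vertex m (opp m d)"
      have dep: "dep ?x = None" using less.prems(7) Cons AN by simp
      obtain k' where k: "k = Suc k'" using less.prems(8) Cons AN by (cases k) auto
      let ?dep1 = "dep(?x \<mapsto> p + 1)" and ?ex1 = "ex \<union> {d, opp m d}" and ?path = "path @ [opp m d]"
      let ?ds1 = "tl (support (rot m) (opp m d))"
      have f1: "fam ?path (P @ words (opp m) as @ [d]) ([] @ vs) (opp m d # words (opp m) us @ Q)"
        using fam_child[of path P as d vs us Q] f0 AN by simp
      have lt1: "length (words (opp m) vs) < length (words (opp m) ts)" using Cons AN by simp
      have p1: "p + 1 = int (length ?path) - 2" using less.prems(2) by simp
      have s1: "splits (opp m) {} vs ?ds1" using cex AN by simp
      have w1: "set (words (opp m) vs) \<inter> ?ex1 = {}" using wex(1) dW AN by auto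
      have NDs: "set (fnodes ts) \<subseteq> ND" using fam_nodes[OF less.prems(1)] by auto
      have path1: "\<forall>i<length ?path. ?dep1 (vertex m (?path ! i)) = Some (int i - 1)"
      proof (intro allI impI)
        fix i assume "i < length ?path"
        then consider "i < length path" | "i = length path" by fastforce
        then show "?dep1 (vertex m (?path ! i)) = Some (int i - 1)"
        proof cases
          case 1
          then have "dep (vertex m (path ! i)) = Some (int i - 1)" using less.prems(6) by blast
          then show ?thesis using 1 dep by (auto simp: nth_append)
        next
          case 2
          then show ?thesis using less.prems(2) by simp
        qed
      qed
      have dnd: "d \<in> ND" "set (fnodes vs) \<subseteq> ND" "set (fnodes us) \<subseteq> ND" using NDs Cons AN by auto
      have dnot: "d \<notin> set (fnodes vs)" "d \<notin> set (fnodes us)" "set (fnodes vs) \<inter> set (fnodes us) = {}"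
        using dN AN by auto
      have nvs: "\<forall>d'\<in>set (fnodes vs). ?dep1 (vertex m (opp m d')) = None"
      proof
        fix d' assume d': "d' \<in> set (fnodes vs)"
        then have "vertex m (opp m d') \<noteq> ?x" using node_vertex_inj[of d' d] dnd dnot by blast
        then show "?dep1 (vertex m (opp m d')) = None" using d' less.prems(7) Cons AN by auto
      qed
      have l1: "length (fnodes vs) \<le> k'" using less.prems(8) Cons AN k by simp
      obtain dep2 where r1: "explore k' m (p + 1) ?ds1 (?dep1, ?ex1) =
          (map erase vs, (dep2, ?ex1 \<union> set (words (opp m) vs)))"
        "\<forall>x. x \<notin> (\<lambda>d. vertex m (opp m d)) ` set (fnodes vs) \<longrightarrow> dep2 x = ?dep1 x"
        using IH[OF lt1 f1 p1 s1 empty_subsetI w1 path1 nvs l1] by blast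
      have e1: "explore k' m (p + 1) (support (rot m) (opp m d)) (?dep1, ?ex1) =
          (map erase vs, (dep2, ?ex1 \<union> set (words (opp m) vs)))"
        using r1(1) by (subst support_rot_Cons) simp
      let ?ex2 = "?ex1 \<union> set (words (opp m) vs)"
      have ex2: "?ex2 = ex \<union> set (word (opp m) c)" using AN by auto
      have a1: "E \<union> backs (opp m) c \<subseteq> ?ex2"
        unfolding ex2 using less.prems(4) backs_subset_word[of "opp m" c] by blast
      have a2: "set (words (opp m) us) \<inter> ?ex2 = {}" unfolding ex2 using dW' wex by blast
      have a3: "\<forall>i<length path. dep2 (vertex m (path ! i)) = Some (int i - 1)"
      proof (intro allI impI)
        fix i assume i: "i < length path"
        have 1: "?dep1 (vertex m (path ! i)) = Some (int i - 1)"
          using path1[rule_format, of i] i by (simp add: nth_append)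
        then have "vertex m (path ! i) \<notin> (\<lambda>d. vertex m (opp m d)) ` set (fnodes vs)"
        proof -
          have "vertex m (path ! i) \<noteq> vertex m (opp m d')" if "d' \<in> set (fnodes vs)" for d'
          proof
            assume "vertex m (path ! i) = vertex m (opp m d')"
            then have "?dep1 (vertex m (path ! i)) = None" using nvs[rule_format, OF that] by (simp only:)
            then show False using 1 by (simp only: option.distinct)
          qed
          then show ?thesis by blast
        qed
        from r1(2)[rule_format, OF this] 1 show "dep2 (vertex m (path ! i)) = Some (int i - 1)" by simp
      qed
      have a4: "\<forall>d'\<in>set (fnodes us). dep2 (vertex m (opp m d')) = None"
      proof
        fix d' assume d': "d' \<in> set (fnodes us)"
        have "vertex m (opp m d') \<notin> (\<lambda>d. vertex m (opp m d)) ` set (fnodes vs)"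
        proof
          assume "vertex m (opp m d') \<in> (\<lambda>d. vertex m (opp m d)) ` set (fnodes vs)"
          then obtain e where e: "e \<in> set (fnodes vs)" "vertex m (opp m d') = vertex m (opp m e)" by (elim imageE)
          then have "d' = e" using node_vertex_inj[of d' e] dnd d' by blast
          then show False using e(1) d' dnot by blast
        qed
        then have "dep2 (vertex m (opp m d')) = ?dep1 (vertex m (opp m d'))" using r1(2) by blast
        moreover have "vertex m (opp m d') \<noteq> ?x" using node_vertex_inj[of d' d] dnd dnot d' by blast
        moreover have "dep (vertex m (opp m d')) = None" using d' less.prems(7) Cons by auto
        ultimately show "dep2 (vertex m (opp m d')) = None" by simp
      qed
      have l2: "length (fnodes us) \<le> k" using less.prems(8) Cons by simp
      obtain dep' where r2: "explore k m p ds' (dep2, ?ex2) = (map erase us, (dep', ?ex2 \<union> set (words (opp m) us)))"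
        "\<forall>x. x \<notin> (\<lambda>d. vertex m (opp m d)) ` set (fnodes us) \<longrightarrow> dep' x = dep2 x"
        using IH[OF lt f less.prems(2) ds(3) a1 a2 a3 a4 l2] by blast
      have "explore k m p (d # ds') (dep, ex) = (map erase ts, (dep', ?ex2 \<union> set (words (opp m) us)))"
        using dc AN dep r2(1) e1 Cons k by (simp add: Let_def case_prod_beta rev_map)
      moreover have "?ex2 \<union> set (words (opp m) us) = ex \<union> set (words (opp m) ts)" unfolding ex2 using Cons by auto
      ultimately have "explore k m p ds (dep, ex) = (map erase ts, (dep', ex \<union> set (words (opp m) ts)))"
        unfolding e0 using AN by simp
      moreover have "dep' x = dep x" if "x \<notin> (\<lambda>d. vertex m (opp m d)) ` set (fnodes ts)" for x
      proof -
        have "x \<notin> (\<lambda>d. vertex m (opp m d)) ` set (fnodes us)" "x \<notin> (\<lambda>d. vertex m (opp m d)) ` set (fnodes vs)" "x \<noteq> ?x"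
          using that Cons AN by auto
        then show ?thesis using r1(2) r2(2) by simp
      qed
      ultimately show ?thesis by blast
    qed
  qed
qed

lemma dfs_tree_eq: "dfs_tree m = erase (hd forest)"
proof -
  let ?dep = "[vertex m (root_dart m) \<mapsto> -1] :: 'd set \<rightharpoonup> int"
  have f: "fam [root_dart m] [] ([] @ forest) []" using fam_root by simp
  have p: "-1 = int (length [root_dart m]) - 2" by simp
  have d1: "\<forall>i<length [root_dart m]. ?dep (vertex m ([root_dart m] ! i)) = Some (int i - 1)" by simp
  have d2: "\<forall>d\<in>set (fnodes forest). ?dep (vertex m (opp m d)) = None"
  proof
    fix d assume "d \<in> set (fnodes forest)"
    then have d: "d \<in> ND" by (simp add: ND_def)
    have "vertex m (opp m d) \<noteq> vertex m (root_dart m)"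
    proof
      assume "vertex m (opp m d) = vertex m (root_dart m)"
      moreover have "opp m d \<in> EN" "root_dart m \<in> EN" using d by (auto simp: EN_def)
      ultimately have "opp m d = root_dart m" using EN_fam fam_vertex_inj by metis
      then show False using root_tree_dart LD_ND(2) d by (metis IntI UnI2 empty_iff imageI)
    qed
    then show "?dep (vertex m (opp m d)) = None" by simp
  qed
  have "length (fnodes forest) = card ND"
    unfolding ND_def using distinct_card[OF distinct_words_darts(2)[OF distinct_W]] by simp
  also have "\<dots> \<le> card (darts m)" using W_sets finite_darts by (intro card_mono) auto
  finally have k: "length (fnodes forest) \<le> card (darts m)" .
  obtain dep' where "explore (card (darts m)) m (-1) (support (rot m) (root_dart m)) (?dep, {}) =
      (map erase forest, (dep', {} \<union> set (words (opp m) forest)))"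
    using explore_complete[OF f p root_splits empty_subsetI _ d1 d2 k] by blast
  then have "dfs_tree m = hd (map erase forest)" by (simp add: dfs_tree_def)
  then show ?thesis using root_first by (auto simp: hd_map)
qed

end


section \<open>Non-separability from the labels\<close>

context explored_map
begin

lemma decorated_not_separable:
  assumes "forest = [\<tau>]" "decorated (erase \<tau>)"
  shows "\<not> separable m"
proof (rule not_separableI[OF assms(1)])
  \<comment> \<open>The child of \<open>v\<close> is the root of the decorated tree, on which the
    decoration imposes no condition.\<close>
  have *: "if length path = 1 then ts = forest else \<forall>c\<in>set ts. dec (int (length path) - 2) (erase c)"
    if "fam path P ts Q" for path P ts Q
    using that
  proof (induction rule: fam.induct)
    case (fam_child path P us d ts vs Q)
    show ?case
    proof (cases "length path = 1")
      case True
      then have "\<tau> = AN d ts" using fam_child.IH assms(1) by (simp add: append_eq_Cons_conv)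
      then have "\<forall>c\<in>set ts. dec 0 (erase c)" using assms(2) by (auto simp: decorated_iff)
      then show ?thesis using True by simp
    next
      case False
      then have "dec (int (length path) - 2) (erase (AN d ts))" using fam_child.IH by simp
      then have "\<forall>c\<in>set ts. dec (int (length path) - 2 + 1) (erase c)" by simp
      then show ?thesis using fam_path[OF fam_child.hyps] by (simp add: algebra_simps)
    qed
  qed simp
  fix path P ts Q c assume "fam path P ts Q" "length path > 1" "c \<in> set ts"
  then have "dec (int (length path) - 2) (erase c)" using *[of path P ts Q] by simp
  from dec_low[OF this] obtain q where q: "q \<in> set (map snd (aleaves c))" "q < int (length path) - 2"
    unfolding labels_erase by blast
  from q(1) obtain d where "(d, q) \<in> set (aleaves c)" by auto
  then show "\<exists>d q. (d, q) \<in> set (aleaves c) \<and> q < int (length path) - 2" using q(2) by blast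
qed

end


section \<open>Addresses\<close>

fun subt :: "dtree \<Rightarrow> nat list \<Rightarrow> dtree option" where
  "subt t [] = Some t"
| "subt (Leaf q) (i # a) = None"
| "subt (Node ts) (i # a) = (if i < length ts then subt (ts ! i) a else None)"

lemma subtrees_subt: "(a, s) \<in> set (subtrees t) \<longleftrightarrow> subt t a = Some s"
proof (induction t arbitrary: a s)
  case (Leaf q)
  then show ?case by (cases a) auto
next
  case (Node ts)
  show ?case
  proof (cases a)
    case Nil
    then show ?thesis unfolding subtrees_Node_iff by auto
  next
    case (Cons i b)
    then show ?thesis unfolding subtrees_Node_iff using Node[of "ts ! i" b s] by auto
  qed
qed

lemma tree_vertices_subt: "a \<in> tree_vertices t \<longleftrightarrow> subt t a \<noteq> None"
proof -
  have "a \<in> tree_vertices t \<longleftrightarrow> (\<exists>s. (a, s) \<in> set (subtrees t))" by (force simp: tree_vertices_def)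
  then show ?thesis unfolding subtrees_subt by blast
qed

lemma subt_append: "subt t (a @ b) = (case subt t a of None \<Rightarrow> None | Some s \<Rightarrow> subt s b)"
  by (induction t a rule: subt.induct) auto

lemma subt_snoc:
  "subt t a = Some (Node us) \<Longrightarrow> subt t (a @ [i]) = (if i < length us then Some (us ! i) else None)"
  "subt t a = Some (Leaf q) \<Longrightarrow> subt t (a @ [i]) = None"
  by (simp_all add: subt_append)

lemma subt_prefix: "subt t (a @ i # b) \<noteq> None \<Longrightarrow> \<exists>us. subt t a = Some (Node us) \<and> i < length us"
proof -
  assume *: "subt t (a @ i # b) \<noteq> None"
  then obtain s where s: "subt t a = Some s" "subt s (i # b) \<noteq> None"
    by (cases "subt t a") (auto simp: subt_append)
  then show ?thesis by (cases s) (auto split: if_splits)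
qed

lemma arity_Node: "subt t a = Some (Node us) \<Longrightarrow> arity t a = length us"
proof -
  assume *: "subt t a = Some (Node us)"
  have "{i. a @ [i] \<in> tree_vertices t} = {..<length us}"
    unfolding tree_vertices_subt using subt_snoc(1)[OF *] by auto
  then show ?thesis by (simp add: arity_def)
qed

lemma arity_Leaf: "subt t a = Some (Leaf q) \<Longrightarrow> arity t a = 0"
proof -
  assume *: "subt t a = Some (Leaf q)"
  have "{i. a @ [i] \<in> tree_vertices t} = {}"
    unfolding tree_vertices_subt using subt_snoc(2)[OF *] by auto
  then show ?thesis by (simp add: arity_def)
qed

lemma leaves_subt: "(a, q) \<in> set (leaves t) \<longleftrightarrow> subt t a = Some (Leaf q)"
proof -
  have "(a, q) \<in> set (leaves t) \<longleftrightarrow> (a, Leaf q) \<in> set (subtrees t)"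
    by (force simp: leaves_def split: dtree.splits)
  then show ?thesis unfolding subtrees_subt .
qed

lemma finite_tree_vertices: "finite (tree_vertices t)"
  by (simp add: tree_vertices_def)

text \<open>The traversal order of leaves. It relates only addresses that diverge, not an address
  and its extension; the latter do not occur together among leaves.\<close>

definition lexless :: "nat list \<Rightarrow> nat list \<Rightarrow> bool" where
  "lexless a b \<longleftrightarrow> (\<exists>c i j u w. a = c @ i # u \<and> b = c @ j # w \<and> i < j)"

lemma lexless_Cons: "lexless a b \<Longrightarrow> lexless (i # a) (i # b)"
  unfolding lexless_def by (metis append_Cons)

lemma lexless_divergeD:
  assumes "lexless (b @ i # u) (b @ j # w)" "i \<noteq> j"
  shows "i < j"
proof -
  obtain c i' j' u' w' where "b @ i # u = c @ i' # u'" "b @ j # w = c @ j' # w'" "i' < j'"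
    using assms(1) unfolding lexless_def by blast
  then show ?thesis using assms(2)
  proof (induction b arbitrary: c)
    case Nil
    then show ?case by (cases c) auto
  next
    case (Cons h b)
    then show ?case by (cases c) auto
  qed
qed

lemma lexless_irrefl: "\<not> lexless a a"
  unfolding lexless_def by (metis less_irrefl list.inject same_append_eq)

lemma sorted_wrt_concat_upt:
  assumes "\<And>i. i < n \<Longrightarrow> sorted_wrt R (f i)"
    and "\<And>i j x y. i < j \<Longrightarrow> j < n \<Longrightarrow> x \<in> set (f i) \<Longrightarrow> y \<in> set (f j) \<Longrightarrow> R x y"
  shows "sorted_wrt R (concat (map f [0..<n]))"
  using assms by (induction n) (auto simp: sorted_wrt_append)

lemma leaves_sorted: "sorted_wrt (\<lambda>x y. lexless (fst x) (fst y)) (leaves t)"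
proof (induction t)
  case (Node ts)
  show ?case unfolding leaves_Node
  proof (rule sorted_wrt_concat_upt)
    fix i assume "i < length ts"
    then have "sorted_wrt (\<lambda>x y. lexless (fst x) (fst y)) (leaves (ts ! i))" using Node by simp
    then show "sorted_wrt (\<lambda>x y. lexless (fst x) (fst y)) (map (\<lambda>(a, q). (i # a, q)) (leaves (ts ! i)))"
      unfolding sorted_wrt_map by (rule sorted_wrt_mono_rel[rotated]) (auto intro: lexless_Cons)
  next
    fix i j :: nat and x y assume "i < j" "x \<in> set (map (\<lambda>(a, q). (i # a, q)) (leaves (ts ! i)))"
      "y \<in> set (map (\<lambda>(a, q). (j # a, q)) (leaves (ts ! j)))"
    then show "lexless (fst x) (fst y)" unfolding lexless_def by (fastforce intro: exI[of _ "[]"])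
  qed
qed simp

lemma distinct_leaves: "distinct (map fst (leaves t))"
proof -
  have "sorted_wrt lexless (map fst (leaves t))" using leaves_sorted[of t] by (simp add: sorted_wrt_map)
  moreover have "distinct l" if "sorted_wrt lexless l" for l
    using that lexless_irrefl by (induction l) auto
  ultimately show ?thesis by blast
qed

lemma concat_single:
  assumes "i < n" "\<And>j. j < n \<Longrightarrow> j \<noteq> i \<Longrightarrow> f j = []"
  shows "concat (map f [0..<n]) = f i"
proof -
  have "[0..<n] = [0..<i] @ i # [Suc i..<n]"
    using assms(1) by (metis less_imp_le_nat upt_add_eq_append le_add_diff_inverse upt_conv_Cons zero_le)
  moreover have "concat (map f [0..<i]) = []" "concat (map f [Suc i..<n]) = []"
    using assms by auto
  ultimately show ?thesis by (metis append_Nil append_Nil2 concat.simps(2) concat_append list.simps(9) map_append)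
qed

lemma leaves_filter_prefix:
  assumes "subt t c = Some s"
  shows "filter (\<lambda>(a, q). take (length c) a = c) (leaves t) = map (\<lambda>(b, q). (c @ b, q)) (leaves s)"
  using assms
proof (induction t c rule: subt.induct)
  case (1 t)
  then show ?case by (simp add: case_prod_unfold)
next
  case (3 ts i a)
  then have i: "i < length ts" "subt (ts ! i) a = Some s" by (auto split: if_splits)
  let ?P = "\<lambda>(b, q::int). take (length (i # a)) b = i # a"
  let ?f = "\<lambda>j. filter ?P (map (\<lambda>(b, q). (j # b, q)) (leaves (ts ! j)))"
  have "filter ?P (leaves (Node ts)) = concat (map ?f [0..<length ts])"
    unfolding leaves_Node filter_concat by (simp add: comp_def)
  also have "\<dots> = ?f i"
    by (rule concat_single[OF i(1)]) (auto simp: filter_empty_conv)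
  also have "\<dots> = map (\<lambda>(b, q). (i # b, q)) (filter (\<lambda>(b, q). take (length a) b = a) (leaves (ts ! i)))"
    by (simp add: filter_map comp_def case_prod_unfold)
  also have "\<dots> = map (\<lambda>(b, q). ((i # a) @ b, q)) (leaves s)"
    using 3(1)[OF i] by (simp add: case_prod_unfold comp_def)
  finally show ?case .
qed simp


section \<open>The closure of a tree\<close>

text \<open>Annotates a tree with the darts of its closure. The reversal turns the traversal order
  of a \<open>Node\<close> into the clockwise order of an \<open>AN\<close>.\<close>

fun ann :: "nat list \<Rightarrow> dtree \<Rightarrow> (nat list \<times> bool) atree" where
  "ann a (Leaf q) = AL (a, True) q"
| "ann a (Node ts) = AN (a, True) (rev (map (\<lambda>i. ann (a @ [i]) (ts ! i)) [0..<length ts]))"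

lemma dart_ann [simp]: "dart (ann a s) = (a, True)"
  by (cases s) auto

lemma erase_ann [simp]: "erase (ann a s) = s"
proof (induction s arbitrary: a)
  case (Node ts)
  have "map (\<lambda>i. erase (ann (a @ [i]) (ts ! i))) [0..<length ts] = ts"
    using Node by (intro nth_equalityI) auto
  then show ?case by (simp add: rev_map comp_def)
qed simp

lemma aleaves_ann: "aleaves (ann a s) = map (\<lambda>(b, q). ((a @ b, True), q)) (leaves s)"
proof (induction s arbitrary: a)
  case (Node ts)
  have "map (\<lambda>i. aleaves (ann (a @ [i]) (ts ! i))) [0..<length ts] =
      map (\<lambda>i. map (\<lambda>(b, q). ((a @ b, True), q)) (map (\<lambda>(b, q). (i # b, q)) (leaves (ts ! i)))) [0..<length ts]"
    using Node by (intro nth_equalityI) (auto simp: case_prod_unfold)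
  then have "concat (map (\<lambda>i. aleaves (ann (a @ [i]) (ts ! i))) [0..<length ts]) =
      map (\<lambda>(b, q). ((a @ b, True), q)) (leaves (Node ts))"
    unfolding leaves_Node map_concat map_map comp_def by (rule arg_cong)
  then show ?case by (simp add: comp_def)
qed simp

lemma darts_ann:
  "fst ` set (aleaves (ann a s)) \<union> set (ndarts (ann a s)) = {(a @ b, True) |b. subt s b \<noteq> None}"
proof (induction s arbitrary: a)
  case (Leaf q)
  have "subt (Leaf q) b \<noteq> None \<longleftrightarrow> b = []" for b by (cases b) auto
  then show ?case by auto
next
  case (Node ts)
  let ?F = "\<lambda>c. fst ` set (aleaves c) \<union> set (ndarts c)"
  have "?F (ann a (Node ts)) = insert (a, True) (\<Union>i<length ts. ?F (ann (a @ [i]) (ts ! i)))"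
    by (auto simp: image_UN atLeast0LessThan)
  also have "\<dots> = insert (a, True) (\<Union>i<length ts. {((a @ [i]) @ b, True) |b. subt (ts ! i) b \<noteq> None})"
    using Node by simp
  also have "\<dots> = {(a @ b, True) |b. subt (Node ts) b \<noteq> None}"
  proof (intro set_eqI iffI)
    fix x assume "x \<in> insert (a, True) (\<Union>i<length ts. {((a @ [i]) @ b, True) |b. subt (ts ! i) b \<noteq> None})"
    then consider "x = (a @ [], True)" | i b where "i < length ts" "x = (a @ i # b, True)" "subt (ts ! i) b \<noteq> None"
      by auto
    then show "x \<in> {(a @ b, True) |b. subt (Node ts) b \<noteq> None}"
    proof cases
      case 1
      have "subt (Node ts) [] \<noteq> None" by simp
      then show ?thesis using 1 by blast
    next
      case 2
      then have "subt (Node ts) (i # b) \<noteq> None" by simp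
      then show ?thesis using 2(2) by blast
    qed
  next
    fix x assume "x \<in> {(a @ b, True) |b. subt (Node ts) b \<noteq> None}"
    then obtain b where b: "x = (a @ b, True)" "subt (Node ts) b \<noteq> None" by blast
    show "x \<in> insert (a, True) (\<Union>i<length ts. {((a @ [i]) @ b, True) |b. subt (ts ! i) b \<noteq> None})"
    proof (cases b)
      case Nil
      then show ?thesis using b by simp
    next
      case (Cons i c)
      then have "i < length ts" "subt (ts ! i) c \<noteq> None" using b(2) by (auto split: if_splits)
      then show ?thesis using b(1) Cons by auto
    qed
  qed
  finally show ?case .
qed

lemma distinct_concat_map:
  assumes "distinct xs" "\<And>x. x \<in> set xs \<Longrightarrow> distinct (f x)"
    "\<And>x y. x \<in> set xs \<Longrightarrow> y \<in> set xs \<Longrightarrow> x \<noteq> y \<Longrightarrow> set (f x) \<inter> set (f y) = {}"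
  shows "distinct (concat (map f xs))"
  using assms
proof (induction xs)
  case (Cons x xs)
  have "set (f x) \<inter> set (f y) = {}" if "y \<in> set xs" for y
    using Cons.prems(1) Cons.prems(3)[of x y] that by auto
  then have "set (f x) \<inter> set (concat (map f xs)) = {}" by auto
  then show ?case using Cons by simp
qed simp

text \<open>The hypothesis speaks of addresses in the tree only, since \<open>opp\<close> of the
  closure is the identity elsewhere.\<close>

lemma word_ann:
  assumes "\<And>b. subt s b \<noteq> None \<Longrightarrow> op (a @ b, True) = (a @ b, False)"
  shows "set (word op (ann a s)) = {(a @ b, x) |b x. subt s b \<noteq> None}" "distinct (word op (ann a s))"
proof -
  have set: "set (word op (ann a s)) = {(a @ b, x) |b x. subt s b \<noteq> None}"
    if "\<And>b. subt s b \<noteq> None \<Longrightarrow> op (a @ b, True) = (a @ b, False)" for a s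
  proof -
    have "op ` {(a @ b, True) |b. subt s b \<noteq> None} = {(a @ b, False) |b. subt s b \<noteq> None}"
      (is "?A = ?B")
    proof (intro set_eqI iffI)
      fix x assume "x \<in> ?A"
      then obtain b where "x = op (a @ b, True)" "subt s b \<noteq> None" by blast
      then show "x \<in> ?B" using that by auto
    next
      fix x assume "x \<in> ?B"
      then obtain b where b: "x = (a @ b, False)" "subt s b \<noteq> None" by blast
      then have "x = op (a @ b, True)" using that by simp
      then show "x \<in> ?A" using b(2) by blast
    qed
    then have "set (word op (ann a s)) = {(a @ b, True) |b. subt s b \<noteq> None} \<union> {(a @ b, False) |b. subt s b \<noteq> None}"
      unfolding set_word_eq darts_ann by simp
    also have "\<dots> = {(a @ b, x) |b x. subt s b \<noteq> None}" by auto
    finally show ?thesis .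
  qed
  show "set (word op (ann a s)) = {(a @ b, x) |b x. subt s b \<noteq> None}" using set assms by blast
  show "distinct (word op (ann a s))"
    using assms
  proof (induction s arbitrary: a)
    case (Leaf q)
    then show ?case using Leaf[of "[]"] by simp
  next
    case (Node ts)
    let ?f = "\<lambda>i. word op (ann (a @ [i]) (ts ! i))"
    have op: "op ((a @ [i]) @ b, True) = ((a @ [i]) @ b, False)" if "i < length ts" "subt (ts ! i) b \<noteq> None" for i b
      using Node.prems[of "i # b"] that by simp
    have fi: "set (?f i) = {((a @ [i]) @ b, x) |b x. subt (ts ! i) b \<noteq> None}" if "i < length ts" for i
      by (rule set) (use op[OF that] in blast)
    have w: "words op (rev (map (\<lambda>i. ann (a @ [i]) (ts ! i)) [0..<length ts])) = concat (map ?f (rev [0..<length ts]))"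
      by (simp add: rev_map comp_def)
    have "distinct (concat (map ?f (rev [0..<length ts])))"
    proof (rule distinct_concat_map)
      fix i assume "i \<in> set (rev [0..<length ts])"
      then have i: "i < length ts" by simp
      then show "distinct (?f i)" using Node.IH[of "ts ! i" "a @ [i]"] op[OF i] by simp
    next
      fix i j assume "i \<in> set (rev [0..<length ts])" "j \<in> set (rev [0..<length ts])" "i \<noteq> j"
      then show "set (?f i) \<inter> set (?f j) = {}" by (auto simp: fi)
    qed simp
    moreover have "set (concat (map ?f (rev [0..<length ts]))) \<subseteq> {(a @ i # b, x) |i b x. True}"
      by (auto simp: fi)
    then have "(a, x) \<notin> set (concat (map ?f (rev [0..<length ts])))" for x by fastforce
    moreover have "op (a, True) = (a, False)" using Node.prems[of "[]"] by simp
    ultimately show ?case using w by simp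
  qed
qed

text \<open>Every back edge ends right behind the child it comes from, so it has been examined by
  then. The induction carries along the block \<open>Y\<close> left over from the previous
  child.\<close>

lemma splits_tight: "splits op E ts (concat (map (\<lambda>c. dart c # ups op p c) ts))"
proof -
  have "splits op E ts (Y @ concat (map (\<lambda>c. dart c # ups op p c) ts))" if "set Y \<subseteq> E" for Y
    using that
  proof (induction ts arbitrary: E Y)
    case (Cons c ts)
    have "splits op (E \<union> backs op c) ts (ups op p c @ concat (map (\<lambda>c. dart c # ups op p c) ts))"
      by (rule Cons.IH) (use ups_subset_backs[of op p c] in auto)
    then show ?case using Cons.prems by auto
  qed simp
  from this[of "[]"] show ?thesis by simp
qed

text \<open>The bounds on the labels make the closure a map explored by \<open>t\<close>; condition
  (3) is added in \<open>closing3\<close> for planarity, and condition (2) serves non-separability.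
  The parent of the leaf \<open>a\<close> has depth \<open>length a - 1\<close>.\<close>

locale closing =
  fixes t :: dtree
  assumes node: "\<exists>ts. t = Node ts"
    and label: "subt t a = Some (Leaf q) \<Longrightarrow> -1 \<le> q \<and> q < int (length a) - 1"
begin

definition "L = leaves t"
definition "D = tree_vertices t \<times> (UNIV :: bool set)"
definition "m = closure_map t"
text \<open>Leaves are closed from the last to the first, so for a suffix \<open>S\<close> of
  \<open>L\<close> this is the rotation at the moment when just the leaves of \<open>S\<close> are
  closed.\<close>

definition "clos S = foldr close_leaf S (tree_rot t)"
definition up :: "(nat list \<times> int) list \<Rightarrow> nat list \<Rightarrow> (nat list \<times> bool) list" where
  "up S c = map (\<lambda>(a, q). (a, False)) (filter (\<lambda>(a, q). take (nat (q + 1)) a = c) S)"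

lemma m_simps: "darts m = D" "rot m = perm_restrict (clos L) D"
  "opp m = perm_restrict (\<lambda>(a, b). (a, \<not> b)) D" "root_dart m = ([], True)"
  by (simp_all add: m_def closure_map_def D_def L_def clos_def foldr_conv_fold Let_def)

lemma D_iff: "(a, x) \<in> D \<longleftrightarrow> subt t a \<noteq> None"
  by (simp add: D_def tree_vertices_subt)

lemma opp_m: "subt t a \<noteq> None \<Longrightarrow> opp m (a, x) = (a, \<not> x)"
  by (simp add: m_simps perm_restrict_def D_iff)

lemma opp_m_invol: "opp m (opp m d) = d"
  by (cases d) (auto simp: m_simps perm_restrict_def D_iff)

lemma tree_rot_leaf: "subt t a = Some (Leaf q) \<Longrightarrow> tree_rot t (a, False) = (a, False)"
  by (simp add: arity_Leaf)

lemma tree_rot_node: "subt t a = Some (Node us) \<Longrightarrow>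
  tree_rot t (a, False) = (if us = [] then (a, False) else (a @ [length us - 1], True))"
  by (simp add: arity_Node)

lemma tree_rot_child: "tree_rot t (a @ [i], True) = (if i = 0 then (a, False) else (a @ [i - 1], True))"
  by simp

lemma tree_rot_siblings:
  "n > 0 \<Longrightarrow> map (\<lambda>i. tree_rot t (a @ [i], True)) (rev [0..<n]) =
     tl (map (\<lambda>i. (a @ [i], True)) (rev [0..<n])) @ [(a, False)]"
proof (induction n)
  case (Suc n)
  show ?case
  proof (cases n)
    case 0
    then show ?thesis by simp
  next
    case (Suc k)
    then have "map (\<lambda>i. tree_rot t (a @ [i], True)) (rev [0..<n]) =
        tl (map (\<lambda>i. (a @ [i], True)) (rev [0..<n])) @ [(a, False)]" using Suc.IH by blast
    moreover have "map (\<lambda>i. (a @ [i], True)) (rev [0..<n]) = (a @ [n - 1], True) # tl (map (\<lambda>i. (a @ [i], True)) (rev [0..<n]))"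
      using Suc by simp
    moreover have "rev [0..<Suc n] = n # rev [0..<n]" by simp
    moreover have "tree_rot t (a @ [n], True) = (a @ [n - 1], True)" using Suc by (simp only: tree_rot_child) simp
    ultimately show ?thesis by (metis (no_types, lifting) append_Cons list.sel(3) list.simps(9))
  qed
qed simp

text \<open>A leaf is glued right behind \<open>(c, True)\<close>, before the ends glued there
  earlier; closing in reverse order therefore leaves these ends in traversal order. Behind them the
  rotation of the tree resumes.\<close>

lemma clos_chain:
  assumes "distinct (map fst S)" "\<And>a q. (a, q) \<in> set S \<Longrightarrow> subt t a = Some (Leaf q)"
  shows "map (clos S) ((c, True) # up S c) = up S c @ [tree_rot t (c, True)]"
    and "a \<notin> fst ` set S \<Longrightarrow> clos S (a, False) = tree_rot t (a, False)"
proof -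
  have "(\<forall>c. map (clos S) ((c, True) # up S c) = up S c @ [tree_rot t (c, True)]) \<and>
    (\<forall>a. a \<notin> fst ` set S \<longrightarrow> clos S (a, False) = tree_rot t (a, False))"
    using assms
  proof (induction S)
    case Nil
    then show ?case by (simp add: clos_def up_def)
  next
    case (Cons x S)
    obtain a q where x: "x = (a, q)" by (cases x)
    let ?c = "take (nat (q + 1)) a"
    let ?r = "clos S"
    have r': "clos (x # S) = ?r((?c, True) := (a, False), (a, False) := ?r (?c, True))"
      by (simp add: clos_def x Let_def)
    have IH: "\<And>c. map ?r ((c, True) # up S c) = up S c @ [tree_rot t (c, True)]"
      "\<And>a. a \<notin> fst ` set S \<Longrightarrow> ?r (a, False) = tree_rot t (a, False)"
      using Cons by auto
    have aS: "a \<notin> fst ` set S" using Cons.prems(1) x by simp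
    have un: "map (clos (x # S)) (up S c) = map ?r (up S c)" for c
    proof -
      have "(a, False) \<notin> set (up S c)" "(?c, True) \<notin> set (up S c)" using aS by (force simp: up_def)+
      then show ?thesis unfolding r' by (intro map_cong) auto
    qed
    have 1: "map (clos (x # S)) ((c, True) # up (x # S) c) = up (x # S) c @ [tree_rot t (c, True)]" for c
    proof (cases "c = ?c")
      case True
      have "up (x # S) c = (a, False) # up S c" using True x by (simp add: up_def)
      moreover have "clos (x # S) (c, True) = (a, False)" unfolding r' using True by simp
      moreover have "clos (x # S) (a, False) = ?r (c, True)" unfolding r' using True by simp
      ultimately show ?thesis using IH(1)[of c] un[of c] by (simp del: tree_rot.simps map_eq_conv)
    next
      case False
      have "up (x # S) c = up S c" using False x by (auto simp: up_def)
      moreover have "clos (x # S) (c, True) = ?r (c, True)" unfolding r' using False by simp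
      ultimately show ?thesis using IH(1)[of c] un[of c] by (simp del: tree_rot.simps map_eq_conv)
    qed
    have 2: "clos (x # S) (b, False) = tree_rot t (b, False)" if "b \<notin> fst ` set (x # S)" for b
      unfolding r' using that IH(2)[of b] x by simp
    show ?case using 1 2 by blast
  qed
  then show "map (clos S) ((c, True) # up S c) = up S c @ [tree_rot t (c, True)]"
    "a \<notin> fst ` set S \<Longrightarrow> clos S (a, False) = tree_rot t (a, False)" by blast+
qed

lemma L_facts: "distinct (map fst L)" "(a, q) \<in> set L \<longleftrightarrow> subt t a = Some (Leaf q)"
  by (simp_all add: L_def distinct_leaves leaves_subt)

lemma clos_L:
  "map (clos L) ((c, True) # up L c) = up L c @ [tree_rot t (c, True)]"
  "a \<notin> fst ` set L \<Longrightarrow> clos L (a, False) = tree_rot t (a, False)"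
  using clos_chain[of L] L_facts by blast+

text \<open>The edge \<open>c\<close> has its upper end at depth \<open>length c - 1\<close>, which
  is -1 for the root edge. So a leaf is glued behind \<open>c\<close> iff it lies below
  \<open>c\<close> and has exactly this label.\<close>

lemma up_ups:
  assumes "subt t c = Some s"
  shows "up L c = ups (opp m) (int (length c) - 1) (ann c s)"
proof -
  have "filter (\<lambda>(a, q). take (nat (q + 1)) a = c) L =
      filter (\<lambda>(a, q). q = int (length c) - 1) (filter (\<lambda>(a, q). take (length c) a = c) L)"
    unfolding filter_filter
  proof (rule filter_cong[OF refl])
    fix x assume x: "x \<in> set L"
    obtain a q where aq: "x = (a, q)" by (cases x)
    have q: "-1 \<le> q" "q < int (length a) - 1" using label[of a q] L_facts(2) x aq by auto
    have "take (nat (q + 1)) a = c \<longleftrightarrow> take (length c) a = c \<and> q = int (length c) - 1"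
    proof
      assume *: "take (nat (q + 1)) a = c"
      then have "length c = nat (q + 1)" using q by auto
      then show "take (length c) a = c \<and> q = int (length c) - 1" using * q by auto
    qed (use q in auto)
    then show "(case x of (a, q) \<Rightarrow> take (nat (q + 1)) a = c) =
      ((case x of (a, q) \<Rightarrow> take (length c) a = c) \<and> (case x of (a, q) \<Rightarrow> q = int (length c) - 1))"
      using aq by simp
  qed
  also have "filter (\<lambda>(a, q). take (length c) a = c) L = map (\<lambda>(b, q). (c @ b, q)) (leaves s)"
    unfolding L_def by (rule leaves_filter_prefix[OF assms])
  finally have "up L c = map (\<lambda>(a, q). (a, False))
      (filter (\<lambda>(a, q). q = int (length c) - 1) (map (\<lambda>(b, q). (c @ b, q)) (leaves s)))"
    unfolding up_def by simp
  also have "\<dots> = map (\<lambda>(b, q). (c @ b, False)) (filter (\<lambda>(b, q). q = int (length c) - 1) (leaves s))"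
    by (simp add: filter_map comp_def case_prod_unfold)
  also have "\<dots> = map (\<lambda>(b, q). opp m (c @ b, True)) (filter (\<lambda>(b, q). q = int (length c) - 1) (leaves s))"
  proof (rule map_cong[OF refl])
    fix x assume x: "x \<in> set (filter (\<lambda>(b, q). q = int (length c) - 1) (leaves s))"
    obtain b q where bq: "x = (b, q)" by (cases x)
    then have "subt s b = Some (Leaf q)" using x by (simp add: leaves_subt)
    then have "subt t (c @ b) \<noteq> None" using assms by (simp add: subt_append)
    then show "(case x of (b, q) \<Rightarrow> (c @ b, False)) = (case x of (b, q) \<Rightarrow> opp m (c @ b, True))"
      using opp_m bq by simp
  qed
  also have "\<dots> = ups (opp m) (int (length c) - 1) (ann c s)"
    unfolding ups_def aleaves_ann by (simp add: filter_map comp_def case_prod_unfold)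
  finally show ?thesis .
qed

lemma distinct_up: "distinct (up L c)"
proof -
  have "distinct (map (\<lambda>a. (a, False)) (map fst (filter (\<lambda>(a, q). take (nat (q + 1)) a = c) L)))"
    using distinct_map_filter[OF L_facts(1)] by (subst distinct_map) (auto intro: inj_onI)
  then show ?thesis by (simp add: up_def comp_def case_prod_unfold)
qed

lemma set_up: "x \<in> set (up L c) \<longleftrightarrow> (\<exists>a q. x = (a, False) \<and> subt t a = Some (Leaf q) \<and> take (nat (q + 1)) a = c)"
  by (force simp: up_def L_facts)

definition vlist :: "nat list \<Rightarrow> nat \<Rightarrow> (nat list \<times> bool) list" where
  "vlist a n = concat (map (\<lambda>i. (a @ [i], True) # up L (a @ [i])) (rev [0..<n]))"

lemma cyc_root: "cyc (clos L) (([], True) # up L [])"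
  unfolding cyc_Cons_iff using clos_L(1)[of "[]"] distinct_up[of "[]"] by (auto simp: set_up)

lemma cyc_node:
  assumes a: "subt t a = Some (Node us)"
  shows "cyc (clos L) ((a, False) # vlist a (length us))"
proof -
  let ?n = "length us"
  have d: "distinct (vlist a ?n)"
    unfolding vlist_def
  proof (rule distinct_concat_map)
    fix i assume "i \<in> set (rev [0..<?n])"
    show "distinct ((a @ [i], True) # up L (a @ [i]))" using distinct_up by (auto simp: set_up)
  next
    fix i j assume "i \<in> set (rev [0..<?n])" "j \<in> set (rev [0..<?n])" "i \<noteq> j"
    then show "set ((a @ [i], True) # up L (a @ [i])) \<inter> set ((a @ [j], True) # up L (a @ [j])) = {}"
      by (auto simp: set_up)
  qed simp
  have na: "(a, False) \<notin> set (vlist a ?n)" using a by (auto simp: vlist_def set_up)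
  have nL: "a \<notin> fst ` set L" using a L_facts(2) by fastforce
  have r: "clos L (a, False) = (if us = [] then (a, False) else (a @ [?n - 1], True))"
    using clos_L(2)[OF nL] tree_rot_node[OF a] by simp
  show ?thesis
  proof (cases "us = []")
    case True
    then show ?thesis using r by (simp add: vlist_def cyc_def)
  next
    case False
    let ?nx = "\<lambda>i. tree_rot t (a @ [i], True)"
    have ne: "?n > 0" using False by simp
    have m1: "map ?nx (rev [0..<?n]) = tl (map (\<lambda>i. (a @ [i], True)) (rev [0..<?n])) @ [(a, False)]"
      using tree_rot_siblings[OF ne] .
    have chain: "map (clos L) (vlist a ?n) = tl (vlist a ?n) @ [(a, False)]"
      unfolding vlist_def
      by (rule map_chain[where x = "\<lambda>i. (a @ [i], True)" and nx = ?nx]) (use clos_L(1) m1 in blast)+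
    obtain k where k: "?n = Suc k" using ne by (cases ?n) auto
    have "vlist a ?n = (a @ [?n - 1], True) # tl (vlist a ?n)" by (simp add: vlist_def k)
    then have "map (clos L) ((a, False) # vlist a ?n) = vlist a ?n @ [(a, False)]"
      using chain r False by (metis append_Cons list.simps(9))
    then show ?thesis using d na by (simp add: cyc_Cons_iff)
  qed
qed

lemma up_D: "set (up L c) \<subseteq> D"
proof
  fix x assume "x \<in> set (up L c)"
  then obtain a q where "x = (a, False)" "subt t a = Some (Leaf q)" unfolding set_up by blast
  then show "x \<in> D" using D_iff by simp
qed

lemma vlist_D: "subt t a = Some (Node us) \<Longrightarrow> set ((a, False) # vlist a (length us)) \<subseteq> D"
proof -
  assume a: "subt t a = Some (Node us)"
  have "(a @ [i], True) \<in> D" if "i < length us" for i using D_iff subt_snoc(1)[OF a, of i] that by simp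
  moreover have "(a, False) \<in> D" using a D_iff by simp
  ultimately show ?thesis using up_D by (auto simp: vlist_def)
qed

lemma leaf_in_cycle:
  assumes a: "subt t a = Some (Leaf q)"
  shows "q = -1 \<Longrightarrow> (a, False) \<in> set (([], True) # up L [])"
    and "q \<noteq> -1 \<Longrightarrow> \<exists>us. subt t (take (nat q) a) = Some (Node us) \<and>
      (a, False) \<in> set ((take (nat q) a, False) # vlist (take (nat q) a) (length us))"
proof -
  show "(a, False) \<in> set (([], True) # up L [])" if "q = -1"
  proof -
    have "(a, False) \<in> set (up L [])" unfolding set_up using a that by (intro exI[of _ a] exI[of _ q]) simp
    then show ?thesis by simp
  qed
  show "\<exists>us. subt t (take (nat q) a) = Some (Node us) \<and>
      (a, False) \<in> set ((take (nat q) a, False) # vlist (take (nat q) a) (length us))" if "q \<noteq> -1"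
  proof -
    have q: "0 \<le> q" "q < int (length a) - 1" using label[OF a] that by auto
    let ?b = "take (nat q) a" and ?i = "a ! nat q"
    have lt: "nat q < length a" using q by simp
    have a': "a = ?b @ ?i # drop (Suc (nat q)) a" using id_take_nth_drop[OF lt] .
    then have "subt t (?b @ ?i # drop (Suc (nat q)) a) \<noteq> None" using a by simp
    then obtain us where us: "subt t ?b = Some (Node us)" "?i < length us" using subt_prefix by blast
    have "nat (q + 1) = Suc (nat q)" using q by simp
    then have "take (nat (q + 1)) a = ?b @ [?i]" using lt by (simp add: take_Suc_conv_app_nth)
    then have "(a, False) \<in> set (up L (?b @ [?i]))" unfolding set_up using a by blast
    then have "(a, False) \<in> set (vlist ?b (length us))" using us(2) by (auto simp: vlist_def)
    then show ?thesis using us(1) by auto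
  qed
qed

text \<open>The cycles are those of \<open>v\<close> and of the internal vertices; the end of a
  closed leaf belongs to the cycle of its target.\<close>

lemma in_cycle: "x \<in> D \<Longrightarrow> \<exists>l. cyc (clos L) l \<and> x \<in> set l \<and> set l \<subseteq> D"
proof -
  assume x: "x \<in> D"
  obtain a b where ab: "x = (a, b)" by (cases x)
  have rootD: "set (([], True) # up L []) \<subseteq> D" using up_D[of "[]"] D_iff[of "[]" True] by simp
  obtain s where s: "subt t a = Some s" using x ab D_iff by auto
  show ?thesis
  proof (cases b)
    case True
    show ?thesis
    proof (cases a rule: rev_cases)
      case Nil
      then show ?thesis using ab True cyc_root rootD by (intro exI[of _ "([], True) # up L []"]) simp
    next
      case (snoc c i)
      then obtain us where us: "subt t c = Some (Node us)" "i < length us" using subt_prefix[of t c i "[]"] s by auto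
      have "x \<in> set (vlist c (length us))" using ab True snoc us(2) by (auto simp: vlist_def)
      then show ?thesis using cyc_node[OF us(1)] vlist_D[OF us(1)]
        by (intro exI[of _ "(c, False) # vlist c (length us)"]) simp
    qed
  next
    case False
    show ?thesis
    proof (cases s)
      case (Node us)
      then have "subt t a = Some (Node us)" using s by simp
      from cyc_node[OF this] vlist_D[OF this] show ?thesis using ab False
        by (intro exI[of _ "(a, False) # vlist a (length us)"]) simp
    next
      case (Leaf q)
      then have l: "subt t a = Some (Leaf q)" using s by simp
      show ?thesis
      proof (cases "q = -1")
        case True
        then show ?thesis using leaf_in_cycle(1)[OF l] ab False cyc_root rootD
          by (intro exI[of _ "([], True) # up L []"]) simp
      next
        case q: False
        from leaf_in_cycle(2)[OF l q] obtain us where "subt t (take (nat q) a) = Some (Node us)"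
          "(a, False) \<in> set ((take (nat q) a, False) # vlist (take (nat q) a) (length us))" by blast
        then show ?thesis using cyc_node[of "take (nat q) a" us] vlist_D[of "take (nat q) a" us] ab False
          by (intro exI[of _ "(take (nat q) a, False) # vlist (take (nat q) a) (length us)"]) simp
      qed
    qed
  qed
qed

lemma finite_D: "finite D"
  using finite_tree_vertices by (simp add: D_def)

sublocale premap m
proof
  show "finite (darts m)" using finite_D by (simp add: m_simps)
  show "rot m permutes darts m"
    unfolding m_simps by (rule cyc_permutes[OF in_cycle finite_D])
  show "opp m permutes darts m"
    unfolding permutes_def using opp_m_invol by (metis m_simps(1,3) perm_restrict_simps(2))
  show "opp m d \<noteq> d \<and> opp m (opp m d) = d" if "d \<in> darts m" for d
    using that opp_m_invol[of d] opp_m by (cases d) (auto simp: m_simps(1) D_iff)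
  show "root_dart m \<in> darts m" using D_iff by (simp add: m_simps)
qed

lemma cyc_rot_m: "cyc (clos L) l \<Longrightarrow> set l \<subseteq> D \<Longrightarrow> cyc (rot m) l"
  unfolding cyc_def m_simps by (metis (no_types, lifting) map_eq_conv perm_restrict_simps(1) subsetD)

lemma support_root: "support (rot m) ([], True) = ([], True) # up L []"
  by (rule cyc_support[OF cyc_rot_m[OF cyc_root]]) (use up_D[of "[]"] D_iff[of "[]"] in simp)

lemma support_node:
  "subt t a = Some (Node us) \<Longrightarrow> support (rot m) (a, False) = (a, False) # vlist a (length us)"
  by (rule cyc_support[OF cyc_rot_m[OF cyc_node vlist_D]])

text \<open>The entering darts of \<open>v\<close> and of the proper ancestors of \<open>a\<close>;
  the entry at index \<open>i\<close> belongs to depth \<open>i - 1\<close>.\<close>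

definition pathof :: "nat list \<Rightarrow> (nat list \<times> bool) list" where
  "pathof a = ([], True) # map (\<lambda>k. (take k a, False)) [0..<length a]"

lemma pathof_snoc: "pathof (a @ [i]) = pathof a @ [(a, False)]"
  by (simp add: pathof_def)

lemma vlist_children:
  assumes a: "subt t a = Some (Node us)"
  shows "vlist a (length us) = concat (map (\<lambda>c. dart c # ups (opp m) (int (length a)) c)
    (rev (map (\<lambda>i. ann (a @ [i]) (us ! i)) [0..<length us])))"
proof -
  have "map (\<lambda>i. (a @ [i], True) # up L (a @ [i])) (rev [0..<length us]) =
      map (\<lambda>i. dart (ann (a @ [i]) (us ! i)) # ups (opp m) (int (length a)) (ann (a @ [i]) (us ! i)))
        (rev [0..<length us])"
  proof (rule map_cong[OF refl])
    fix i assume "i \<in> set (rev [0..<length us])"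
    then have "subt t (a @ [i]) = Some (us ! i)" using subt_snoc(1)[OF a] by simp
    from up_ups[OF this] show "(a @ [i], True) # up L (a @ [i]) =
      dart (ann (a @ [i]) (us ! i)) # ups (opp m) (int (length a)) (ann (a @ [i]) (us ! i))" by simp
  qed
  then show ?thesis unfolding vlist_def rev_map map_map comp_def by (rule arg_cong)
qed

lemma explored_ann: "subt t a = Some s \<Longrightarrow> explored m (pathof a) (ann a s) \<and> tight m (int (length a)) (ann a s)"
proof (induction s arbitrary: a)
  case (Leaf q)
  have q: "-1 \<le> q" "q < int (length a) - 1" using label[OF Leaf] by auto
  have op: "opp m (a, True) = (a, False)" using opp_m Leaf by simp
  have "\<exists>i<length (pathof a). q = int i - 1 \<and> opp m (a, True) \<in> vertex m (pathof a ! i)"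
  proof (cases "q = -1")
    case True
    have "(a, False) \<in> vertex m ([], True)"
      unfolding vertex_eq_support support_root using leaf_in_cycle(1)[OF Leaf True] .
    then show ?thesis using True op by (intro exI[of _ 0]) (simp add: pathof_def)
  next
    case False
    then have q0: "0 \<le> q" using q by simp
    obtain us where us: "subt t (take (nat q) a) = Some (Node us)"
      "(a, False) \<in> set ((take (nat q) a, False) # vlist (take (nat q) a) (length us))"
      using leaf_in_cycle(2)[OF Leaf False] by blast
    have "(a, False) \<in> vertex m (take (nat q) a, False)"
      unfolding vertex_eq_support support_node[OF us(1)] using us(2) .
    then show ?thesis using q q0 op by (intro exI[of _ "Suc (nat q)"]) (simp add: pathof_def)
  qed
  then show ?case by simp
next
  case (Node us)
  have op: "opp m (a, True) = (a, False)" using opp_m Node.prems by simp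
  have tl: "tl (support (rot m) (opp m (a, True))) = concat (map (\<lambda>c. dart c # ups (opp m) (int (length a)) c)
    (rev (map (\<lambda>i. ann (a @ [i]) (us ! i)) [0..<length us])))"
    unfolding op support_node[OF Node.prems] vlist_children[OF Node.prems] by simp
  have ch: "explored m (pathof a @ [opp m (a, True)]) (ann (a @ [i]) (us ! i)) \<and>
      tight m (int (length a) + 1) (ann (a @ [i]) (us ! i))" if i: "i < length us" for i
  proof -
    have "subt t (a @ [i]) = Some (us ! i)" using subt_snoc(1)[OF Node.prems] i by simp
    from Node.IH[OF nth_mem[OF i] this] show ?thesis using op by (simp add: pathof_snoc add.commute)
  qed
  show ?case unfolding ann.simps explored.simps tight.simps tl using ch splits_tight by (auto simp del: map_map)
qed

sublocale explored_map m "[ann [] t]"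
proof
  have op: "opp m ([] @ b, True) = ([] @ b, False)" if "subt t b \<noteq> None" for b using opp_m that by simp
  show "distinct (words (opp m) [ann [] t])" using word_ann(2)[OF op] by simp
  have "set (word (opp m) (ann [] t)) = {([] @ b, x) |b x. subt t b \<noteq> None}" using word_ann(1)[OF op] .
  also have "\<dots> = D" using D_iff by auto
  finally show "set (words (opp m) [ann [] t]) = darts m" by (simp add: m_simps)
  have "up L [] = ups (opp m) (-1) (ann [] t)" using up_ups[of "[]" t] by simp
  then have sup: "support (rot m) (root_dart m) = concat (map (\<lambda>c. dart c # ups (opp m) (-1) c) [ann [] t])"
    using support_root by (simp add: m_simps)
  show "splits (opp m) {} [ann [] t] (support (rot m) (root_dart m))" unfolding sup by (rule splits_tight)
  show "explored m [root_dart m] c" if "c \<in> set [ann [] t]" for c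
    using explored_ann[of "[]" t] that by (simp add: pathof_def m_simps)
qed

end


subsection \<open>Planarity of the closure\<close>

lemma take_eq_length: "take k a = c \<Longrightarrow> take (length c) a = c"
  by (auto simp: min_def)

lemma map_Cons_chain: "map f X = tl X @ [z] \<Longrightarrow> f z = y \<Longrightarrow> X = y # tl X \<Longrightarrow> map f (z # X) = X @ [z]"
  by (metis append_Cons list.simps(9))

locale closing3 = closing +
  assumes ok: "subt t (b @ [i]) = Some s \<Longrightarrow> ok3 (int (length b)) (labels s)"
begin

text \<open>The face permutation while just the leaves of \<open>S\<close> are closed.\<close>

definition "phi S = perm_restrict (clos S) D \<circ> opp m"

lemma phi: "subt t a \<noteq> None \<Longrightarrow> phi S (a, x) = clos S (a, \<not> x)"
  by (simp add: phi_def opp_m perm_restrict_def D_iff)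

context
  fixes pre S assumes L: "L = pre @ S"
begin

lemma S_facts: "distinct (map fst S)" "(a, q) \<in> set S \<Longrightarrow> subt t a = Some (Leaf q)"
  using L_facts(1) L_facts(2)[of a q] L by auto

lemma clos_S:
  "map (clos S) ((c, True) # up S c) = up S c @ [tree_rot t (c, True)]"
  "a \<notin> fst ` set S \<Longrightarrow> clos S (a, False) = tree_rot t (a, False)"
  using clos_chain[of S] S_facts by blast+

lemma up_empty: "(\<And>a q. (a, q) \<in> set S \<Longrightarrow> take (length c) a \<noteq> c) \<Longrightarrow> up S c = []"
  unfolding up_def using take_eq_length by (fastforce simp: filter_empty_conv)

lemma clos_up_empty: "up S c = [] \<Longrightarrow> clos S (c, True) = tree_rot t (c, True)"
  using clos_S(1)[of c] by (simp del: tree_rot.simps)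

text \<open>The contour runs through the children of \<open>b\<close> by decreasing index and then
  returns to \<open>(b, False)\<close>. A leaf glued behind an edge lies below it; as no leaf below
  these children is closed, the step from one child to the next is that of the tree.\<close>

lemma siblings:
  assumes b: "subt t b = Some (Node us)" and n: "n \<le> length us"
    and un: "\<And>j a q. j < n \<Longrightarrow> (a, q) \<in> set S \<Longrightarrow> take (length (b @ [j])) a \<noteq> b @ [j]"
    and ch: "\<And>j. j < n \<Longrightarrow> (b @ [j], False) \<in> orbit (phi S) (b @ [j], True)"
    and j: "j < n"
  shows "(b, False) \<in> orbit (phi S) (b @ [j], True)"
  using j
proof (induction j)
  case (0)
  have "subt t (b @ [0]) \<noteq> None" using subt_snoc(1)[OF b, of 0] 0 n by auto
  then have "phi S (b @ [0], False) = (b, False)"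
    using phi[of "b @ [0]" S False] clos_up_empty[OF up_empty[OF un[OF 0]]] by simp
  then show ?case using orbit.step[OF ch[OF 0]] by simp
next
  case (Suc j)
  have "subt t (b @ [Suc j]) \<noteq> None" using subt_snoc(1)[OF b, of "Suc j"] Suc.prems n by simp
  then have "phi S (b @ [Suc j], False) = (b @ [j], True)"
    using phi[of "b @ [Suc j]" S False] clos_up_empty[OF up_empty[OF un[OF Suc.prems]]] by simp
  then have "(b @ [j], True) \<in> orbit (phi S) (b @ [Suc j], True)" using orbit.step[OF ch[OF Suc.prems]] by simp
  moreover have "(b, False) \<in> orbit (phi S) (b @ [j], True)" using Suc by simp
  ultimately show ?case using orbit_trans by metis
qed

lemma untouched:
  assumes "subt t b = Some s" "\<And>a q. (a, q) \<in> set S \<Longrightarrow> take (length b) a \<noteq> b"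
  shows "(b, False) \<in> orbit (phi S) (b, True)"
  using assms
proof (induction s arbitrary: b)
  case (Leaf q)
  have "b \<notin> fst ` set S" using Leaf.prems(2) by fastforce
  then have "phi S (b, True) = (b, False)"
    using phi[of b S True] Leaf.prems(1) clos_S(2)[of b] tree_rot_leaf[OF Leaf.prems(1)] by simp
  then show ?case using orbit.base by metis
next
  case (Node us)
  have bS: "b \<notin> fst ` set S" using Node.prems(2) by fastforce
  have r: "phi S (b, True) = (if us = [] then (b, False) else (b @ [length us - 1], True))"
    using phi[of b S True] Node.prems(1) clos_S(2)[OF bS] tree_rot_node[OF Node.prems(1)] by simp
  show ?case
  proof (cases "us = []")
    case True
    then show ?thesis using r orbit.base by metis
  next
    case False
    have un: "take (length (b @ [j])) a \<noteq> b @ [j]" if "(a, q) \<in> set S" for a q j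
    proof
      assume "take (length (b @ [j])) a = b @ [j]"
      then have "take (length b) (take (length (b @ [j])) a) = b" by simp
      then show False using Node.prems(2)[OF that] by (simp add: min_def)
    qed
    have ch: "(b @ [j], False) \<in> orbit (phi S) (b @ [j], True)" if "j < length us" for j
    proof (rule Node.IH)
      show "us ! j \<in> set us" using that by simp
      show "subt t (b @ [j]) = Some (us ! j)" using subt_snoc(1)[OF Node.prems(1)] that by simp
    qed (use un in blast)
    have "(b, False) \<in> orbit (phi S) (b @ [length us - 1], True)"
      by (rule siblings[OF Node.prems(1) order_refl]) (use un ch False in auto)
    moreover have "(b @ [length us - 1], True) \<in> orbit (phi S) (b, True)"
      using r False orbit.base[of "phi S" "(b, True)"] by simp
    ultimately show ?thesis using orbit_trans by metis
  qed
qed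

end

text \<open>The face at the leaf climbs towards the root along the path, up to the target corner.
  Nothing closed so far diverts it: the subtrees walked around on the way belong to siblings
  preceding the path, whose leaves are still open, and a back edge glued behind an edge of the path
  is excluded by condition (3).\<close>

lemma leaf_path:
  assumes L: "L = pre @ (a, q) # S" and l: "nat (q + 1) \<le> l" "l \<le> length a"
  shows "(take l a, False) \<in> orbit (phi S) (a, True)"
proof -
  have L': "L = (pre @ [(a, q)]) @ S" using L by simp
  have aL: "subt t a = Some (Leaf q)" using L_facts(2)[of a q] L by simp
  have aS: "a \<notin> fst ` set S" using L_facts(1) L by auto
  have after: "lexless a a'" if "(a', q') \<in> set S" for a' q'
    using leaves_sorted[of t] L that unfolding L_def by (auto simp: sorted_wrt_append)
  have q: "-1 \<le> q" "q < int (length a) - 1" using label[OF aL] by auto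
  show ?thesis
    using l
  proof (induction "length a - l" arbitrary: l)
    case 0
    then have "take l a = a" by simp
    moreover have "phi S (a, True) = (a, False)"
      using phi[of a S True] aL clos_S(2)[OF L' aS] tree_rot_leaf[OF aL] by simp
    ultimately show ?case using orbit.base by metis
  next
    case (Suc n)
    then have lt: "l < length a" by simp
    let ?b = "take l a" and ?i = "a ! l"
    let ?c = "?b @ [?i]"
    have c: "take (Suc l) a = ?c" using lt by (simp add: take_Suc_conv_app_nth)
    have reach: "(?c, False) \<in> orbit (phi S) (a, True)"
      using Suc.hyps(1)[of "Suc l"] Suc.hyps(2) Suc.prems lt unfolding c by simp
    have a': "a = ?b @ ?i # drop (Suc l) a" using id_take_nth_drop[OF lt] .
    have "subt t (?b @ ?i # drop (Suc l) a) \<noteq> None" using aL a' by simp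
    then obtain us where us: "subt t ?b = Some (Node us)" "?i < length us" using subt_prefix by blast
    have sc: "subt t ?c = Some (us ! ?i)" using subt_snoc(1)[OF us(1)] us(2) by simp
    \<comment> \<open>A leaf glued here has label \<open>l\<close>, lies below the same edge and
      comes after \<open>a\<close>; condition (3) would force the label of \<open>a\<close> to be at
      least \<open>l\<close>.\<close>
    have upc: "up S ?c = []"
    proof (rule ccontr)
      assume "up S ?c \<noteq> []"
      then obtain x' q' where x': "(x', q') \<in> set S" "take (nat (q' + 1)) x' = ?c"
        unfolding up_def by (auto simp: filter_empty_conv)
      have x'L: "subt t x' = Some (Leaf q')" using S_facts(2)[OF L' x'(1)] .
      have q': "-1 \<le> q'" "q' < int (length x') - 1" using label[OF x'L] by auto
      have "length (take (nat (q' + 1)) x') = Suc l" using x'(2) lt by simp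
      then have q'l: "q' = int l" using q' by simp
      obtain S1 S2 where S: "S = S1 @ (x', q') # S2" using x'(1) by (meson split_list)
      let ?P = "\<lambda>(b, r::int). take (length ?c) b = ?c"
      have P1: "?P (a, q)" using c lt by simp
      have P2: "?P (x', q')" using take_eq_length[OF x'(2)] by simp
      have "map (\<lambda>(b, r). (?c @ b, r)) (leaves (us ! ?i)) = filter ?P L"
        unfolding L_def using leaves_filter_prefix[OF sc] by simp
      also have "\<dots> = filter ?P pre @ (a, q) # filter ?P S1 @ (x', q') # filter ?P S2"
        unfolding L S using P1 P2 by simp
      finally have "map snd (map (\<lambda>(b, r). (?c @ b, r)) (leaves (us ! ?i))) =
          map snd (filter ?P pre @ (a, q) # filter ?P S1 @ (x', q') # filter ?P S2)" by (rule arg_cong)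
      then have "labels (us ! ?i) = map snd (filter ?P pre) @ q # map snd (filter ?P S1) @ q' # map snd (filter ?P S2)"
        by (simp add: labels_def comp_def case_prod_unfold)
      then obtain A B C where lab: "labels (us ! ?i) = A @ q # B @ q' # C" by blast
      have "ok3 (int (length ?b)) (labels (us ! ?i))" using ok[OF sc] .
      moreover have "length A < length A + length B + 1" "length A + length B + 1 < length (labels (us ! ?i))"
        "labels (us ! ?i) ! (length A + length B + 1) = int (length ?b)" "labels (us ! ?i) ! length A = q"
        unfolding lab using q'l lt by (simp_all add: nth_append)
      ultimately have "int (length ?b) \<le> q" unfolding ok3_def by metis
      then show False using Suc.prems(1) lt q by simp
    qed
    have pc: "phi S (?c, False) = (if ?i = 0 then (?b, False) else (?b @ [?i - 1], True))"
      using phi[of ?c S False] sc clos_up_empty[OF L' upc] tree_rot_child[of ?b ?i] by simp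
    \<comment> \<open>Leaves in \<open>S\<close> come after \<open>a\<close>, whereas the children
      of smaller index carry leaves before \<open>a\<close>.\<close>
    have un: "take (length (?b @ [j])) x \<noteq> ?b @ [j]" if j: "j < ?i" and x: "(x, r) \<in> set S" for x r j
    proof
      assume *: "take (length (?b @ [j])) x = ?b @ [j]"
      have "x = take (length (?b @ [j])) x @ drop (length (?b @ [j])) x" by simp
      then have "x = ?b @ j # drop (length (?b @ [j])) x" unfolding * by simp
      then have "lexless (?b @ ?i # drop (Suc l) a) (?b @ j # drop (length (?b @ [j])) x)"
        using after[OF x] a' by metis
      from lexless_divergeD[OF this] j show False by simp
    qed
    have ch: "(?b @ [j], False) \<in> orbit (phi S) (?b @ [j], True)" if j: "j < ?i" for j
    proof (rule untouched[OF L'])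
      show "subt t (?b @ [j]) = Some (us ! j)" using subt_snoc(1)[OF us(1)] us(2) j by simp
    qed (use un[OF j] in blast)
    show ?case
    proof (cases "?i = 0")
      case True
      then show ?thesis using orbit.step[OF reach] pc by simp
    next
      case False
      then have "(?b, False) \<in> orbit (phi S) (?b @ [?i - 1], True)"
        using siblings[OF L' us(1), of ?i "?i - 1"] us(2) un ch by simp
      moreover have "(?b @ [?i - 1], True) \<in> orbit (phi S) (a, True)"
        using orbit.step[OF reach] pc False by simp
      ultimately show ?thesis using orbit_trans by metis
    qed
  qed
qed

lemma tree_perm_ann:
  "subt t a = Some s \<Longrightarrow> tree_perm (opp m) (perm_restrict (tree_rot t) D) (ann a s)"
proof (induction s arbitrary: a)
  case (Leaf q)
  then show ?case using opp_m[of a True] tree_rot_leaf[OF Leaf] D_iff by (simp add: perm_restrict_def del: tree_rot.simps)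
next
  case (Node us)
  let ?r = "perm_restrict (tree_rot t) D" and ?n = "length us"
  have op: "opp m (a, True) = (a, False)" using opp_m Node.prems by simp
  have rD: "?r (b, x) = tree_rot t (b, x)" if "subt t b \<noteq> None" for b x using that D_iff by (simp add: perm_restrict_def)
  have ch: "subt t (a @ [i]) = Some (us ! i)" if "i < ?n" for i using subt_snoc(1)[OF Node.prems] that by simp
  let ?x = "\<lambda>i. (a @ [i], True)"
  have d: "map dart (rev (map (\<lambda>i. ann (a @ [i]) (us ! i)) [0..<?n])) = map ?x (rev [0..<?n])"
    by (simp add: rev_map comp_def)
  have "map ?r ((a, False) # map ?x (rev [0..<?n])) = map ?x (rev [0..<?n]) @ [(a, False)]"
  proof (cases "us = []")
    case True
    then show ?thesis using rD[of a False] Node.prems tree_rot_node[OF Node.prems] by simp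
  next
    case False
    then have n: "?n > 0" by simp
    then obtain k where k: "?n = Suc k" by (cases ?n) auto
    have "map ?r (map ?x (rev [0..<?n])) = map (\<lambda>i. tree_rot t (?x i)) (rev [0..<?n])"
      unfolding map_map comp_def by (rule map_cong[OF refl]) (use rD ch in simp)
    also have "\<dots> = tl (map ?x (rev [0..<?n])) @ [(a, False)]" using tree_rot_siblings[OF n] .
    finally have "map ?r (map ?x (rev [0..<?n])) = tl (map ?x (rev [0..<?n])) @ [(a, False)]" .
    moreover have "?r (a, False) = (a @ [?n - 1], True)"
      using rD[of a False] Node.prems tree_rot_node[OF Node.prems] False by simp
    moreover have "map ?x (rev [0..<?n]) = (a @ [?n - 1], True) # tl (map ?x (rev [0..<?n]))" using k by simp
    ultimately show ?thesis by (rule map_Cons_chain)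
  qed
  then have "map ?r (opp m (a, True) # map dart (rev (map (\<lambda>i. ann (a @ [i]) (us ! i)) [0..<?n]))) =
      map dart (rev (map (\<lambda>i. ann (a @ [i]) (us ! i)) [0..<?n])) @ [opp m (a, True)]"
    unfolding d op .
  moreover have "tree_perm (opp m) ?r c" if "c \<in> set (rev (map (\<lambda>i. ann (a @ [i]) (us ! i)) [0..<?n]))" for c
    using that Node.IH ch by auto
  ultimately show ?case unfolding ann.simps tree_perm.simps by blast
qed

lemma phi_Nil: "phi [] permutes D" "ncyc (phi []) D = 1"
proof -
  let ?r = "perm_restrict (tree_rot t) D"
  have phi0: "phi [] = ?r \<circ> opp m" by (simp add: phi_def clos_def)
  have "cyc ?r (map dart [ann [] t])" using D_iff[of "[]"] by (simp add: cyc_def perm_restrict_def)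
  then have c: "cyc (phi []) W" unfolding phi0 W_def
    using tree_perm_cyc[of "opp m" "[ann [] t]" ?r, OF opp_opp _ _ distinct_W] tree_perm_ann[of "[]" t] by simp
  have W: "set W = D" using set_W' by (simp add: m_simps)
  have "perm_restrict (phi []) D permutes D"
    by (rule cyc_permutes[OF _ finite_D]) (use c W in auto)
  moreover have "perm_restrict (phi []) D = phi []"
    by (auto simp: fun_eq_iff perm_restrict_def phi_def m_simps)
  ultimately show "phi [] permutes D" by simp
  have "orbit (phi []) x = D" if "x \<in> D" for x using cyc_orbit[OF c, of x] that W by simp
  moreover have "D \<noteq> {}" using root_in by (auto simp: m_simps)
  ultimately have "orbit (phi []) ` D = {D}" by blast
  then show "ncyc (phi []) D = 1" by (simp add: ncyc_def)
qed

text \<open>By \<open>leaf_path\<close> the leaf and its target corner are on one face, so each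
  closing splits a face (\<open>ncyc_split\<close>), starting from the single face of the
  tree.\<close>

lemma ncyc_phi: "L = pre @ S \<Longrightarrow> phi S permutes D \<and> ncyc (phi S) D = Suc (length S)"
proof (induction S arbitrary: pre)
  case Nil
  then show ?case using phi_Nil by simp
next
  case (Cons x S)
  obtain a q where x: "x = (a, q)" by (cases x)
  have L: "L = pre @ (a, q) # S" using Cons.prems x by simp
  have L': "L = (pre @ [x]) @ S" using Cons.prems by simp
  have IH: "phi S permutes D" "ncyc (phi S) D = Suc (length S)" using Cons.IH[OF L'] by auto
  have aL: "subt t a = Some (Leaf q)" using L_facts(2)[of a q] L by simp
  have aS: "a \<notin> fst ` set S" using L_facts(1) L by auto
  have q: "-1 \<le> q" "q < int (length a) - 1" using label[OF aL] by auto
  let ?c = "take (nat (q + 1)) a"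
  have lt: "nat (q + 1) < length a" using q by simp
  have "subt t (?c @ drop (nat (q + 1)) a) \<noteq> None" using aL by simp
  then have cV: "subt t ?c \<noteq> None" unfolding subt_append by (auto split: option.splits)
  \<comment> \<open>The end \<open>(a, False)\<close> is still a fixed point, so the two updates of
    \<open>close_leaf\<close> amount to composition with a transposition.\<close>
  have fx: "clos S (a, False) = (a, False)"
    using clos_S(2)[OF L' aS] tree_rot_leaf[OF aL] by simp
  have "clos (x # S) = (clos S)((?c, True) := (a, False), (a, False) := clos S (?c, True))"
    by (simp add: clos_def x Let_def)
  also have "\<dots> = clos S \<circ> transpose (?c, True) (a, False)"
    using fx by (auto simp: fun_eq_iff transpose_def)
  finally have "perm_restrict (clos (x # S)) D = perm_restrict (clos S) D \<circ> transpose (?c, True) (a, False)"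
    using cV aL by (auto simp: fun_eq_iff perm_restrict_def transpose_def D_iff)
  then have "phi (x # S) = (perm_restrict (clos S) D \<circ> transpose (?c, True) (a, False)) \<circ> opp m"
    unfolding phi_def by simp
  also have "\<dots> = phi S \<circ> transpose (opp m (?c, True)) (opp m (a, False))"
    unfolding phi_def by (rule removed_comp_opp)
  also have "\<dots> = phi S \<circ> transpose (a, True) (?c, False)"
    using opp_m cV aL by (simp add: transpose_commute)
  finally have eq: "phi (x # S) = phi S \<circ> transpose (a, True) (?c, False)" .
  have D: "(a, True) \<in> D" "(?c, False) \<in> D" using D_iff aL cV by auto
  have "(?c, False) \<in> orbit (phi S) (a, True)" using leaf_path[OF L order_refl] lt by simp
  from ncyc_split[OF IH(1) finite_D D(1) this] IH(2) have "ncyc (phi (x # S)) D = Suc (length (x # S))"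
    unfolding eq by simp
  moreover have "phi (x # S) permutes D" unfolding eq using permutes_comp_transpose[OF IH(1) D] .
  ultimately show ?case by blast
qed

lemma planar_closure: "planar_map m"
proof -
  have "phi L = rot m \<circ> opp m" by (simp add: phi_def m_simps)
  then have "ncyc (rot m \<circ> opp m) (darts m) = Suc (length L)" using ncyc_phi[of "[]" L] by (simp add: m_simps)
  moreover have "card LD = length L" unfolding card_LD by (simp add: aleaves_ann L_def)
  ultimately show ?thesis using planar_map_iff[OF rooted] by simp
qed

end


lemma decorated_closing3:
  assumes "decorated t"
  shows "closing3 t"
proof unfold_locales
  show "\<exists>ts. t = Node ts" using assms unfolding decorated_iff by blast
next
  fix a q assume a: "subt t a = Some (Leaf q)"
  have "a \<noteq> []" using a assms unfolding decorated_iff by auto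
  then obtain b i where b: "a = b @ [i]" by (metis rev_exhaust)
  have "(b @ [i], Leaf q) \<in> set (subtrees t)" using a b subtrees_subt by simp
  then have "q < int (length b)" using assms unfolding decorated_def by blast
  moreover have "q \<in> set (labels t)" unfolding set_labels subtrees_subt using a by blast
  then have "-1 \<le> q" using assms unfolding decorated_def by (elim conjE) blast
  ultimately show "-1 \<le> q \<and> q < int (length a) - 1" using b by simp
next
  fix b i s assume "subt t (b @ [i]) = Some s"
  then have "(b @ [i], s) \<in> set (subtrees t)" using subtrees_subt by simp
  then show "ok3 (int (length b)) (labels s)" using assms unfolding decorated_def ok3_def by blast
qed

lemma closure_map_props:
  assumes "decorated t"
  shows "explored_map (closure_map t) [ann [] t]" "tight (closure_map t) 0 (ann [] t)"
    "support (rot (closure_map t)) (root_dart (closure_map t)) =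
       root_dart (closure_map t) # ups (opp (closure_map t)) (-1) (ann [] t)"
    "planar_map (closure_map t)" "\<not> separable (closure_map t)"
    "card (edges (closure_map t)) = card (tree_vertices t)"
proof -
  interpret closing3 t using decorated_closing3[OF assms] .
  have m: "closure_map t = m" by (simp add: m_def)
  show "explored_map (closure_map t) [ann [] t]" unfolding m by unfold_locales
  show "tight (closure_map t) 0 (ann [] t)" unfolding m using explored_ann[of "[]" t] by simp
  show "support (rot (closure_map t)) (root_dart (closure_map t)) =
       root_dart (closure_map t) # ups (opp (closure_map t)) (-1) (ann [] t)"
    unfolding m using support_root up_ups[of "[]" t] by (simp add: m_simps(4) del: m_simps(2,3))
  show "planar_map (closure_map t)" unfolding m by (rule planar_closure)
  show "\<not> separable (closure_map t)"
    unfolding m by (rule decorated_not_separable[of "ann [] t"]) (simp_all add: assms)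
  have V: "tree_vertices t = {b. subt t b \<noteq> None}" using tree_vertices_subt by blast
  have "LD \<union> ND = {([] @ b, True) |b. subt t b \<noteq> None}"
    unfolding LD_def ND_def using darts_ann[of "[]" t] by simp
  also have "\<dots> = (\<lambda>b. (b, True)) ` tree_vertices t" unfolding V by auto
  finally have "card (LD \<union> ND) = card (tree_vertices t)" by (simp add: card_image inj_on_def)
  moreover have "card (LD \<union> ND) = card LD + card ND"
    using LD_ND(1) by (intro card_Un_disjoint) (auto simp: LD_def ND_def)
  moreover have "card ND = length (fnodes [ann [] t])"
    unfolding ND_def using distinct_card[OF distinct_words_darts(2)[OF distinct_W]] .
  ultimately show "card (edges (closure_map t)) = card (tree_vertices t)"
    unfolding m card_edges card_LD by simp
qed


section \<open>Isomorphisms\<close>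

text \<open>Since the length of a contour depends only on the shape, matching two contours position
  by position matches corresponding subtrees.\<close>

lemma erase_length_word: "erase c = erase c' \<Longrightarrow> length (word op c) = length (word op' c')"
proof (induction c arbitrary: c')
  case (AL d q)
  then show ?case by (cases c') auto
next
  case (AN d ts)
  then obtain d' ts' where c': "c' = AN d' ts'" by (cases c') auto
  then have e: "map erase ts = map erase ts'" using AN.prems by simp
  then have l: "length ts = length ts'" by (metis length_map)
  have "map (length \<circ> word op) ts = map (length \<circ> word op') ts'"
  proof (rule nth_equalityI)
    fix i assume "i < length (map (length \<circ> word op) ts)"
    then have i: "i < length ts" by simp
    then have "erase (ts ! i) = erase (ts' ! i)" using e l by (metis nth_map)
    then show "map (length \<circ> word op) ts ! i = map (length \<circ> word op') ts' ! i"
      using AN.IH[OF nth_mem[OF i]] i l by simp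
  qed (simp add: l)
  then show ?case using c' by (simp add: length_concat comp_def)
qed

lemma erase_children:
  assumes "erase (AN d ts) = erase c'" "map f (word op (AN d ts)) = word op' c'"
  shows "\<exists>d' ts'. c' = AN d' ts' \<and> f d = d' \<and> f (op d) = op' d' \<and> length ts = length ts' \<and>
    (\<forall>i<length ts. erase (ts ! i) = erase (ts' ! i) \<and> map f (word op (ts ! i)) = word op' (ts' ! i))"
proof -
  obtain d' ts' where c': "c' = AN d' ts'" using assms(1) by (cases c') auto
  then have e: "map erase ts = map erase ts'" using assms(1) by simp
  then have l: "length ts = length ts'" by (metis length_map)
  have ei: "erase (ts ! i) = erase (ts' ! i)" if "i < length ts" for i using e l that by (metis nth_map)
  have "f d # map f (words op ts) @ [f (op d)] = d' # words op' ts' @ [op' d']" using assms(2) c' by simp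
  then have 1: "f d = d'" "map f (words op ts) = words op' ts'" "f (op d) = op' d'" by auto
  have "concat (map (\<lambda>c. map f (word op c)) ts) = concat (map (word op') ts')"
    using 1(2) by (simp add: map_concat comp_def)
  moreover have "\<forall>(x, y)\<in>set (zip (map (\<lambda>c. map f (word op c)) ts) (map (word op') ts')). length x = length y"
    using ei l erase_length_word[where op = op and op' = op'] by (auto simp: set_zip)
  ultimately have "map (\<lambda>c. map f (word op c)) ts = map (word op') ts'"
    using concat_eq_concat_iff[of "map (\<lambda>c. map f (word op c)) ts" "map (word op') ts'"] l by simp
  then have "map f (word op (ts ! i)) = word op' (ts' ! i)" if "i < length ts" for i
    using that l by (metis nth_map)
  then show ?thesis using c' 1 l ei by blast
qed

lemma erase_dart:
  assumes "erase c = erase c'" "map f (word op c) = word op' c'"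
  shows "f (dart c) = dart c'"
  using assms hd_word[of op c] hd_word[of op' c'] by auto

text \<open>The positions of the two darts of an edge in the contour depend only on the
  shape.\<close>

lemma erase_opp:
  assumes "\<And>d. op (op d) = d" "\<And>d. op' (op' d) = d"
    and "erase c = erase c'" "map f (word op c) = word op' c'" "y \<in> set (word op c)"
  shows "f (op y) = op' (f y)"
  using assms(3-5)
proof (induction c arbitrary: c')
  case (AL d q)
  then obtain d' where "c' = AL d' q" by (cases c') auto
  then show ?case using AL assms(1,2) by auto
next
  case (AN d ts)
  from erase_children[OF AN.prems(1,2)] obtain d' ts' where
    c': "c' = AN d' ts'" "f d = d'" "f (op d) = op' d'" "length ts = length ts'"
    "\<And>i. i < length ts \<Longrightarrow> erase (ts ! i) = erase (ts' ! i) \<and> map f (word op (ts ! i)) = word op' (ts' ! i)"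
    by blast
  consider "y = d" | "y = op d" | c where "c \<in> set ts" "y \<in> set (word op c)"
    using AN.prems(3) by auto
  then show ?case
  proof cases
    case 3
    then obtain i where "i < length ts" "c = ts ! i" by (metis in_set_conv_nth)
    then show ?thesis using AN.IH[OF 3(1)] 3(2) c'(5) by blast
  qed (use c' assms(1,2) in auto)
qed

lemma erase_aleaves:
  assumes "erase c = erase c'" "map f (word op c) = word op' c'"
  shows "aleaves c' = map (\<lambda>(d, q). (f d, q)) (aleaves c)"
  using assms
proof (induction c arbitrary: c')
  case (AL d q)
  then show ?case by (cases c') auto
next
  case (AN d ts)
  from erase_children[OF AN.prems] obtain d' ts' where
    c': "c' = AN d' ts'" "length ts = length ts'"
    "\<And>i. i < length ts \<Longrightarrow> erase (ts ! i) = erase (ts' ! i) \<and> map f (word op (ts ! i)) = word op' (ts' ! i)"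
    by blast
  have "map aleaves ts' = map (\<lambda>c. map (\<lambda>(d, q). (f d, q)) (aleaves c)) ts"
  proof (rule nth_equalityI)
    fix i assume "i < length (map aleaves ts')"
    then have i: "i < length ts" using c'(2) by simp
    then show "map aleaves ts' ! i = map (\<lambda>c. map (\<lambda>(d, q). (f d, q)) (aleaves c)) ts ! i"
      using AN.IH[OF nth_mem[OF i], of "ts' ! i"] c'(2) c'(3)[OF i] by simp
  qed (simp add: c')
  then have "rev (map aleaves ts') = rev (map (\<lambda>c. map (\<lambda>(d, q). (f d, q)) (aleaves c)) ts)" by simp
  then show ?case unfolding c'(1) aleaves.simps rev_map[symmetric] map_concat by (simp add: rev_map comp_def)
qed

lemma erase_ups:
  assumes "\<And>d. op (op d) = d" "\<And>d. op' (op' d) = d"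
    and "erase c = erase c'" "map f (word op c) = word op' c'"
  shows "ups op' p c' = map f (ups op p c)"
proof -
  have "ups op' p c' = map (\<lambda>x. op' (f (fst x))) (filter (\<lambda>(d, q). q = p) (aleaves c))"
    unfolding ups_def erase_aleaves[OF assms(3,4)] by (simp add: filter_map comp_def case_prod_unfold)
  also have "\<dots> = map (\<lambda>x. f (op (fst x))) (filter (\<lambda>(d, q). q = p) (aleaves c))"
  proof (rule map_cong[OF refl])
    fix x assume "x \<in> set (filter (\<lambda>(d, q). q = p) (aleaves c))"
    then have "fst x \<in> set (word op c)" unfolding set_word_eq by auto
    from erase_opp[OF assms this] show "op' (f (fst x)) = f (op (fst x))" by simp
  qed
  finally show ?thesis by (simp add: ups_def comp_def)
qed

text \<open>Under \<open>tight\<close> the darts around an internal vertex are composed of child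
  darts and ends of back edges, and \<open>f\<close> transports both (\<open>erase_dart\<close>,
  \<open>erase_ups\<close>).\<close>

lemma tight_support:
  assumes "\<And>d. opp m (opp m d) = d" "\<And>d. opp m' (opp m' d) = d"
    and "\<And>d. support (rot m) d = d # tl (support (rot m) d)" "\<And>d. support (rot m') d = d # tl (support (rot m') d)"
    and "erase c = erase c'" "map f (word (opp m) c) = word (opp m') c'" "tight m p c" "tight m' p c'"
    and "d \<in> set (ndarts c)"
  shows "map f (support (rot m) (opp m d)) = support (rot m') (f (opp m d))"
  using assms(5-9)
proof (induction c arbitrary: c' p)
  case (AN e ts)
  from erase_children[OF AN.prems(1,2)] obtain e' ts' where
    c': "c' = AN e' ts'" "f e = e'" "f (opp m e) = opp m' e'" "length ts = length ts'"
    "\<And>i. i < length ts \<Longrightarrow> erase (ts ! i) = erase (ts' ! i) \<and> map f (word (opp m) (ts ! i)) = word (opp m') (ts' ! i)"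
    by blast
  show ?case
  proof (cases "d = e")
    case True
    let ?g = "\<lambda>c. dart c # ups (opp m) p c" and ?g' = "\<lambda>c. dart c # ups (opp m') p c"
    have "map (\<lambda>c. map f (?g c)) ts = map ?g' ts'"
    proof (rule nth_equalityI)
      fix i assume "i < length (map (\<lambda>c. map f (?g c)) ts)"
      then have i: "i < length ts" by simp
      then show "map (\<lambda>c. map f (?g c)) ts ! i = map ?g' ts' ! i"
        using c'(4) c'(5)[of i] erase_dart[of "ts ! i" "ts' ! i" f "opp m" "opp m'"]
          erase_ups[OF assms(1,2), of "ts ! i" "ts' ! i" f p] by simp
    qed (simp add: c')
    then have "map f (concat (map ?g ts)) = concat (map ?g' ts')" by (simp add: map_concat comp_def)
    moreover have "tl (support (rot m) (opp m e)) = concat (map ?g ts)"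
      "tl (support (rot m') (opp m' e')) = concat (map ?g' ts')" using AN.prems(3,4) c'(1) by auto
    ultimately have "map f (tl (support (rot m) (opp m e))) = tl (support (rot m') (opp m' e'))" by simp
    then have "map f (opp m e # tl (support (rot m) (opp m e))) = opp m' e' # tl (support (rot m') (opp m' e'))"
      using c'(3) by (simp only: list.map)
    then show ?thesis using True c'(3) assms(3)[of "opp m e"] assms(4)[of "opp m' e'"] by metis
  next
    case False
    then obtain c where "c \<in> set ts" "d \<in> set (ndarts c)" using AN.prems(5) by auto
    moreover then obtain i where i: "i < length ts" "c = ts ! i" by (metis in_set_conv_nth)
    moreover have "tight m (p + 1) c" "tight m' (p + 1) (ts' ! i)" using AN.prems(3,4) c'(1,4) i by auto
    ultimately show ?thesis using AN.IH[of c "ts' ! i" "p + 1"] c'(5)[OF i(1)] by simp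
  qed
qed simp

text \<open>The contour accounts for the darts and their opposites, and tightness together with the
  list at \<open>v\<close> for the rotation; so the tree alone determines the map up to
  isomorphism.\<close>

lemma tight_iso:
  assumes m: "explored_map m [\<tau>]" and m': "explored_map m' [\<tau>']" and e: "erase \<tau> = erase \<tau>'"
    and t: "tight m 0 \<tau>" "tight m' 0 \<tau>'"
    and s: "support (rot m) (root_dart m) = root_dart m # ups (opp m) (-1) \<tau>"
      "support (rot m') (root_dart m') = root_dart m' # ups (opp m') (-1) \<tau>'"
  shows "\<exists>f. map_iso f m m'"
proof -
  interpret A: explored_map m "[\<tau>]" by (rule m)
  interpret B: explored_map m' "[\<tau>']" by (rule m')
  let ?w = "word (opp m) \<tau>" and ?w' = "word (opp m') \<tau>'"
  have len: "length ?w = length ?w'" using erase_length_word[OF e] .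
  have dw: "distinct ?w" "distinct ?w'" using A.distinct_W B.distinct_W by auto
  have sw: "set ?w = darts m" "set ?w' = darts m'" using A.set_W B.set_W by auto
  define f where "f y = the (map_of (zip ?w ?w') y)" for y
  have fw: "map f ?w = ?w'"
    by (rule nth_equalityI) (use len dw in \<open>auto simp: f_def map_of_zip_nth\<close>)
  have "f ` darts m = darts m'" using fw sw by (metis list.set_map)
  moreover have "inj_on f (darts m)" using fw dw sw by (metis distinct_map)
  ultimately have bij: "bij_betw f (darts m) (darts m')" by (simp add: bij_betw_def)
  have opp: "f (opp m y) = opp m' (f y)" if "y \<in> darts m" for y
    using erase_opp[OF A.opp_opp B.opp_opp e fw] that sw by simp
  have dr: "dart \<tau> = root_dart m" "dart \<tau>' = root_dart m'" using A.root_first B.root_first by auto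
  have root: "f (root_dart m) = root_dart m'" using erase_dart[OF e fw] dr by simp
  have list: "map f (support (rot m) d) = support (rot m') (f d)" if d: "d \<in> A.EN" for d
  proof (cases "d = root_dart m")
    case True
    then show ?thesis using s root erase_ups[OF A.opp_opp B.opp_opp e fw, of "-1"] by simp
  next
    case False
    then obtain d' where "d = opp m d'" "d' \<in> set (ndarts \<tau>)" using d by (auto simp: A.EN_def A.ND_def)
    then show ?thesis
      using tight_support[OF A.opp_opp B.opp_opp A.support_rot_Cons B.support_rot_Cons e fw t] by simp
  qed
  \<comment> \<open>Each rotation acts on the list around a vertex as \<open>rotate1\<close>, and
    \<open>f\<close> carries one list to the other.\<close>
  have rot: "f (rot m y) = rot m' (f y)" if y: "y \<in> darts m" for y
  proof -
    have "vertex m y \<in> vertex m ` A.EN" using A.vertices_eq y unfolding vertices_def by blast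
    then obtain d where d: "d \<in> A.EN" "vertex m y = vertex m d" by blast
    let ?l = "support (rot m) d"
    have yl: "y \<in> set ?l" using d(2) A.vertex_self A.vertex_eq_support by metis
    have "map (rot m') (map f ?l) = rotate1 (map f ?l)"
      unfolding list[OF d(1)] using B.cyc_support_rot by (simp only: cyc_def)
    also have "\<dots> = map f (rotate1 ?l)" by (rule rotate1_map)
    also have "rotate1 ?l = map (rot m) ?l" using A.cyc_support_rot[of d] by (simp only: cyc_def)
    finally have "map (\<lambda>z. rot m' (f z)) ?l = map (\<lambda>z. f (rot m z)) ?l" by (simp only: map_map comp_def)
    then show ?thesis using yl by (metis (no_types, lifting) map_eq_conv)
  qed
  show ?thesis unfolding map_iso_def using bij rot opp root by blast
qed

section \<open>Invariance under isomorphism\<close>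

lemma map_iso_trans: "map_iso f a b \<Longrightarrow> map_iso g b c \<Longrightarrow> map_iso (g \<circ> f) a c"
  unfolding map_iso_def using bij_betw_trans[of f "darts a" "darts b" g "darts c"]
  by (auto dest: bij_betwE)

lemma map_iso_sym:
  assumes m: "rooted_map m" and iso: "map_iso f m m'"
  shows "map_iso (inv_into (darts m) f) m' m"
proof -
  let ?g = "inv_into (darts m) f"
  have inj: "inj_on f (darts m)" and im: "f ` darts m = darts m'" using iso by (auto simp: map_iso_def bij_betw_def)
  have gf: "?g (f d) = d" if "d \<in> darts m" for d using inv_into_f_f[OF inj that] .
  have "?g (rot m' d') = rot m (?g d') \<and> ?g (opp m' d') = opp m (?g d')" if d': "d' \<in> darts m'" for d'
  proof -
    obtain d where d: "d \<in> darts m" "d' = f d" using d' unfolding im[symmetric] by (elim imageE)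
    note i = iso_facts[OF m iso]
    have "rot m' d' = f (rot m d)" "opp m' d' = f (opp m d)" using i(2,3)[OF d(1)] d(2) by auto
    then show ?thesis using gf i(4,5)[OF d(1)] d by simp
  qed
  moreover have "?g (root_dart m') = root_dart m"
    using iso gf premap.root_in[OF rooted_map_premap[OF m]] unfolding map_iso_def by metis
  moreover have "bij_betw ?g (darts m') (darts m)" using iso by (simp add: map_iso_def bij_betw_inv_into)
  ultimately show ?thesis unfolding map_iso_def by blast
qed

lemma iso_class_eq:
  assumes "rooted_map m" "map_iso f m m'"
  shows "iso_class m = iso_class m'"
proof -
  have "(\<exists>g. map_iso g m x) \<longleftrightarrow> (\<exists>g. map_iso g m' x)" for x :: "nat cmap"
    using map_iso_trans[OF assms(2)] map_iso_trans[OF map_iso_sym[OF assms]] by blast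
  then show ?thesis by (simp add: iso_class_def)
qed

lemma edges_iso:
  assumes "rooted_map m" "map_iso f m m'"
  shows "edges m' = (`) f ` edges m"
proof -
  have im: "darts m' = f ` darts m" using assms(2) by (auto simp: map_iso_def bij_betw_def)
  have "(\<lambda>d. {d, opp m' d}) ` f ` darts m = (`) f ` (\<lambda>d. {d, opp m d}) ` darts m"
    unfolding image_image
    by (rule image_cong[OF refl]) (simp add: iso_facts(3)[OF assms])
  then show ?thesis by (simp add: edges_def im)
qed

lemma edges_sub: "rooted_map m \<Longrightarrow> edges m \<subseteq> Pow (darts m)"
  by (auto simp: edges_def rooted_map_def permutes_in_image)

lemma vertices_sub: "rooted_map m \<Longrightarrow> vertices m \<subseteq> Pow (darts m)"
proof
  fix x assume m: "rooted_map m" and "x \<in> vertices m"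
  then obtain d where "d \<in> darts m" "x = vertex m d" unfolding vertices_def by (elim imageE)
  then show "x \<in> Pow (darts m)" using premap.vertex_sub[OF rooted_map_premap[OF m]] by simp
qed

lemma card_iso_image:
  assumes "map_iso f m m'" "A \<subseteq> Pow (darts m)"
  shows "card ((`) f ` A) = card A" "inj_on ((`) f) A"
proof -
  have "inj_on f (darts m)" using assms(1) by (auto simp: map_iso_def bij_betw_def)
  then show "inj_on ((`) f) A" using inj_on_image_Pow inj_on_subset assms(2) by blast
  then show "card ((`) f ` A) = card A" by (rule card_image)
qed

lemma card_edges_iso: "rooted_map m \<Longrightarrow> map_iso f m m' \<Longrightarrow> card (edges m') = card (edges m)"
  using edges_iso card_iso_image(1) edges_sub by metis

lemma vertices_iso:
  assumes "rooted_map m" "map_iso f m m'"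
  shows "vertices m' = (`) f ` vertices m"
proof -
  have im: "darts m' = f ` darts m" using assms(2) by (auto simp: map_iso_def bij_betw_def)
  show ?thesis unfolding vertices_def im image_image
    by (rule image_cong[OF refl]) (simp add: vertex_iso[OF assms])
qed

lemma faces_iso:
  assumes "rooted_map m" "map_iso f m m'"
  shows "faces m' = (`) f ` faces m" "faces m \<subseteq> Pow (darts m)"
proof -
  interpret premap m using rooted_map_premap[OF assms(1)] .
  have im: "darts m' = f ` darts m" using assms(2) by (auto simp: map_iso_def bij_betw_def)
  have p: "rot m \<circ> opp m permutes darts m" using opp_permutes rot_permutes by (rule permutes_compose)
  then have perm: "permutation (rot m \<circ> opp m)" using finite_darts permutes_permutation by blast
  have o: "orbit (rot m \<circ> opp m) d \<subseteq> darts m" if "d \<in> darts m" for d using permutes_orbit_subset[OF p that] .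
  then show "faces m \<subseteq> Pow (darts m)" by (auto simp: faces_def)
  have "f ` orbit (rot m \<circ> opp m) d = orbit (rot m' \<circ> opp m') (f d)" if d: "d \<in> darts m" for d
  proof (rule orbit_inverse)
    show "d \<in> orbit (rot m \<circ> opp m) d" using permutation_self_in_orbit[OF perm] .
    fix x assume "x \<in> orbit (rot m \<circ> opp m) d"
    then have "x \<in> darts m" using o[OF d] by blast
    then show "(rot m' \<circ> opp m') (f x) = f ((rot m \<circ> opp m) x)" using iso_facts[OF assms] by simp
  qed
  then show "faces m' = (`) f ` faces m" unfolding faces_def im image_image by simp
qed

lemma separable_iso:
  assumes "rooted_map m" "map_iso f m m'" "separable m'"
  shows "separable m"
proof -
  obtain E1 E2 where E: "E1 \<noteq> {}" "E2 \<noteq> {}" "E1 \<inter> E2 = {}" "E1 \<union> E2 = edges m'"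
    and un: "\<exists>!v. v \<in> vertices m' \<and> incident v E1 \<and> incident v E2"
    using assms(3) unfolding separable_def by (elim exE conjE)
  have inj: "inj_on f (darts m)" using assms(2) by (auto simp: map_iso_def bij_betw_def)
  define F where "F X = {e \<in> edges m. f ` e \<in> X}" for X
  have FE: "(`) f ` F X = X" if "X \<subseteq> edges m'" for X
    using that unfolding F_def edges_iso[OF assms(1,2)] by auto
  have inc: "incident (f ` v) X \<longleftrightarrow> incident v (F X)" if v: "v \<subseteq> darts m" and X: "X \<subseteq> edges m'" for v X
  proof
    assume "incident (f ` v) X"
    then obtain e' where e': "e' \<in> X" "f ` v \<inter> e' \<noteq> {}" unfolding incident_def by (elim bexE)
    then have "e' \<in> (`) f ` F X" using FE[OF X] by simp
    then obtain e where e: "e \<in> F X" "e' = f ` e" by (elim imageE)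
    have "e \<subseteq> darts m" using e(1) edges_sub[OF assms(1)] by (auto simp: F_def)
    then have "f ` v \<inter> f ` e = f ` (v \<inter> e)" using inj_on_image_Int[OF inj v] by simp
    then have "v \<inter> e \<noteq> {}" using e'(2) e(2) by auto
    then show "incident v (F X)" unfolding incident_def using e(1) by (rule bexI)
  next
    assume "incident v (F X)"
    then obtain e where e: "e \<in> F X" "v \<inter> e \<noteq> {}" unfolding incident_def by (elim bexE)
    have "f ` e \<in> X" using e(1) by (simp add: F_def)
    moreover have "f ` v \<inter> f ` e \<noteq> {}" using e(2) by auto
    ultimately show "incident (f ` v) X" unfolding incident_def by (intro bexI)
  qed
  have sub: "E1 \<subseteq> edges m'" "E2 \<subseteq> edges m'" using E(4) by auto
  have "F E1 \<noteq> {}" "F E2 \<noteq> {}" using FE[OF sub(1)] FE[OF sub(2)] E(1,2) by auto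
  moreover have "F E1 \<inter> F E2 = {}" using E(3) by (auto simp: F_def)
  moreover have "F E1 \<union> F E2 = edges m" using E(4) unfolding edges_iso[OF assms(1,2)] by (auto simp: F_def)
  moreover have "\<exists>!v. v \<in> vertices m \<and> incident v (F E1) \<and> incident v (F E2)"
  proof -
    obtain x where x: "x \<in> vertices m'" "incident x E1" "incident x E2" using un by (elim ex1E conjE)
    then obtain v where v: "v \<in> vertices m" "x = f ` v" unfolding vertices_iso[OF assms(1,2)] by (elim imageE)
    have vs: "u \<subseteq> darts m" if "u \<in> vertices m" for u using that vertices_sub[OF assms(1)] by auto
    show ?thesis
    proof (rule ex1I[of _ v])
      show "v \<in> vertices m \<and> incident v (F E1) \<and> incident v (F E2)"
        using x v inc[OF vs[OF v(1)]] sub by simp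
      fix u assume u: "u \<in> vertices m \<and> incident u (F E1) \<and> incident u (F E2)"
      then have "f ` u \<in> vertices m' \<and> incident (f ` u) E1 \<and> incident (f ` u) E2"
        using inc[OF vs] sub unfolding vertices_iso[OF assms(1,2)] by simp
      then have "f ` u = f ` v" using un x v(2) by (metis (no_types, lifting))
      then show "u = v" using inj_on_image_eq_iff[OF inj] vs u v(1) by simp
    qed
  qed
  ultimately show ?thesis unfolding separable_def by (intro exI[of _ "F E1"] exI[of _ "F E2"] conjI)
qed

text \<open>The darts of the closure are pairs built from addresses, whereas isomorphism classes
  consist of maps on \<open>nat\<close>; the copy provides a representative.\<close>

lemma nat_copy:
  fixes m :: "'d cmap"
  assumes m: "rooted_map m"
  shows "\<exists>f (m' :: nat cmap). map_iso f m m' \<and> rooted_map m'"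
proof -
  interpret premap m using rooted_map_premap[OF m] .
  let ?D = "darts m"
  obtain f :: "'d \<Rightarrow> nat" where inj: "inj_on f ?D" using finite_imp_inj_to_nat_seg[OF finite_darts] by blast
  let ?g = "inv_into ?D f"
  have gf: "?g (f d) = d" if "d \<in> ?D" for d using inv_into_f_f[OF inj that] .
  \<comment> \<open>Outside the image the copy of a permutation is the identity, as
    \<open>permutes\<close> requires.\<close>
  define tr where "tr p x = (if x \<in> f ` ?D then f (p (?g x)) else x)" for p x
  have trf: "tr p (f d) = f (p d)" if "d \<in> ?D" for p d using that gf by (simp add: tr_def)
  have trp: "tr p permutes f ` ?D" if p: "p permutes ?D" for p
  proof (rule bij_imp_permutes)
    have "inj_on (tr p) (f ` ?D)"
    proof (rule inj_onI)
      fix x y assume "x \<in> f ` ?D" "y \<in> f ` ?D" and eq: "tr p x = tr p y"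
      then obtain a b where ab: "a \<in> ?D" "b \<in> ?D" "x = f a" "y = f b" by blast
      then have "f (p a) = f (p b)" using eq trf by simp
      then have "p a = p b" using inj ab p by (metis inj_on_def permutes_in_image)
      then show "x = y" using ab p by (metis permutes_def)
    qed
    moreover have "tr p ` f ` ?D \<subseteq> f ` ?D" using trf p by (auto simp: permutes_in_image)
    ultimately show "bij_betw (tr p) (f ` ?D) (f ` ?D)"
      using finite_darts by (simp add: bij_betw_def endo_inj_surj)
  qed (simp add: tr_def)
  define m' :: "nat cmap" where
    "m' = \<lparr>darts = f ` ?D, rot = tr (rot m), opp = tr (opp m), root_dart = f (root_dart m)\<rparr>"
  have s: "darts m' = f ` ?D" "rot m' = tr (rot m)" "opp m' = tr (opp m)" "root_dart m' = f (root_dart m)"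
    by (simp_all add: m'_def)
  have iso: "map_iso f m m'" unfolding map_iso_def s using inj trf by (simp add: bij_betw_def)
  have conn: "(f d, f e) \<in> ({(x, rot m' x) |x. True} \<union> {(x, opp m' x) |x. True})\<^sup>* \<and> e \<in> ?D"
    if "d \<in> ?D" "(d, e) \<in> ({(x, rot m x) |x. True} \<union> {(x, opp m x) |x. True})\<^sup>*" for d e
    using that(2)
  proof induction
    case base
    then show ?case using that(1) by simp
  next
    case (step y z)
    then have "z = rot m y \<or> z = opp m y" "y \<in> ?D" by auto
    then have "(f y, f z) \<in> {(x, rot m' x) |x. True} \<union> {(x, opp m' x) |x. True}" "z \<in> ?D"
      using trf unfolding s by auto
    then show ?case using step.IH by (meson rtrancl.rtrancl_into_rtrancl)
  qed
  have "rooted_map m'"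
    unfolding rooted_map_def
  proof (intro conjI ballI)
    show "finite (darts m')" using finite_darts s by simp
    show "rot m' permutes darts m'" unfolding s using trp rot_permutes by blast
    show "opp m' permutes darts m'" unfolding s using trp opp_permutes by blast
    show "root_dart m' \<in> darts m'" unfolding s using root_in by blast
  next
    fix x assume "x \<in> darts m'"
    then obtain d where d: "d \<in> ?D" "x = f d" unfolding s by blast
    have "f (opp m d) \<noteq> f d" using inj d(1) opp_inv[OF d(1)] by (metis inj_on_def opp_in)
    then show "opp m' x \<noteq> x" unfolding s d(2) using trf[OF d(1)] by simp
    show "opp m' (opp m' x) = x" unfolding s d(2) using trf d(1) by simp
    fix y assume "y \<in> darts m'"
    then obtain e where e: "e \<in> ?D" "y = f e" unfolding s by blast
    have "(d, e) \<in> ({(x, rot m x) |x. True} \<union> {(x, opp m x) |x. True})\<^sup>*"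
      using m d(1) e(1) unfolding rooted_map_def by blast
    from conn[OF d(1) this] show "(x, y) \<in> ({(x, rot m' x) |x. True} \<union> {(x, opp m' x) |x. True})\<^sup>*"
      using d e by simp
  qed
  then show ?thesis using iso by blast
qed

lemma planar_map_iso:
  assumes "planar_map m" "map_iso f m m'" "rooted_map m'"
  shows "planar_map m'"
proof -
  have m: "rooted_map m" using assms(1) by (simp add: planar_map_def)
  have "card (vertices m') = card (vertices m)"
    using vertices_iso[OF m assms(2)] card_iso_image(1)[OF assms(2) vertices_sub[OF m]] by simp
  moreover have "card (faces m') = card (faces m)"
    using faces_iso[OF m assms(2)] card_iso_image(1)[OF assms(2)] by simp
  moreover have "card (edges m') = card (edges m)" using card_edges_iso[OF m assms(2)] .
  ultimately show ?thesis using assms(1,3) by (simp add: planar_map_def)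
qed


section \<open>The bijection\<close>

lemma S_decorated:
  assumes "n > 0" "t \<in> decorated_trees n"
  shows "S_map t \<in> nonsep_maps n" "T_map (S_map t) = t"
proof -
  have t: "decorated t" "tree_edges t = n" using assms(2) by (auto simp: decorated_trees_def)
  note c = closure_map_props[OF t(1)]
  have r: "rooted_map (closure_map t)" using c(4) by (simp add: planar_map_def)
  obtain f and m' :: "nat cmap" where f: "map_iso f (closure_map t) m'" "rooted_map m'" using nat_copy[OF r] by blast
  have p: "planar_map m'" using planar_map_iso[OF c(4) f] .
  \<comment> \<open>The address \<open>[]\<close> stands for the added root edge, so the map has one
    edge more than the tree.\<close>
  have "[] \<in> tree_vertices t" by (simp add: tree_vertices_subt)
  then have "card (tree_vertices t) = Suc (tree_edges t)"
    unfolding tree_edges_def using finite_tree_vertices by (metis card.remove)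
  then have e: "card (edges m') = n + 1" using card_edges_iso[OF r f(1)] c(6) t(2) by simp
  have "\<not> separable m'" using separable_iso[OF r f(1)] c(5) by blast
  \<comment> \<open>\<open>n > 0\<close> provides the second edge; the closure of the one-vertex
    tree is a single edge.\<close>
  then have "nonseparable m'" using p e assms(1) by (simp add: nonseparable_def)
  moreover have S: "S_map t = iso_class m'" unfolding S_map_def by (rule iso_class_eq[OF r f(1)])
  ultimately show "S_map t \<in> nonsep_maps n" using e by (auto simp: nonsep_maps_def)
  have "T_map (S_map t) = dfs_tree m'" unfolding S by (rule T_map_iso_class[OF p])
  also have "\<dots> = dfs_tree (closure_map t)" by (rule dfs_tree_iso[OF r f(1)])
  also have "\<dots> = t" using explored_map.dfs_tree_eq[OF c(1)] by simp
  finally show "T_map (S_map t) = t" .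
qed

text \<open>A representative of \<open>M\<close> and the closure of its tree are tight maps with the
  same tree, hence isomorphic by \<open>tight_iso\<close>.\<close>

lemma T_nonseparable:
  assumes "M \<in> nonsep_maps n"
  shows "T_map M \<in> decorated_trees n" "S_map (T_map M) = M"
proof -
  obtain m :: "nat cmap" where m: "nonseparable m" "card (edges m) = n + 1" "M = iso_class m"
    using assms by (auto simp: nonsep_maps_def)
  have p: "planar_map m" "card (edges m) \<ge> 2" "\<not> separable m" using m(1) by (auto simp: nonseparable_def)
  have r: "rooted_map m" using p(1) by (simp add: planar_map_def)
  obtain forest where fo: "explored_map m forest" "dfs_tree m = erase (hd forest)"
    using explored_map_exists[OF r] by blast
  obtain \<tau> where \<tau>: "forest = [\<tau>]" "decorated (erase \<tau>)" "tight m 0 \<tau>"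
    "support (rot m) (root_dart m) = root_dart m # ups (opp m) (-1) \<tau>"
    using explored_map.nonseparable_tree[OF fo(1) p(1,3,2)] by (elim exE conjE)
  let ?t = "erase \<tau>"
  have T: "T_map M = ?t" using T_map_iso_class[OF p(1)] fo(2) \<tau>(1) m(3) by simp
  note c = closure_map_props[OF \<tau>(2)]
  obtain f where f: "map_iso f m (closure_map ?t)"
    using tight_iso[OF fo(1)[unfolded \<tau>(1)] c(1) _ \<tau>(3) c(2) \<tau>(4) c(3)] by auto
  have "card (tree_vertices ?t) = n + 1" using card_edges_iso[OF r f] c(6) m(2) by simp
  moreover have "[] \<in> tree_vertices ?t" by (simp add: tree_vertices_subt)
  ultimately have "tree_edges ?t = n"
    unfolding tree_edges_def using finite_tree_vertices by (simp add: card_Diff_singleton)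
  then show "T_map M \<in> decorated_trees n" unfolding T using \<tau>(2) by (simp add: decorated_trees_def)
  have "S_map (T_map M) = iso_class (closure_map ?t)" by (simp only: T S_map_def)
  then show "S_map (T_map M) = M" using iso_class_eq[OF r f] m(3) by simp
qed

theorem theorem3:
  fixes n :: nat
  assumes "n > 0"
  shows "bij_betw T_map (nonsep_maps n) (decorated_trees n) \<and>
    (\<forall>M\<in>nonsep_maps n. S_map (T_map M) = M) \<and>
    (\<forall>t\<in>decorated_trees n. T_map (S_map t) = t)"
proof (intro conjI ballI)
  show "bij_betw T_map (nonsep_maps n) (decorated_trees n)"
    by (rule bij_betw_byWitness[where f' = S_map])
      (use S_decorated[OF assms] T_nonseparable in auto)
qed (use S_decorated[OF assms] T_nonseparable in auto)

end
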